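(* For $z\in\mathbb C$, $\tau\in\mathbb H$ and $m,n\in\mathbb Z$, $\varpi(z+m\tau+n,\tau)=(e(z),e(\tau))_m^{-1}\varpi(z,\tau)$. Moreover, for every $A=\begin{pmatrix}a&b\\c&d\end{pmatrix}\in\mathrm{SL}_2(\mathbb Z)$, the function $\sigma_A(z,\tau):=\varpi\!\big(\tfrac{z}{c\tau+d},A\cdot\tau\big)/\varpi(z,\tau)$, defined on $\mathbb C\times\mathbb H$ (so that $\varpi(\frac{z}{c\tau+d},A\cdot\tau)=\sigma_A(z,\tau)\varpi(z,\tau)$), extends to a meromorphic function on $\mathbb C\times\mathcal D_A$, where $\mathcal D_A=\mathbb C\setminus(-\infty,-d/c]$ if $c>0$; $\mathcal D_A=\mathbb C$ if $c=0,d>0$; $\mathcal D_A=\mathbb H$ if $c=0,d<0$; $\mathcal D_A=\mathbb C\setminus[-d/c,\infty)$ if $c<0$.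
   Context: $e(z)=e^{2\pi i z}$, $\mathbb H$ is the upper half plane, $A\cdot\tau=\frac{a\tau+b}{c\tau+d}$. $\varpi(z,\tau)=\prod_{k\ge0}(1-e(z+k\tau))$ for $z\in\mathbb C,\tau\in\mathbb H$. The finite $q$-Pochhammer symbol is $(w,q)_m=\prod_{k=0}^{m-1}(1-wq^k)$ for $m\ge0$ and $(w,q)_m=\prod_{k=1}^{-m}(1-wq^{-k})^{-1}$ for $m<0$. *)

theory Defs
  imports "HOL-Analysis.Analysis"
begin

definition e :: "complex \<Rightarrow> complex" where
  "e z = exp (2 * of_real pi * \<i> * z)"

definition UHP :: "complex set" where
  "UHP = {\<tau>. Im \<tau> > 0}"

definition varpi :: "complex \<Rightarrow> complex \<Rightarrow> complex" where
  "varpi z \<tau> = (\<Prod>k. (1 - e (z + of_nat k * \<tau>)))"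

definition qpoch :: "complex \<Rightarrow> complex \<Rightarrow> int \<Rightarrow> complex" where
  "qpoch w q m =
     (if m \<ge> 0 then (\<Prod>k<nat m. (1 - w * q ^ k))
      else inverse (\<Prod>k\<in>{1..nat (-m)}. (1 - w * q powi (- int k))))"

definition moeb :: "int \<Rightarrow> int \<Rightarrow> int \<Rightarrow> int \<Rightarrow> complex \<Rightarrow> complex" where
  "moeb a b c d \<tau> = (of_int a * \<tau> + of_int b) / (of_int c * \<tau> + of_int d)"

definition DA :: "int \<Rightarrow> int \<Rightarrow> complex set" where
  "DA c d =
     (if c > 0 then - {complex_of_real x | x. x \<le> - real_of_int d / real_of_int c}
      else if c = 0 \<and> d > 0 then UNIV
      else if c = 0 \<and> d < 0 then UHP
      else - {complex_of_real x | x. x \<ge> - real_of_int d / real_of_int c})"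

definition holomorphic2_on :: "(complex \<times> complex \<Rightarrow> complex) \<Rightarrow> (complex \<times> complex) set \<Rightarrow> bool" where
  "holomorphic2_on f U \<longleftrightarrow>
     (\<forall>p\<in>U. \<exists>a b. (f has_derivative (\<lambda>(u, v). a * u + b * v)) (at p))"

text \<open>Meromorphy in two complex variables on an open set U: locally a quotient g/h
  of holomorphic functions on a connected open neighbourhood, with h not identically
  zero there (values of f on the zero set of h are irrelevant).\<close>
definition meromorphic2_on :: "(complex \<times> complex \<Rightarrow> complex) \<Rightarrow> (complex \<times> complex) set \<Rightarrow> bool" where
  "meromorphic2_on f U \<longleftrightarrow> open U \<and>
     (\<forall>p\<in>U. \<exists>V g h. open V \<and> connected V \<and> p \<in> V \<and> V \<subseteq> U \<and>
        holomorphic2_on g V \<and> holomorphic2_on h V \<and> (\<exists>q\<in>V. h q \<noteq> 0) \<and>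
        (\<forall>q\<in>V. h q \<noteq> 0 \<longrightarrow> f q = g q / h q))"

end

theory Submission
  imports Defs "HOL-Complex_Analysis.Complex_Analysis"
begin

text \<open>
  Quasi-periodicity comes from splitting off factors. For the modular quotient, decimating both
  products modulo \<open>c\<close> reduces a matrix with \<open>c > 0\<close> to the inversion
  \<open>\<tau> \<mapsto> -1/\<tau>\<close> at \<open>\<tau>' = c\<tau> + d\<close>, up to finitely many factors \<open>1 - e(\<dots>)\<close>; the case
  \<open>c < 0\<close> follows by the symmetry \<open>(z, \<tau>) \<mapsto> (-cnj z, -cnj \<tau>)\<close>.

  For the inversion, shift \<open>z\<close> so that everything is symmetric about \<open>w = 0\<close>. Away from cancellations the
  zeros and poles of the quotient are the half-integral points of the cones
  \<open>\<plusminus>(\<real>\<^sub>>\<^sub>0 + \<real>\<^sub>>\<^sub>0 \<tau>)\<close>, and the Weierstrass product \<open>P(w, \<tau>)\<close> over such a cone converges for all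
  \<open>\<tau>\<close> off the cut \<open>\<real>\<^sub>\<le>\<^sub>0\<close>. Third logarithmic derivatives in \<open>w\<close> are absolutely
  convergent sums of \<open>2/(w - \<omega>)\<^sup>3\<close> over lattice points, which shows that the quotient is
  \<open>C exp(a w\<^sup>2 + b w) P(w) / P(-w)\<close> on the upper half plane. The functional equation under
  \<open>w \<mapsto> w + 1\<close> gives \<open>a = \<pi>\<i>/(2\<tau>)\<close> and expresses \<open>exp b\<close> by values of \<open>P\<close>, so that \<open>b\<close> extends as
  a logarithm on the cut plane. The distribution relations for \<open>\<tau> \<mapsto> 2\<tau>\<close> and \<open>\<tau> \<mapsto> \<tau>/2\<close> give
  \<open>C\<^sup>3 = exp(-\<pi>\<i>(\<tau> + 1/\<tau>)/8)\<close> without any modularity of the eta function.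
\<close>

section \<open>Holomorphic functions of two variables\<close>

text \<open>The zeros of \<open>varpi z \<tau>\<close>, once recentred, fill the lattice half plane
  made of lines in direction 1; those of the inverted product fill one made of lines in direction
  \<tau>. Their common quadrant, spanned by 1 and -\<tau>, collapses when \<tau> reaches the
  positive reals, and it is exactly this quadrant that cancels in the quotient. The quadrants that
  survive collapse only on the cut. Sums of lower order than \<open>1/(w - \<omega>)^3\<close> over
  a quadrant fail to converge absolutely, so rows and columns could not be exchanged. The price of
  differentiating so often is an unknown quadratic polynomial, produced for each \<tau> separately
  and hence without any regularity in \<tau>. The main obstacle is its linear coefficient b: exp b
  fixes b only modulo 2 pi i, and the integer left open might jump with \<tau>. A second relation,
  from the shift by \<tau>, gives exp(b \<tau>); its modulus exhibits that integer as a continuous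
  function, hence as a constant. The cube relation leaves C ambiguous by a cube root of unity, which
  is constant by the same connectedness argument.\<close>

definition hol2_at :: "(complex \<times> complex \<Rightarrow> complex) \<Rightarrow> complex \<times> complex \<Rightarrow> bool" where
  "hol2_at f p \<longleftrightarrow> (\<exists>a b. (f has_derivative (\<lambda>(u, v). a * u + b * v)) (at p))"

lemma holomorphic2_on_iff: "holomorphic2_on f U \<longleftrightarrow> (\<forall>p\<in>U. hol2_at f p)"
  by (simp add: holomorphic2_on_def hol2_at_def)

lemma hol2_at_const: "hol2_at (\<lambda>_. k) p"
  unfolding hol2_at_def
  by (rule exI[of _ 0], rule exI[of _ 0]) (auto simp: case_prod_beta')

lemma hol2_at_fst: "hol2_at fst p"
  unfolding hol2_at_def
  by (rule exI[of _ 1], rule exI[of _ 0])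
     (auto simp: case_prod_beta' intro!: derivative_eq_intros)

lemma hol2_at_snd: "hol2_at snd p"
  unfolding hol2_at_def
  by (rule exI[of _ 0], rule exI[of _ 1])
     (auto simp: case_prod_beta' intro!: derivative_eq_intros)

lemma hol2_at_add:
  assumes "hol2_at f p" "hol2_at g p"
  shows "hol2_at (\<lambda>q. f q + g q) p"
proof -
  from assms obtain a b a' b' where
    "(f has_derivative (\<lambda>(u, v). a * u + b * v)) (at p)"
    "(g has_derivative (\<lambda>(u, v). a' * u + b' * v)) (at p)"
    unfolding hol2_at_def by blast
  from has_derivative_add[OF this] show ?thesis
    unfolding hol2_at_def
    by (intro exI[of _ "a + a'"] exI[of _ "b + b'"])
       (simp add: case_prod_beta' algebra_simps)
qed

lemma hol2_at_mult:
  assumes "hol2_at f p" "hol2_at g p"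
  shows "hol2_at (\<lambda>q. f q * g q) p"
proof -
  from assms obtain a b a' b' where
    "(f has_derivative (\<lambda>(u, v). a * u + b * v)) (at p)"
    "(g has_derivative (\<lambda>(u, v). a' * u + b' * v)) (at p)"
    unfolding hol2_at_def by blast
  from has_derivative_mult[OF this] show ?thesis
    unfolding hol2_at_def
    by (intro exI[of _ "f p * a' + a * g p"] exI[of _ "f p * b' + b * g p"])
       (simp add: case_prod_beta' algebra_simps)
qed

lemma hol2_at_compose_field:
  assumes "hol2_at f p" "g field_differentiable at (f p)"
  shows "hol2_at (\<lambda>q. g (f q)) p"
proof -
  from assms obtain a b D where
    "(f has_derivative (\<lambda>(u, v). a * u + b * v)) (at p)"
    "(g has_field_derivative D) (at (f p))"
    unfolding hol2_at_def field_differentiable_def by blast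
  from has_derivative_compose[OF this(1) this(2)[unfolded has_field_derivative_def]]
  show ?thesis unfolding hol2_at_def
    by (intro exI[of _ "D * a"] exI[of _ "D * b"])
       (simp add: case_prod_beta' algebra_simps)
qed

lemma hol2_at_compose:
  assumes "hol2_at F (f p, g p)" "hol2_at f p" "hol2_at g p"
  shows "hol2_at (\<lambda>q. F (f q, g q)) p"
proof -
  from assms obtain a b a' b' A B where
    f: "(f has_derivative (\<lambda>(u, v). a * u + b * v)) (at p)" and
    g: "(g has_derivative (\<lambda>(u, v). a' * u + b' * v)) (at p)" and
    F: "(F has_derivative (\<lambda>(u, v). A * u + B * v)) (at (f p, g p))"
    unfolding hol2_at_def by blast
  from has_derivative_compose[OF has_derivative_Pair[OF f g], of F] F
  have "((\<lambda>q. F (f q, g q)) has_derivative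
      (\<lambda>h. case (case h of (u, v) \<Rightarrow> a * u + b * v, case h of (u, v) \<Rightarrow> a' * u + b' * v) of
          (u, v) \<Rightarrow> A * u + B * v)) (at p)"
    by blast
  thus ?thesis unfolding hol2_at_def
    by (intro exI[of _ "A * a + B * a'"] exI[of _ "A * b + B * b'"])
       (simp add: case_prod_beta' algebra_simps)
qed

lemma hol2_at_uminus: "hol2_at f p \<Longrightarrow> hol2_at (\<lambda>q. - f q) p"
  using hol2_at_mult[OF hol2_at_const, of f p "-1"] by simp

lemma hol2_at_diff: "hol2_at f p \<Longrightarrow> hol2_at g p \<Longrightarrow> hol2_at (\<lambda>q. f q - g q) p"
  using hol2_at_add[of f p "\<lambda>q. - g q"] hol2_at_uminus[of g p] by simp

lemma hol2_at_divide:
  assumes "hol2_at f p" "hol2_at g p" "g p \<noteq> 0"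
  shows "hol2_at (\<lambda>q. f q / g q) p"
proof -
  have "hol2_at (\<lambda>q. inverse (g q)) p"
    using hol2_at_compose_field[OF assms(2), of inverse] assms(3)
    by (simp add: field_differentiable_inverse)
  from hol2_at_mult[OF assms(1) this] show ?thesis by (simp add: divide_inverse)
qed

lemma hol2_at_power: "hol2_at f p \<Longrightarrow> hol2_at (\<lambda>q. f q ^ n) p"
  by (induction n) (simp_all add: hol2_at_const hol2_at_mult)

lemma hol2_at_exp: "hol2_at f p \<Longrightarrow> hol2_at (\<lambda>q. exp (f q)) p"
  using hol2_at_compose_field[of f p exp] by (simp add: field_differentiable_within_exp)

lemma hol2_at_e: "hol2_at f p \<Longrightarrow> hol2_at (\<lambda>q. e (f q)) p"
  unfolding e_def by (intro hol2_at_exp hol2_at_mult hol2_at_const)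

lemma hol2_at_prod:
  "(\<And>i. i \<in> I \<Longrightarrow> hol2_at (f i) p) \<Longrightarrow> hol2_at (\<lambda>q. \<Prod>i\<in>I. f i q) p"
  by (induction I rule: infinite_finite_induct) (simp_all add: hol2_at_const hol2_at_mult)

lemmas hol2_intros = hol2_at_const hol2_at_fst hol2_at_snd hol2_at_add hol2_at_mult
  hol2_at_uminus hol2_at_diff hol2_at_divide hol2_at_power hol2_at_exp hol2_at_e hol2_at_prod

lemma hol2_at_imp_isCont: "hol2_at f p \<Longrightarrow> isCont f p"
  unfolding hol2_at_def using has_derivative_continuous by blast

lemma holomorphic2_on_imp_continuous_on: "holomorphic2_on f U \<Longrightarrow> continuous_on U f"
  by (auto simp: holomorphic2_on_iff intro!: continuous_at_imp_continuous_on hol2_at_imp_isCont)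

lemma hol2_has_derivative_slices:
  assumes "(f has_derivative (\<lambda>(u, v). a * u + b * v)) (at (z, t))"
  shows "((\<lambda>x. f (x, t)) has_field_derivative a) (at z)"
    and "((\<lambda>x. f (z, x)) has_field_derivative b) (at t)"
proof -
  have "((\<lambda>x. (x, t)) has_derivative (\<lambda>h. (h, 0))) (at z)"
    and "((\<lambda>x. (z, x)) has_derivative (\<lambda>h. (0, h))) (at t)"
    by (auto intro!: derivative_eq_intros)
  from this[THEN has_derivative_compose, of f, OF assms]
  show "((\<lambda>x. f (x, t)) has_field_derivative a) (at z)"
    and "((\<lambda>x. f (z, x)) has_field_derivative b) (at t)"
    by (simp_all add: has_field_derivative_def)
qed

lemma hol2_at_compose_slice:
  assumes "hol2_at F (f x, g x)" "f field_differentiable at x" "g field_differentiable at x"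
  shows "(\<lambda>y. F (f y, g y)) field_differentiable at x"
proof -
  \<comment> \<open>A function of one variable enters the two-variable chain rule as a function of a
    pair that ignores its second entry; the entry 0 is a dummy.\<close>
  have "hol2_at (\<lambda>q. F (f (fst q), g (fst q))) (x, 0)"
    by (rule hol2_at_compose)
       (use assms hol2_at_compose_field[OF hol2_at_fst, of f "(x, 0)"] hol2_at_compose_field[OF hol2_at_fst, of g "(x, 0)"] in auto)
  then obtain a b where "((\<lambda>q. F (f (fst q), g (fst q))) has_derivative (\<lambda>(u, v). a * u + b * v)) (at (x, 0))"
    unfolding hol2_at_def by blast
  from hol2_has_derivative_slices(1)[OF this] show ?thesis
    by (auto simp: field_differentiable_def)
qed

text \<open>Cauchy's inequality on one-dimensional slices carries uniform convergence over to the
  partial derivatives. Termwise differentiation of sequences then gives total differentiability of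
  the limit, and the derivative is complex linear because its coefficients are limits of complex
  partials.\<close>

lemma hol2_uniform_limit:
  assumes U: "open U" and f: "\<And>n. holomorphic2_on (f n) U"
    and lim: "\<And>K. compact K \<Longrightarrow> K \<subseteq> U \<Longrightarrow> uniform_limit K f g sequentially"
  shows "holomorphic2_on g U"
  unfolding holomorphic2_on_iff
proof
  fix p0 assume "p0 \<in> U"
  then obtain R where R: "R > 0" "cball p0 R \<subseteq> U"
    using U open_contains_cball by blast
  \<comment> \<open>Half the radius for \<open>S\<close>, so that discs of radius R/2 in either
    coordinate around a point of \<open>S\<close> stay inside \<open>K\<close>.\<close>
  define K S where "K = cball p0 R" and "S = ball p0 (R/2)"
  have limK: "uniform_limit K f g sequentially"
    by (rule lim) (use R in \<open>auto simp: K_def\<close>)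
  have inK1: "(z, snd p) \<in> K" if "p \<in> S" "z \<in> cball (fst p) (R/2)" for p z
  proof -
    have "dist p (z, snd p) = dist (fst p) z" by (simp add: dist_prod_def)
    thus ?thesis using that dist_triangle[of p0 "(z, snd p)" p] by (simp add: K_def S_def)
  qed
  have inK2: "(fst p, w) \<in> K" if "p \<in> S" "w \<in> cball (snd p) (R/2)" for p w
  proof -
    have "dist p (fst p, w) = dist (snd p) w" by (simp add: dist_prod_def)
    thus ?thesis using that dist_triangle[of p0 "(fst p, w)" p] by (simp add: K_def S_def)
  qed
  have KU: "K \<subseteq> U" using R by (simp add: K_def)
  have SK: "p \<in> K" if "p \<in> S" for p using that R by (auto simp: K_def S_def)
  obtain a b where ab: "(f n has_derivative (\<lambda>(u, v). a n p * u + b n p * v)) (at p)"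
    if "p \<in> U" for n p
    using f unfolding holomorphic2_on_def by metis
  define A where "A p = deriv (\<lambda>x. g (x, snd p)) (fst p)" for p
  define B where "B p = deriv (\<lambda>x. g (fst p, x)) (snd p)" for p
  have slice: "norm (deriv (h n) z - deriv h' z) \<le> M / (R/2)"
    if hol: "\<And>n w. w \<in> cball z (R/2) \<Longrightarrow> h n field_differentiable at w"
      and ul: "uniform_limit (cball z (R/2)) h h' sequentially"
      and M: "\<And>w. w \<in> cball z (R/2) \<Longrightarrow> norm (h n w - h' w) \<le> M"
    for h :: "nat \<Rightarrow> complex \<Rightarrow> complex" and h' z M n
  proof -
    have h: "h n holomorphic_on cball z (R/2)" for n
      unfolding holomorphic_on_def using hol by (blast intro: field_differentiable_at_within)
    have hb: "h n holomorphic_on ball z (R/2)" for n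
      using h holomorphic_on_subset ball_subset_cball by blast
    have hc: "continuous_on (cball z (R/2)) (h n)" for n
      using h holomorphic_on_imp_continuous_on by blast
    obtain h': "continuous_on (cball z (R/2)) h'" "h' holomorphic_on ball z (R/2)"
      by (rule holomorphic_uniform_limit[OF _ ul]) (auto intro: always_eventually hb hc)
    have "norm ((deriv ^^ 1) (\<lambda>w. h n w - h' w) z) \<le> fact 1 * M / (R/2) ^ 1"
      by (rule Cauchy_inequality)
         (use R in \<open>auto intro!: holomorphic_intros continuous_intros hb hc h' M simp: dist_norm\<close>)
    moreover have "deriv (\<lambda>w. h n w - h' w) z = deriv (h n) z - deriv h' z"
      using R holomorphic_on_imp_differentiable_at[OF hb[of n], of z]
        holomorphic_on_imp_differentiable_at[OF h'(2), of z]
      by (intro deriv_diff) auto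
    ultimately show ?thesis by simp
  qed
  have est: "norm (a n p - A p) \<le> M / (R/2)" "norm (b n p - B p) \<le> M / (R/2)"
    if "p \<in> S" and M: "\<And>q. q \<in> K \<Longrightarrow> norm (f n q - g q) \<le> M" for n p M
  proof -
    have d1: "((\<lambda>x. f n (x, snd p)) has_field_derivative a n (w, snd p)) (at w)"
      if "w \<in> cball (fst p) (R/2)" for n w
      using hol2_has_derivative_slices(1)[OF ab] inK1[OF \<open>p \<in> S\<close> that] KU by blast
    have d2: "((\<lambda>x. f n (fst p, x)) has_field_derivative b n (fst p, w)) (at w)"
      if "w \<in> cball (snd p) (R/2)" for n w
      using hol2_has_derivative_slices(2)[OF ab] inK2[OF \<open>p \<in> S\<close> that] KU by blast
    have "norm (deriv (\<lambda>x. f n (x, snd p)) (fst p) - A p) \<le> M / (R/2)"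
      unfolding A_def
    proof (rule slice)
      show "uniform_limit (cball (fst p) (R/2)) (\<lambda>n x. f n (x, snd p)) (\<lambda>x. g (x, snd p)) sequentially"
        by (rule uniform_limit_compose'[OF limK]) (use inK1[OF \<open>p \<in> S\<close>] in blast)
    next
      fix n w assume "w \<in> cball (fst p) (R/2)"
      from d1[OF this] show "(\<lambda>x. f n (x, snd p)) field_differentiable at w"
        unfolding field_differentiable_def by blast
    qed (use M inK1[OF \<open>p \<in> S\<close>] in blast)
    moreover have "deriv (\<lambda>x. f n (x, snd p)) (fst p) = a n p"
      using d1[of "fst p" n] R by (auto dest: DERIV_imp_deriv)
    ultimately show "norm (a n p - A p) \<le> M / (R/2)" by simp
    have "norm (deriv (\<lambda>x. f n (fst p, x)) (snd p) - B p) \<le> M / (R/2)"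
      unfolding B_def
    proof (rule slice)
      show "uniform_limit (cball (snd p) (R/2)) (\<lambda>n x. f n (fst p, x)) (\<lambda>x. g (fst p, x)) sequentially"
        by (rule uniform_limit_compose'[OF limK]) (use inK2[OF \<open>p \<in> S\<close>] in blast)
    next
      fix n w assume "w \<in> cball (snd p) (R/2)"
      from d2[OF this] show "(\<lambda>x. f n (fst p, x)) field_differentiable at w"
        unfolding field_differentiable_def by blast
    qed (use M inK2[OF \<open>p \<in> S\<close>] in blast)
    moreover have "deriv (\<lambda>x. f n (fst p, x)) (snd p) = b n p"
      using d2[of "snd p" n] R by (auto dest: DERIV_imp_deriv)
    ultimately show "norm (b n p - B p) \<le> M / (R/2)" by simp
  qed
  have "\<exists>g1. \<forall>x\<in>S. (\<lambda>n. f n x) \<longlonglongrightarrow> g1 x \<and>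
      (g1 has_derivative (\<lambda>(u, v). A x * u + B x * v)) (at x within S)"
  proof (rule has_derivative_sequence)
    show "convex S" by (simp add: S_def)
    show "(f n has_derivative (\<lambda>(u, v). a n x * u + b n x * v)) (at x within S)" if "x \<in> S" for n x
      using ab that SK KU by (blast intro: has_derivative_at_withinI)
    show "p0 \<in> S" using R by (simp add: S_def)
    show "(\<lambda>n. f n p0) \<longlonglongrightarrow> g p0"
      by (rule tendsto_uniform_limitI[OF limK]) (use R in \<open>auto simp: K_def\<close>)
    fix \<epsilon> :: real assume "\<epsilon> > 0"
    \<comment> \<open>Cauchy's inequality divides by R/2, so each partial is off by at most
      \<epsilon>/2 and the two together by \<epsilon>.\<close>
    hence "\<epsilon> * R / 4 > 0" using R by simp
    from uniform_limitD[OF limK this]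
    show "\<forall>\<^sub>F n in sequentially. \<forall>x\<in>S. \<forall>h. norm ((case h of (u, v) \<Rightarrow> a n x * u + b n x * v) -
        (case h of (u, v) \<Rightarrow> A x * u + B x * v)) \<le> \<epsilon> * norm h"
    proof eventually_elim
      case (elim n)
      show ?case
      proof (intro ballI allI)
        fix x h :: "complex \<times> complex" assume "x \<in> S"
        have M: "norm (f n q - g q) \<le> \<epsilon> * R / 4" if "q \<in> K" for q
          using elim that by (auto simp: dist_norm intro: less_imp_le)
        have ea: "norm (a n x - A x) \<le> \<epsilon> / 2" and eb: "norm (b n x - B x) \<le> \<epsilon> / 2"
          using est[OF \<open>x \<in> S\<close> M] R by simp_all
        obtain u v where h: "h = (u, v)" by (cases h)
        have "norm (a n x * u + b n x * v - (A x * u + B x * v)) =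
              norm ((a n x - A x) * u + (b n x - B x) * v)"
          by (simp add: algebra_simps)
        also have "\<dots> \<le> norm (a n x - A x) * norm u + norm (b n x - B x) * norm v"
          by (metis norm_mult norm_triangle_ineq)
        also have "\<dots> \<le> \<epsilon> / 2 * norm h + \<epsilon> / 2 * norm h"
          using ea eb norm_fst_le[of u v] norm_snd_le[of v u] \<open>\<epsilon> > 0\<close>
          by (intro add_mono mult_mono) (auto simp: h)
        finally show "norm ((case h of (u, v) \<Rightarrow> a n x * u + b n x * v) -
          (case h of (u, v) \<Rightarrow> A x * u + B x * v)) \<le> \<epsilon> * norm h"
          by (simp add: h)
      qed
    qed
  qed
  then obtain g1 where g1: "\<And>x. x \<in> S \<Longrightarrow> (\<lambda>n. f n x) \<longlonglongrightarrow> g1 x"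
      "\<And>x. x \<in> S \<Longrightarrow> (g1 has_derivative (\<lambda>(u, v). A x * u + B x * v)) (at x within S)"
    by blast
  have p0: "p0 \<in> S" "open S" using R by (auto simp: S_def)
  have "g1 x = g x" if "x \<in> S" for x
    using LIMSEQ_unique[OF g1(1)[OF that] tendsto_uniform_limitI[OF limK SK[OF that]]] .
  hence "(g has_derivative (\<lambda>(u, v). A p0 * u + B p0 * v)) (at p0)"
    using g1(2)[OF p0(1)] p0 has_derivative_transform_within_open[of g1 _ p0 UNIV S g]
    by (simp add: at_within_open[OF p0])
  thus "hol2_at g p0" unfolding hol2_at_def by blast
qed

section \<open>Infinite products of holomorphic functions\<close>

lemma uniform_limit_prodinf_M_test:
  fixes f :: "nat \<Rightarrow> 'a :: topological_space \<Rightarrow> complex"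
  assumes K: "compact K" and cont: "\<And>n. continuous_on K (f n)"
    and M: "summable M" "\<And>n p. n \<ge> N \<Longrightarrow> p \<in> K \<Longrightarrow> norm (f n p - 1) \<le> M n"
  shows "\<And>p. p \<in> K \<Longrightarrow> convergent_prod (\<lambda>n. f n p)"
    and "uniform_limit K (\<lambda>n p. \<Prod>k<n. f k p) (\<lambda>p. \<Prod>k. f k p) sequentially"
proof -
  \<comment> \<open>The majorant is assumed only from \<open>N\<close> on: the estimate for
    Weierstrass factors holds only once their arguments are small.\<close>
  have ev: "\<forall>\<^sub>F n in sequentially. \<forall>p\<in>K. norm (norm (f n p - 1)) \<le> M n"
    using eventually_ge_at_top[of N] by eventually_elim (use M in auto)
  have "uniformly_convergent_on K (\<lambda>n p. \<Sum>k<n. norm (f k p - 1))"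
    by (rule Weierstrass_m_test'_ev[OF ev M(1)])
  hence uc: "uniformly_convergent_on K (\<lambda>n p. \<Prod>k<n. f k p)"
    by (intro uniformly_convergent_on_prod' cont K)
  show cp: "convergent_prod (\<lambda>n. f n p)" if "p \<in> K" for p
  proof -
    have "summable (\<lambda>n. norm (f n p - 1))"
      by (rule summable_comparison_test_ev[OF _ M(1)]) (use ev that in \<open>auto elim: eventually_mono\<close>)
    thus ?thesis
      by (intro abs_convergent_prod_imp_convergent_prod summable_imp_abs_convergent_prod)
  qed
  obtain l where l: "uniform_limit K (\<lambda>n p. \<Prod>k<n. f k p) l sequentially"
    using uc unfolding uniformly_convergent_on_def by blast
  have "l p = (\<Prod>k. f k p)" if "p \<in> K" for p
    using LIMSEQ_unique[OF tendsto_uniform_limitI[OF l that]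
      LIMSEQ_lessThan_iff_atMost[THEN iffD2, OF convergent_prod_LIMSEQ[OF cp[OF that]]]] .
  hence eq: "uniform_limit K (\<lambda>n p. \<Prod>k<n. f k p) l sequentially \<longleftrightarrow>
    uniform_limit K (\<lambda>n p. \<Prod>k<n. f k p) (\<lambda>p. \<Prod>k. f k p) sequentially"
    by (intro uniform_limit_cong') auto
  show "uniform_limit K (\<lambda>n p. \<Prod>k<n. f k p) (\<lambda>p. \<Prod>k. f k p) sequentially"
    using l eq by (rule iffD1[rotated])
qed

lemma holomorphic2_on_prodinf:
  assumes U: "open U" and f: "\<And>n. holomorphic2_on (f n) U"
    and M: "\<And>K. compact K \<Longrightarrow> K \<subseteq> U \<Longrightarrow>
       \<exists>M N. summable M \<and> (\<forall>n\<ge>N. \<forall>p\<in>K. norm (f n p - 1) \<le> M n)"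
  shows "holomorphic2_on (\<lambda>p. \<Prod>k. f k p) U"
proof (rule hol2_uniform_limit[OF U])
  show "holomorphic2_on (\<lambda>p. \<Prod>k<n. f k p) U" for n
    using f by (auto simp: holomorphic2_on_iff intro!: hol2_at_prod)
  fix K assume K: "compact K" "K \<subseteq> U"
  obtain M N where "summable M" "\<forall>n\<ge>N. \<forall>p\<in>K. norm (f n p - 1) \<le> M n"
    using M[OF K] by blast
  thus "uniform_limit K (\<lambda>n p. \<Prod>k<n. f k p) (\<lambda>p. \<Prod>k. f k p) sequentially"
    using K(1) continuous_on_subset[OF holomorphic2_on_imp_continuous_on[OF f] K(2)]
    by (intro uniform_limit_prodinf_M_test(2)) auto
qed

lemma prodinf_eq_0_iff:
  fixes f :: "nat \<Rightarrow> complex"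
  assumes "convergent_prod f"
  shows "prodinf f = 0 \<longleftrightarrow> (\<exists>n. f n = 0)"
proof
  assume "prodinf f = 0"
  thus "\<exists>n. f n = 0" using prodinf_nonzero[OF assms] by blast
next
  assume "\<exists>n. f n = 0"
  then obtain n where "f n = 0" by blast
  have "(\<lambda>k. \<Prod>i\<le>k. f i) \<longlonglongrightarrow> 0"
    by (rule tendsto_eventually) (use \<open>f n = 0\<close> in \<open>auto intro!: eventually_mono[OF eventually_ge_at_top[of n]]\<close>)
  thus "prodinf f = 0"
    using LIMSEQ_unique[OF convergent_prod_LIMSEQ[OF assms]] by simp
qed

section \<open>Elementary properties of the product\<close>

lemma e_add: "e (x + y) = e x * e y"
  by (simp add: e_def ring_distribs exp_add)

lemma e_0 [simp]: "e 0 = 1"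
  by (simp add: e_def)

lemma e_half: "e (1/2) = -1"
  by (simp add: e_def exp_pi_i')

lemma norm_e: "norm (e z) = exp (- (2 * pi * Im z))"
  by (simp add: e_def)

lemma e_eq_1_iff: "e z = 1 \<longleftrightarrow> (\<exists>n::int. z = of_int n)"
proof -
  have *: "Re (2 * complex_of_real pi * \<i> * z) = - 2 * pi * Im z"
    "Im (2 * complex_of_real pi * \<i> * z) = 2 * pi * Re z" by auto
  show ?thesis
    unfolding e_def exp_eq_1 * by (auto simp: complex_eq_iff)
qed

lemma e_of_int [simp]: "e (of_int n) = 1"
  using e_eq_1_iff by blast

lemma e_add_of_int [simp]: "e (z + of_int n) = e z"
  by (simp add: e_add)

lemma e_of_nat_mult: "e (of_nat k * z) = e z ^ k"
  by (simp add: e_def exp_of_nat_mult[symmetric] mult_ac)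

lemma e_minus: "e (- z) = inverse (e z)"
  by (simp add: e_def exp_minus)

lemma e_nonzero [simp]: "e z \<noteq> 0"
  by (simp add: e_def)

lemma open_UHP: "open UHP"
  unfolding UHP_def by (simp add: open_halfspace_Im_gt)

lemma connected_UHP: "connected UHP"
  unfolding UHP_def by (simp add: convex_connected convex_halfspace_Im_gt)

lemma open_UNIV_Times_UHP: "open (UNIV \<times> UHP :: (complex \<times> complex) set)"
  by (intro open_Times open_UHP open_UNIV)

lemma compact_bounds_UHP:
  assumes "compact K" "K \<subseteq> UNIV \<times> UHP"
  obtains B \<delta> where "\<delta> > 0" "\<And>p. p \<in> K \<Longrightarrow> \<delta> \<le> Im (snd p)" "\<And>p. p \<in> K \<Longrightarrow> norm (fst p) \<le> B"
proof (cases "K = {}")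
  case False
  have "continuous_on K (\<lambda>p. Im (snd p))" by (intro continuous_intros)
  from continuous_attains_inf[OF assms(1) False this]
  obtain p0 where p0: "p0 \<in> K" "\<And>p. p \<in> K \<Longrightarrow> Im (snd p0) \<le> Im (snd p)" by blast
  have "bounded (fst ` K)"
    by (intro compact_imp_bounded compact_continuous_image assms continuous_intros)
  then obtain B where "\<And>p. p \<in> K \<Longrightarrow> norm (fst p) \<le> B" by (auto simp: bounded_iff)
  with p0 assms(2) that[of "Im (snd p0)" B] show ?thesis by (auto simp: UHP_def)
qed (use that[of 1 0] in auto)

text \<open>On a compact set \<delta> \<le> Im \<tau> and -B \<le> Im z, so a geometric series of
  ratio exp(-2 pi \<delta>) is a majorant.\<close>

lemma varpi_M_test:
  assumes "compact K" "K \<subseteq> UNIV \<times> UHP"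
  shows "\<exists>M N. summable M \<and> (\<forall>n\<ge>N. \<forall>p\<in>K. norm (1 - e (fst p + of_nat n * snd p) - 1) \<le> M n)"
proof -
  from compact_bounds_UHP[OF assms] obtain B \<delta> where *: "\<delta> > 0"
    "\<And>p. p \<in> K \<Longrightarrow> \<delta> \<le> Im (snd p)" "\<And>p. p \<in> K \<Longrightarrow> norm (fst p) \<le> B" by metis
  define M where "M n = exp (2 * pi * B) * exp (- (2 * pi * \<delta>)) ^ n" for n :: nat
  have "summable M" unfolding M_def
    by (intro summable_mult summable_geometric) (use * in auto)
  moreover have "norm (1 - e (fst p + of_nat n * snd p) - 1) \<le> M n" if "p \<in> K" for n p
  proof -
    have "- B \<le> Im (fst p)"
      using *(3)[OF that] abs_Im_le_cmod[of "fst p"] by linarith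
    moreover have "real n * \<delta> \<le> real n * Im (snd p)"
      using *(2)[OF that] by (intro mult_left_mono) auto
    ultimately have "2 * pi * (real n * \<delta> - B) \<le> 2 * pi * (Im (fst p) + real n * Im (snd p))"
      by (intro mult_left_mono) auto
    hence "norm (e (fst p + of_nat n * snd p)) \<le> exp (2 * pi * B + real n * (- (2 * pi * \<delta>)))"
      unfolding norm_e by (simp add: algebra_simps)
    also have "\<dots> = M n" by (simp only: M_def exp_add exp_of_nat_mult)
    finally show ?thesis by simp
  qed
  ultimately show ?thesis by blast
qed

lemma holomorphic2_on_varpi: "holomorphic2_on (\<lambda>p. varpi (fst p) (snd p)) (UNIV \<times> UHP)"
  unfolding varpi_def
  by (rule holomorphic2_on_prodinf[OF open_UNIV_Times_UHP _ varpi_M_test])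
     (auto simp: holomorphic2_on_iff intro!: hol2_intros)

lemma hol2_at_varpi:
  assumes "hol2_at f p" "hol2_at g p" "g p \<in> UHP"
  shows "hol2_at (\<lambda>q. varpi (f q) (g q)) p"
  using hol2_at_compose[OF _ assms(1,2), of "\<lambda>p. varpi (fst p) (snd p)"]
    holomorphic2_on_varpi assms(3) by (simp add: holomorphic2_on_iff)

lemma uniform_limit_varpi:
  assumes "\<tau> \<in> UHP" "compact K"
  shows "\<And>z. convergent_prod (\<lambda>k. 1 - e (z + of_nat k * \<tau>))"
    and "uniform_limit K (\<lambda>n z. \<Prod>k<n. 1 - e (z + of_nat k * \<tau>)) (\<lambda>z. varpi z \<tau>) sequentially"
proof -
  have *: "convergent_prod (\<lambda>k. 1 - e (fst p + of_nat k * snd p))"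
    "uniform_limit (L \<times> {\<tau>}) (\<lambda>n p. \<Prod>k<n. 1 - e (fst p + of_nat k * snd p))
       (\<lambda>p. \<Prod>k. 1 - e (fst p + of_nat k * snd p)) sequentially"
    if "compact L" "p \<in> L \<times> {\<tau>}" for L and p :: "complex \<times> complex"
  proof -
    have L: "compact (L \<times> {\<tau>})" "L \<times> {\<tau>} \<subseteq> UNIV \<times> UHP"
      using that assms by (auto intro!: compact_Times)
    obtain M N where M: "summable M"
      "\<forall>n\<ge>N. \<forall>p\<in>L \<times> {\<tau>}. norm (1 - e (fst p + of_nat n * snd p) - 1) \<le> M n"
      using varpi_M_test[OF L] by blast
    have c: "continuous_on (L \<times> {\<tau>}) (\<lambda>p. 1 - e (fst p + of_nat n * snd p))" for n
      unfolding e_def by (intro continuous_intros)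
    show "convergent_prod (\<lambda>k. 1 - e (fst p + of_nat k * snd p))"
      "uniform_limit (L \<times> {\<tau>}) (\<lambda>n p. \<Prod>k<n. 1 - e (fst p + of_nat k * snd p))
       (\<lambda>p. \<Prod>k. 1 - e (fst p + of_nat k * snd p)) sequentially"
      using uniform_limit_prodinf_M_test[of "L \<times> {\<tau>}" "\<lambda>n p. 1 - e (fst p + of_nat n * snd p)" M N,
          OF L(1) c M(1)] M(2) that(2) by blast+
  qed
  show "convergent_prod (\<lambda>k. 1 - e (z + of_nat k * \<tau>))" for z
    using *(1)[of "{z}" "(z, \<tau>)"] by simp
  show "uniform_limit K (\<lambda>n z. \<Prod>k<n. 1 - e (z + of_nat k * \<tau>)) (\<lambda>z. varpi z \<tau>) sequentially"
  proof (cases "K = {}")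
    case False
    then obtain z where "z \<in> K" by blast
    from uniform_limit_compose'[OF *(2)[OF assms(2), of "(z, \<tau>)"], of "\<lambda>z. (z, \<tau>)" K] \<open>z \<in> K\<close>
    show ?thesis by (auto simp: varpi_def)
  qed auto
qed

lemma varpi_LIMSEQ:
  assumes "\<tau> \<in> UHP"
  shows "(\<lambda>n. \<Prod>k<n. 1 - e (z + of_nat k * \<tau>)) \<longlonglongrightarrow> varpi z \<tau>"
  using tendsto_uniform_limitI[OF uniform_limit_varpi(2)[OF assms, of "{z}"], of z] by simp

lemma varpi_eq_0_iff:
  assumes "\<tau> \<in> UHP"
  shows "varpi z \<tau> = 0 \<longleftrightarrow> (\<exists>(n::int) (k::nat). z = of_int n - of_nat k * \<tau>)"
proof -
  have "varpi z \<tau> = 0 \<longleftrightarrow> (\<exists>k. e (z + of_nat k * \<tau>) = 1)"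
    unfolding varpi_def
    by (subst prodinf_eq_0_iff[OF uniform_limit_varpi(1)[OF assms compact_empty]])
       (auto simp: right_minus_eq)
  thus ?thesis by (auto simp: e_eq_1_iff algebra_simps)
qed

lemma varpi_shift:
  assumes "\<tau> \<in> UHP"
  shows "varpi z \<tau> = (1 - e z) * varpi (z + \<tau>) \<tau>"
proof -
  have "(\<lambda>n. (1 - e z) * (\<Prod>k<n. 1 - e ((z + \<tau>) + of_nat k * \<tau>))) \<longlonglongrightarrow> (1 - e z) * varpi (z + \<tau>) \<tau>"
    by (intro tendsto_intros varpi_LIMSEQ assms)
  also have "(\<lambda>n. (1 - e z) * (\<Prod>k<n. 1 - e ((z + \<tau>) + of_nat k * \<tau>))) =
    (\<lambda>n. \<Prod>k<Suc n. 1 - e (z + of_nat k * \<tau>))"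
    by (simp add: prod.lessThan_Suc_shift algebra_simps del: prod.lessThan_Suc)
  finally show ?thesis
    using LIMSEQ_unique LIMSEQ_Suc[OF varpi_LIMSEQ[OF assms, of z]] by blast
qed

lemma varpi_shift_nat:
  assumes "\<tau> \<in> UHP"
  shows "varpi z \<tau> = (\<Prod>k<n. 1 - e (z + of_nat k * \<tau>)) * varpi (z + of_nat n * \<tau>) \<tau>"
proof (induction n)
  case (Suc n)
  show ?case
    unfolding Suc prod.lessThan_Suc varpi_shift[OF assms, of "z + of_nat n * \<tau>"]
    by (simp add: algebra_simps)
qed auto

lemma varpi_add_of_int [simp]: "varpi (z + of_int n) \<tau> = varpi z \<tau>"
proof -
  have "e (z + of_int n + of_nat k * \<tau>) = e (z + of_nat k * \<tau>)" for k
    using e_add_of_int[of "z + of_nat k * \<tau>" n] by (simp add: algebra_simps)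
  thus ?thesis by (simp add: varpi_def)
qed

lemma varpi_add_of_int_right [simp]: "varpi z (\<tau> + of_int n) = varpi z \<tau>"
proof -
  have "e (z + of_nat k * (\<tau> + of_int n)) = e (z + of_nat k * \<tau>)" for k
    using e_add_of_int[of "z + of_nat k * \<tau>" "int k * n"] by (simp add: algebra_simps)
  thus ?thesis by (simp add: varpi_def)
qed

lemma varpi_quasi_periodic:
  assumes \<tau>: "\<tau> \<in> UHP" and nz: "qpoch (e z) (e \<tau>) m \<noteq> 0"
  shows "varpi (z + of_int m * \<tau> + of_int n) \<tau> = inverse (qpoch (e z) (e \<tau>) m) * varpi z \<tau>"
proof (cases "m \<ge> 0")
  case True
  then obtain k where m: "m = int k" using nonneg_int_cases by blast
  have "(\<Prod>j<k. 1 - e (z + of_nat j * \<tau>)) = qpoch (e z) (e \<tau>) m"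
    by (simp add: qpoch_def m e_add e_of_nat_mult)
  hence "varpi z \<tau> = qpoch (e z) (e \<tau>) m * varpi (z + of_int m * \<tau> + of_int n) \<tau>"
    using varpi_shift_nat[OF \<tau>, of z k] by (simp add: m)
  with nz show ?thesis by simp
next
  case False
  define k where "k = nat (- m)"
  have m: "m = - int k" using False by (simp add: k_def)
  have p: "e \<tau> powi (- int j) = e (- (of_nat j * \<tau>))" for j
    by (simp add: e_minus e_of_nat_mult power_int_minus)
  have "qpoch (e z) (e \<tau>) m = inverse (\<Prod>j\<in>{1..k}. 1 - e (z + - (of_nat j * \<tau>)))"
    using False by (simp only: qpoch_def m p e_add) simp
  \<comment> \<open>For m = -k the shift is run upwards from z + m\<tau> to z. Reversing by j -> k -
    j turns the indices 1..k of \<open>qpoch\<close> into 0..k-1.\<close>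
  also have "(\<Prod>j\<in>{1..k}. 1 - e (z + - (of_nat j * \<tau>))) =
      (\<Prod>j<k. 1 - e (z + of_int m * \<tau> + of_nat j * \<tau>))"
    by (rule prod.reindex_bij_witness[of _ "\<lambda>j. k - j" "\<lambda>j. k - j"])
       (auto simp: m of_nat_diff algebra_simps)
  finally have "inverse (qpoch (e z) (e \<tau>) m) = (\<Prod>j<k. 1 - e (z + of_int m * \<tau> + of_nat j * \<tau>))"
    by simp
  with varpi_shift_nat[OF \<tau>, of "z + of_int m * \<tau>" k] show ?thesis by (simp add: m)
qed

text \<open>The factors are sorted by their index modulo c. Finite products agree exactly along the
  subsequence n c, so the infinite product is never rearranged.\<close>

lemma varpi_decimate:
  assumes "\<tau> \<in> UHP" "c > 0"
  shows "varpi z \<tau> = (\<Prod>r<c. varpi (z + of_nat r * \<tau>) (of_nat c * \<tau>))"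
proof -
  have c\<tau>: "of_nat c * \<tau> \<in> UHP" using assms by (auto simp: UHP_def)
  have "(\<lambda>n. \<Prod>r<c. \<Prod>j<n. 1 - e (z + of_nat r * \<tau> + of_nat j * (of_nat c * \<tau>)))
     \<longlonglongrightarrow> (\<Prod>r<c. varpi (z + of_nat r * \<tau>) (of_nat c * \<tau>))"
    by (intro tendsto_prod varpi_LIMSEQ c\<tau>)
  also have "(\<lambda>n. \<Prod>r<c. \<Prod>j<n. 1 - e (z + of_nat r * \<tau> + of_nat j * (of_nat c * \<tau>))) =
     (\<lambda>n. \<Prod>k<n * c. 1 - e (z + of_nat k * \<tau>))"
  proof
    fix n
    have "(\<Prod>r<c. \<Prod>j<n. 1 - e (z + of_nat r * \<tau> + of_nat j * (of_nat c * \<tau>))) =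
        (\<Prod>j<n. \<Prod>r<c. 1 - e (z + of_nat (r + j * c) * \<tau>))"
      by (subst prod.swap) (simp add: algebra_simps)
    also have "\<dots> = (\<Prod>j<n. \<Prod>k=j*c..<j*c+c. 1 - e (z + of_nat k * \<tau>))"
          proof (rule prod.cong[OF refl])
      fix j
      show "(\<Prod>r<c. 1 - e (z + of_nat (r + j * c) * \<tau>)) = (\<Prod>k=j*c..<j*c+c. 1 - e (z + of_nat k * \<tau>))"
        by (rule prod.reindex_bij_witness[of _ "\<lambda>k. k - j * c" "\<lambda>r. r + j * c"]) auto
    qed
    also have "\<dots> = (\<Prod>k<n * c. 1 - e (z + of_nat k * \<tau>))"
      by (rule prod.nat_group)
    finally show "(\<Prod>r<c. \<Prod>j<n. 1 - e (z + of_nat r * \<tau> + of_nat j * (of_nat c * \<tau>))) =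
      (\<Prod>k<n * c. 1 - e (z + of_nat k * \<tau>))" .
  qed
  finally have l: "(\<lambda>n. \<Prod>k<n * c. 1 - e (z + of_nat k * \<tau>))
    \<longlonglongrightarrow> (\<Prod>r<c. varpi (z + of_nat r * \<tau>) (of_nat c * \<tau>))" .
  have "strict_mono (\<lambda>n::nat. n * c)" using assms by (auto simp: strict_mono_def)
  from LIMSEQ_subseq_LIMSEQ[OF varpi_LIMSEQ[OF assms(1), of z] this]
  show ?thesis using LIMSEQ_unique[OF _ l] by (simp add: o_def)
qed

text \<open>Factorwise this is \<open>1 - x^2 = (1 - x)(1 + x)\<close>, the sign being absorbed by
  e(1/2) = -1.\<close>

lemma varpi_duplication:
  assumes "\<tau> \<in> UHP"
  shows "varpi (2 * z) (2 * \<tau>) = varpi z \<tau> * varpi (z + 1/2) \<tau>"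
proof -
  have "2 * \<tau> \<in> UHP" using assms by (auto simp: UHP_def)
  have *: "1 - e (2 * z + of_nat k * (2 * \<tau>)) = (1 - e (z + of_nat k * \<tau>)) * (1 - e (z + 1/2 + of_nat k * \<tau>))" for k
  proof -
    have "e (2 * z + of_nat k * (2 * \<tau>)) = e (z + of_nat k * \<tau>) ^ 2"
      using e_add[of "z + of_nat k * \<tau>" "z + of_nat k * \<tau>"] by (simp add: power2_eq_square algebra_simps)
    moreover have "e (z + 1/2 + of_nat k * \<tau>) = - e (z + of_nat k * \<tau>)"
      using e_add[of "z + of_nat k * \<tau>" "1/2"] by (simp add: e_half algebra_simps)
    ultimately show ?thesis by (simp add: power2_eq_square algebra_simps)
  qed
  show ?thesis
    unfolding varpi_def *
    by (rule prodinf_mult[symmetric]) (rule uniform_limit_varpi(1)[OF assms compact_empty])+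
qed

section \<open>The Weierstrass product over a lattice cone\<close>

lemma has_sum_prod_decode:
  fixes f :: "nat \<times> nat \<Rightarrow> complex"
  assumes "summable (\<lambda>i. norm (f (prod_decode i)))"
  shows "(f has_sum (\<Sum>i. f (prod_decode i))) UNIV"
  using norm_summable_imp_has_sum[OF assms] summable_norm_cancel[OF assms]
    has_sum_reindex_bij_betw[OF bij_prod_decode, of f] by (simp add: summable_sums)

text \<open>The product for \<tau> sums a quadrant along direction 1, the product for -1/\<tau>
  along direction \<tau>. This lemma and \<open>has_sum_columns\<close> identify both iterated sums
  with one unconditional sum.\<close>

lemma has_sum_rows:
  fixes f :: "nat \<times> nat \<Rightarrow> complex"
  assumes "(f has_sum S) UNIV" "\<And>m. (\<lambda>n. f (m, n)) sums g m"
  shows "(g has_sum S) UNIV"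
proof (rule has_sum_SigmaD[where B = "\<lambda>_. UNIV" and f = f])
  show "(f has_sum S) (SIGMA x:UNIV. UNIV)" using assms(1) by simp
  have "f summable_on (SIGMA x:UNIV. UNIV)" using assms(1) by (auto simp: summable_on_def)
  hence "(\<lambda>n. f (m, n)) summable_on UNIV" for m
    using summable_on_SigmaD1[of "\<lambda>x y. f (x, y)" UNIV "\<lambda>_. UNIV" m] by simp
  thus "((\<lambda>n. f (m, n)) has_sum g m) UNIV" for m
    using assms(2) by (metis has_sum_imp_sums has_sum_infsum sums_unique2)
qed

lemma has_sum_columns:
  fixes f :: "nat \<times> nat \<Rightarrow> complex"
  assumes "(f has_sum S) UNIV" "\<And>n. (\<lambda>m. f (m, n)) sums g n"
  shows "(g has_sum S) UNIV"
proof (rule has_sum_rows)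
  show "((\<lambda>p. f (prod.swap p)) has_sum S) UNIV"
    using has_sum_reindex_bij_betw[of prod.swap UNIV UNIV f S] assms(1) by (simp add: bij_swap)
qed (use assms(2) in simp)

text \<open>Up to a factor that is locally uniform in \<tau>, an upper bound for the reciprocal norm
  of the lattice point with index i; it does not involve \<tau> itself.\<close>

definition lattice_weight :: "nat \<Rightarrow> real" where
  "lattice_weight i = 1 / (real (fst (prod_decode i)) + real (snd (prod_decode i)) + 1)"

lemma lattice_weight_pos: "lattice_weight i > 0"
  by (simp add: lattice_weight_def add_nonneg_pos)

text \<open>Since \<open>(m + n + 1)^2\<close> is at least (m + 1)(n + 1), the cube is dominated by
  the product of two one-dimensional series with exponent 3/2 > 1.\<close>

lemma summable_lattice_weight_cubed: "summable (\<lambda>i. lattice_weight i ^ 3)"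
proof -
  define p where "p k = (real k + 1) powr (-3/2)" for k
  have p0: "p k \<ge> 0" for k by (simp add: p_def)
  have "summable (\<lambda>k. real k powr (-3/2))"
    by (subst summable_real_powr_iff) simp
  hence "summable p"
    using summable_Suc_iff[of "\<lambda>k. real k powr (-3/2)"] by (simp add: p_def[abs_def] add_ac)
  hence ps: "(p has_sum suminf p) UNIV"
    using p0 by (intro norm_summable_imp_has_sum) (auto simp: summable_sums)
  have "(\<lambda>(m, n). p m * p n) summable_on (SIGMA m:UNIV. UNIV)"
  proof (rule summable_on_SigmaI)
    show "((\<lambda>n. case (m, n) of (m, n) \<Rightarrow> p m * p n) has_sum p m * suminf p) UNIV" for m
      using has_sum_cmult_right[OF ps, of "p m"] by simp
    show "(\<lambda>m. p m * suminf p) summable_on UNIV"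
      by (intro summable_on_cmult_left) (use ps in \<open>auto simp: summable_on_def\<close>)
  qed (simp add: p0)
  hence "(\<lambda>(m, n). p m * p n) summable_on UNIV" by simp
  hence "(\<lambda>i. case prod_decode i of (m, n) \<Rightarrow> p m * p n) summable_on UNIV"
    using summable_on_reindex_bij_betw[OF bij_prod_decode, of "\<lambda>(m, n). p m * p n"] by simp
  hence s: "summable (\<lambda>i. case prod_decode i of (m, n) \<Rightarrow> p m * p n)"
    by (rule summable_on_imp_summable)
  show ?thesis
  proof (rule summable_comparison_test'[OF s])
    fix i :: nat
    obtain m n where mn: "prod_decode i = (m, n)" by (cases "prod_decode i")
    define x where "x = real m + real n + 1"
    have x: "x > 0" "x\<^sup>2 \<ge> (real m + 1) * (real n + 1)"
      by (auto simp: x_def power2_eq_square algebra_simps add_nonneg_pos)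
    have "lattice_weight i ^ 3 = x powr (-3)"
      using x(1) by (simp add: lattice_weight_def mn x_def powr_minus power_one_over inverse_eq_divide powr_numeral)
    also have "\<dots> = (x\<^sup>2) powr (-3/2)"
      using x(1) by (simp add: powr_powr flip: powr_numeral)
    also have "\<dots> \<le> ((real m + 1) * (real n + 1)) powr (-3/2)"
      using x by (intro powr_mono2') auto
    also have "\<dots> = p m * p n" by (simp add: p_def powr_mult)
    finally show "norm (lattice_weight i ^ 3) \<le> (case prod_decode i of (m, n) \<Rightarrow> p m * p n)"
      using lattice_weight_pos[of i] by (simp add: mn)
  qed
qed

lemma lattice_weight_tendsto_0: "lattice_weight \<longlonglongrightarrow> 0"
proof -
  have "(\<lambda>i. root 3 (lattice_weight i ^ 3)) \<longlonglongrightarrow> root 3 0"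
    by (intro tendsto_intros summable_LIMSEQ_zero summable_lattice_weight_cubed)
  thus ?thesis using lattice_weight_pos by (simp add: real_root_power_cancel less_imp_le)
qed

text \<open>By homogeneity only x + y = 1 matters. The segment from 1 to \<tau> misses 0 precisely
  when \<tau> is off the cut, and compactness makes the distance uniform.\<close>

lemma cone_lower_bound:
  fixes K :: "complex set"
  assumes "compact K" "K \<subseteq> - \<real>\<^sub>\<le>\<^sub>0"
  obtains \<delta> where "\<delta> > 0"
    "\<And>\<tau> x y. \<tau> \<in> K \<Longrightarrow> x \<ge> 0 \<Longrightarrow> y \<ge> 0 \<Longrightarrow> \<delta> * (x + y) \<le> norm (of_real y + of_real x * \<tau>)"
proof (cases "K = {}")
  case False
  define g where "g p = norm (of_real (1 - fst p) + of_real (fst p) * snd p)" for p :: "real \<times> complex"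
  have "continuous_on ({0..1} \<times> K) g" unfolding g_def by (intro continuous_intros)
  moreover have "compact ({0..1::real} \<times> K)" by (intro compact_Times assms compact_Icc)
  ultimately obtain p0 where p0: "p0 \<in> {0..1} \<times> K" "\<And>p. p \<in> {0..1} \<times> K \<Longrightarrow> g p0 \<le> g p"
    using continuous_attains_inf[of "{0..1} \<times> K" g] False by auto
  have "g p0 > 0"
  proof (rule ccontr)
    assume "\<not> g p0 > 0"
    hence "of_real (1 - fst p0) + of_real (fst p0) * snd p0 = 0" by (simp add: g_def)
    moreover from this have "fst p0 \<noteq> 0" by auto
    ultimately have "snd p0 = of_real (- ((1 - fst p0) / fst p0))"
      by (simp add: field_simps add_eq_0_iff)
    hence "snd p0 \<in> \<real>\<^sub>\<le>\<^sub>0"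
      using p0(1) by (simp only: nonpos_Reals_of_real_iff) (auto simp: mem_Times_iff)
    thus False using p0(1) assms(2) by (auto simp: mem_Times_iff)
  qed
  show ?thesis
  proof (rule that[OF \<open>g p0 > 0\<close>])
    fix \<tau> and x y :: real assume *: "\<tau> \<in> K" "x \<ge> 0" "y \<ge> 0"
    show "g p0 * (x + y) \<le> norm (of_real y + of_real x * \<tau>)"
    proof (cases "x + y = 0")
      case False
      hence s: "x + y > 0" using * by linarith
      have "g p0 \<le> g (x / (x + y), \<tau>)"
        using s * by (intro p0(2)) (auto simp: divide_le_eq_1)
      also have "of_real (1 - x / (x + y)) + of_real (x / (x + y)) * \<tau> =
          (of_real y + of_real x * \<tau>) / of_real (x + y)"
        using s by (simp add: field_simps flip: of_real_add of_real_diff)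
      hence "g (x / (x + y), \<tau>) = norm (of_real y + of_real x * \<tau>) / (x + y)"
        using s by (simp add: g_def norm_divide flip: of_real_add)
      finally show ?thesis using s by (simp add: field_simps)
    qed simp
  qed
qed (use that[of 1] in auto)

text \<open>Enumeration by \<open>prod_decode\<close> makes the product over the cone an ordinary
  \<open>prodinf\<close>. The offsets 1/2 keep 0 away from the points, so that division by them is
  harmless.\<close>

definition lattice_pt :: "complex \<Rightarrow> nat \<Rightarrow> complex" where
  "lattice_pt \<tau> i = (of_nat (fst (prod_decode i)) + 1/2) + (of_nat (snd (prod_decode i)) + 1/2) * \<tau>"

lemma lattice_pt_lower_bound:
  fixes K :: "complex set"
  assumes "compact K" "K \<subseteq> - \<real>\<^sub>\<le>\<^sub>0"
  obtains \<delta> where "\<delta> > 0" "\<And>\<tau> i. \<tau> \<in> K \<Longrightarrow> \<delta> / lattice_weight i \<le> norm (lattice_pt \<tau> i)"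
proof -
  obtain \<delta> where \<delta>: "\<delta> > 0"
    "\<And>\<tau> x y. \<tau> \<in> K \<Longrightarrow> x \<ge> 0 \<Longrightarrow> y \<ge> 0 \<Longrightarrow> \<delta> * (x + y) \<le> norm (of_real y + of_real x * \<tau>)"
    using cone_lower_bound[OF assms] by metis
  have "\<delta> / lattice_weight i \<le> norm (lattice_pt \<tau> i)" if "\<tau> \<in> K" for \<tau> i
    using \<delta>(2)[OF that, of "real (snd (prod_decode i)) + 1/2" "real (fst (prod_decode i)) + 1/2"]
    by (simp add: lattice_weight_def lattice_pt_def algebra_simps)
  with \<delta>(1) that show ?thesis by blast
qed

lemma lattice_pt_nonzero: "\<tau> \<notin> \<real>\<^sub>\<le>\<^sub>0 \<Longrightarrow> lattice_pt \<tau> i \<noteq> 0"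
proof -
  assume "\<tau> \<notin> \<real>\<^sub>\<le>\<^sub>0"
  hence "{\<tau>} \<subseteq> - \<real>\<^sub>\<le>\<^sub>0" by simp
  then obtain \<delta> where "\<delta> > 0" "\<delta> / lattice_weight i \<le> norm (lattice_pt \<tau> i)"
    using lattice_pt_lower_bound[OF compact_sing] by (metis singletonI)
  moreover from this have "\<delta> / lattice_weight i > 0" using lattice_weight_pos by simp
  ultimately show ?thesis by auto
qed

text \<open>Genus 2 fits the summability of the reciprocal cubes. Up to the exponential of a
  quadratic polynomial in w this is 1/Gamma_2((1 + \<tau>)/2 - w | 1, \<tau>) with Barnes' double
  gamma function, so P(w)/P(-w) is essentially a double sine function.\<close>

definition cone_prod :: "complex \<Rightarrow> complex \<Rightarrow> complex" where
  "cone_prod w \<tau> = (\<Prod>i. weierstrass_factor 2 (w / lattice_pt \<tau> i))"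

lemma cone_prod_M_test:
  assumes "compact K" "K \<subseteq> UNIV \<times> - \<real>\<^sub>\<le>\<^sub>0"
  shows "\<exists>M N. summable M \<and>
    (\<forall>n\<ge>N. \<forall>p\<in>K. norm (weierstrass_factor 2 (fst p / lattice_pt (snd p) n) - 1) \<le> M n)"
proof -
  have "compact (snd ` K)" by (intro compact_continuous_image assms continuous_intros)
  moreover have "snd ` K \<subseteq> - \<real>\<^sub>\<le>\<^sub>0" using assms(2) by auto
  ultimately obtain \<delta> where \<delta>: "\<delta> > 0"
    "\<And>\<tau> i. \<tau> \<in> snd ` K \<Longrightarrow> \<delta> / lattice_weight i \<le> norm (lattice_pt \<tau> i)"
    using lattice_pt_lower_bound[of "snd ` K"] by metis
  have "bounded (fst ` K)"
    by (intro compact_imp_bounded compact_continuous_image assms continuous_intros)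
  then obtain B where B: "B > 0" "\<And>p. p \<in> K \<Longrightarrow> norm (fst p) \<le> B" by (auto simp: bounded_pos)
  have "\<forall>\<^sub>F i in sequentially. lattice_weight i < \<delta> / (2 * B)"
    using lattice_weight_tendsto_0 by (rule order_tendstoD) (use \<delta> B in simp)
  \<comment> \<open>From \<open>N\<close> on the arguments are at most 1/2 on all of
    \<open>K\<close>, the range in which \<open>weierstrass_factor_bound\<close> applies.\<close>
  then obtain N where N: "\<And>i. i \<ge> N \<Longrightarrow> lattice_weight i < \<delta> / (2 * B)"
    by (auto simp: eventually_sequentially)
  define M where "M i = 3 * (B / \<delta>) ^ 3 * lattice_weight i ^ 3" for i
  have "summable M" unfolding M_def
    by (intro summable_mult summable_lattice_weight_cubed)
  moreover have "norm (weierstrass_factor 2 (fst p / lattice_pt (snd p) i) - 1) \<le> M i"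
    if "i \<ge> N" "p \<in> K" for i p
  proof -
    have w: "lattice_weight i > 0" by (rule lattice_weight_pos)
    have "norm (fst p / lattice_pt (snd p) i) \<le> B / (\<delta> / lattice_weight i)"
      unfolding norm_divide using B \<delta> that w by (intro frac_le) auto
    hence le: "norm (fst p / lattice_pt (snd p) i) \<le> B / \<delta> * lattice_weight i" by simp
    also have "\<dots> \<le> 1/2" using N[OF that(1)] B \<delta> by (simp add: field_simps)
    finally have "norm (weierstrass_factor 2 (fst p / lattice_pt (snd p) i) - 1) \<le>
        3 * norm (fst p / lattice_pt (snd p) i) ^ Suc 2"
      by (rule weierstrass_factor_bound)
    also have "\<dots> \<le> 3 * (B / \<delta> * lattice_weight i) ^ Suc 2"
      using le by (intro mult_left_mono power_mono) auto
    also have "\<dots> = M i"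
      by (simp add: M_def power_mult_distrib power_divide flip: numeral_3_eq_3)
    finally show ?thesis .
  qed
  ultimately show ?thesis by blast
qed

lemma hol2_at_weierstrass_factor:
  assumes "hol2_at f p"
  shows "hol2_at (\<lambda>q. weierstrass_factor n (f q)) p"
  by (rule hol2_at_compose_field[OF assms])
     (rule holomorphic_on_imp_differentiable_at[of _ UNIV], auto intro!: holomorphic_intros)

lemma hol2_at_lattice_pt: "hol2_at (\<lambda>q. lattice_pt (snd q) i) p"
  unfolding lattice_pt_def by (intro hol2_intros)

lemma open_cut_plane: "open (- \<real>\<^sub>\<le>\<^sub>0 :: complex set)"
  using closed_nonpos_Reals_complex by (rule open_Compl)

lemma holomorphic2_on_cone_prod: "holomorphic2_on (\<lambda>p. cone_prod (fst p) (snd p)) (UNIV \<times> - \<real>\<^sub>\<le>\<^sub>0)"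
  unfolding cone_prod_def
  by (rule holomorphic2_on_prodinf[OF _ _ cone_prod_M_test])
     (auto simp: holomorphic2_on_iff lattice_pt_nonzero open_Times open_cut_plane
       intro!: hol2_at_weierstrass_factor hol2_intros hol2_at_lattice_pt)

lemma hol2_at_cone_prod:
  assumes "hol2_at f p" "hol2_at g p" "g p \<notin> \<real>\<^sub>\<le>\<^sub>0"
  shows "hol2_at (\<lambda>q. cone_prod (f q) (g q)) p"
  using hol2_at_compose[OF _ assms(1,2), of "\<lambda>p. cone_prod (fst p) (snd p)"]
    holomorphic2_on_cone_prod assms(3) by (simp add: holomorphic2_on_iff)

lemma uniform_limit_cone_prod:
  assumes "\<tau> \<notin> \<real>\<^sub>\<le>\<^sub>0" "compact K"
  shows "\<And>w. convergent_prod (\<lambda>i. weierstrass_factor 2 (w / lattice_pt \<tau> i))"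
    and "uniform_limit K (\<lambda>n w. \<Prod>i<n. weierstrass_factor 2 (w / lattice_pt \<tau> i)) (\<lambda>w. cone_prod w \<tau>) sequentially"
proof -
  have *: "(\<forall>w\<in>L. convergent_prod (\<lambda>i. weierstrass_factor 2 (w / lattice_pt \<tau> i))) \<and>
    uniform_limit L (\<lambda>n w. \<Prod>i<n. weierstrass_factor 2 (w / lattice_pt \<tau> i)) (\<lambda>w. cone_prod w \<tau>) sequentially"
    if "compact L" for L
  proof -
    have L: "compact (L \<times> {\<tau>})" "L \<times> {\<tau>} \<subseteq> UNIV \<times> - \<real>\<^sub>\<le>\<^sub>0"
      using that assms by (auto intro!: compact_Times)
    obtain M N where M: "summable M"
      "\<forall>n\<ge>N. \<forall>p\<in>L \<times> {\<tau>}. norm (weierstrass_factor 2 (fst p / lattice_pt (snd p) n) - 1) \<le> M n"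
      using cone_prod_M_test[OF L] by blast
    have c: "continuous_on L (\<lambda>w. weierstrass_factor 2 (w / lattice_pt \<tau> i))" for i
      using lattice_pt_nonzero[OF assms(1)] by (intro continuous_intros) auto
    show ?thesis
      unfolding cone_prod_def
      using uniform_limit_prodinf_M_test[of L "\<lambda>i w. weierstrass_factor 2 (w / lattice_pt \<tau> i)" M N,
          OF that c M(1)] M(2) by auto
  qed
  show "convergent_prod (\<lambda>i. weierstrass_factor 2 (w / lattice_pt \<tau> i))" for w
    using *[of "{w}"] by simp
  show "uniform_limit K (\<lambda>n w. \<Prod>i<n. weierstrass_factor 2 (w / lattice_pt \<tau> i)) (\<lambda>w. cone_prod w \<tau>) sequentially"
    using *[OF assms(2)] by blast
qed

lemma cone_prod_eq_0_iff:
  assumes "\<tau> \<notin> \<real>\<^sub>\<le>\<^sub>0"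
  shows "cone_prod w \<tau> = 0 \<longleftrightarrow> (\<exists>i. w = lattice_pt \<tau> i)"
  unfolding cone_prod_def
  by (subst prodinf_eq_0_iff[OF uniform_limit_cone_prod(1)[OF assms compact_empty]])
     (use lattice_pt_nonzero[OF assms] in \<open>auto simp: divide_eq_1_iff\<close>)

lemma cone_prod_0 [simp]: "cone_prod 0 \<tau> = 1"
  by (simp add: cone_prod_def)

lemma summable_lattice_pt_cubed:
  assumes "\<tau> \<notin> \<real>\<^sub>\<le>\<^sub>0"
  shows "summable (\<lambda>i. norm (2 / (w + lattice_pt \<tau> i) ^ 3))"
proof -
  obtain \<delta> where \<delta>: "\<delta> > 0" "\<And>i. \<delta> / lattice_weight i \<le> norm (lattice_pt \<tau> i)"
    using lattice_pt_lower_bound[OF compact_sing, of \<tau>] assms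
    by (metis ComplI empty_subsetI insert_subset singletonI)
  have "\<forall>\<^sub>F i in sequentially. lattice_weight i < \<delta> / (2 * norm w + 1)"
    using lattice_weight_tendsto_0 by (rule order_tendstoD) (use \<delta> in \<open>simp add: add_nonneg_pos\<close>)
  hence "\<forall>\<^sub>F i in sequentially. norm (norm (2 / (w + lattice_pt \<tau> i) ^ 3)) \<le> 2 * (2 / \<delta>) ^ 3 * lattice_weight i ^ 3"
  proof eventually_elim
    case (elim i)
    define L where "L = \<delta> / lattice_weight i"
    have lw: "lattice_weight i > 0" by (rule lattice_weight_pos)
    \<comment> \<open>For late i the lattice point is more than twice as large as w, so adding w at
      most halves the lower bound \<open>L\<close>.\<close>
    have "2 * norm w + 1 < L"
    proof -
      have "2 * norm w + 1 > 0" by (simp add: add_nonneg_pos)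
      thus ?thesis using elim lw by (simp add: L_def pos_less_divide_eq mult.commute)
    qed
    moreover have "norm (lattice_pt \<tau> i) \<le> norm (w + lattice_pt \<tau> i) + norm w"
      using norm_triangle_ineq4[of "w + lattice_pt \<tau> i" w] by simp
    ultimately have "L / 2 \<le> norm (w + lattice_pt \<tau> i)" "L > 0"
      using \<delta>(2)[of i] by (auto simp: L_def[symmetric]) (smt (verit) norm_ge_zero)+
    hence "2 / norm (w + lattice_pt \<tau> i) ^ 3 \<le> 2 / (L / 2) ^ 3"
      by (intro frac_le power_mono zero_less_power) auto
    also have "\<dots> = 2 * (2 / \<delta>) ^ 3 * lattice_weight i ^ 3"
      using \<delta>(1) lw by (simp add: L_def field_simps)
    finally show ?case by (simp add: norm_divide norm_power)
  qed
  thus ?thesis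
    by (rule summable_comparison_test_ev) (intro summable_mult summable_lattice_weight_cubed)
qed

section \<open>Third logarithmic derivatives\<close>

text \<open>Equals \<open>(f'/f)''\<close> where \<open>f\<close> does not vanish; written in terms of derivatives of \<open>f\<close> so
  that it passes to locally uniform limits.\<close>

definition logderiv3 :: "(complex \<Rightarrow> complex) \<Rightarrow> complex \<Rightarrow> complex" where
  "logderiv3 f z = deriv (deriv (deriv f)) z / f z - 3 * deriv f z * deriv (deriv f) z / (f z)\<^sup>2
     + 2 * (deriv f z / f z) ^ 3"

text \<open>With f' = f l one gets \<open>f'' = f (l^2 + l')\<close> and
  \<open>f''' = f (l^3 + 3 l l' + l'')\<close>, and \<open>logderiv3\<close> is the combination that
  isolates l''. This allows any closed form of the logarithmic derivative in place of f'/f.\<close>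

lemma logderiv3_eqI:
  assumes S: "open S" "z \<in> S" and nz: "f z \<noteq> 0"
    and f: "\<And>x. x \<in> S \<Longrightarrow> (f has_field_derivative f x * l x) (at x)"
    and l: "\<And>x. x \<in> S \<Longrightarrow> (l has_field_derivative l1 x) (at x)"
    and l1: "\<And>x. x \<in> S \<Longrightarrow> (l1 has_field_derivative l2 x) (at x)"
  shows "logderiv3 f z = l2 z"
proof -
  have 1: "deriv f x = f x * l x" if "x \<in> S" for x
    by (rule DERIV_imp_deriv) (rule f[OF that])
  have "((\<lambda>x. f x * l x) has_field_derivative f x * ((l x)\<^sup>2 + l1 x)) (at x)" if "x \<in> S" for x
    by (rule DERIV_cong[OF DERIV_mult[OF f[OF that] l[OF that]]])
       (simp add: algebra_simps power2_eq_square)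
  hence "(deriv f has_field_derivative f x * ((l x)\<^sup>2 + l1 x)) (at x)" if "x \<in> S" for x
    using that S(1)
    by (intro has_field_derivative_transform_within_open[where g = "deriv f" and S = S]) (auto simp: 1)
  hence 2: "deriv (deriv f) x = f x * ((l x)\<^sup>2 + l1 x)" if "x \<in> S" for x
    using that by (blast intro: DERIV_imp_deriv)
  have "((\<lambda>x. f x * ((l x)\<^sup>2 + l1 x)) has_field_derivative
      f z * (l z ^ 3 + 3 * l z * l1 z + l2 z)) (at z)"
    by (rule derivative_eq_intros f l l1 S refl)+ (simp add: algebra_simps power2_eq_square power3_eq_cube)
  hence "(deriv (deriv f) has_field_derivative f z * (l z ^ 3 + 3 * l z * l1 z + l2 z)) (at z)"
    using S(1,2)
    by (intro has_field_derivative_transform_within_open[where g = "deriv (deriv f)" and S = S]) (auto simp: 2)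
  hence 3: "deriv (deriv (deriv f)) z = f z * (l z ^ 3 + 3 * l z * l1 z + l2 z)"
    by (rule DERIV_imp_deriv)
  show ?thesis unfolding logderiv3_def 1[OF S(2)] 2[OF S(2)] 3
    using nz by (simp add: field_simps power2_eq_square power3_eq_cube)
qed

lemma logderiv_holomorphic:
  assumes "open S" "f holomorphic_on S" "\<And>x. x \<in> S \<Longrightarrow> f x \<noteq> 0"
  shows "(\<lambda>x. deriv f x / f x) holomorphic_on S"
  using assms by (intro holomorphic_intros) auto

lemma logderiv3_logderiv:
  assumes "open S" "z \<in> S" "f holomorphic_on S" "\<And>x. x \<in> S \<Longrightarrow> f x \<noteq> 0"
  shows "logderiv3 f z = deriv (deriv (\<lambda>x. deriv f x / f x)) z"
proof (rule logderiv3_eqI[OF assms(1,2)])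
  note L = logderiv_holomorphic[OF assms(1,3,4)]
  show "(f has_field_derivative f x * (deriv f x / f x)) (at x)" if "x \<in> S" for x
    using holomorphic_derivI[OF assms(3,1) that, of UNIV] assms(4)[OF that] by simp
  show "((\<lambda>x. deriv f x / f x) has_field_derivative deriv (\<lambda>x. deriv f x / f x) x) (at x)"
    if "x \<in> S" for x
    by (rule holomorphic_derivI[OF L assms(1) that])
  show "(deriv (\<lambda>x. deriv f x / f x) has_field_derivative deriv (deriv (\<lambda>x. deriv f x / f x)) x) (at x)"
    if "x \<in> S" for x
    by (rule holomorphic_derivI[OF holomorphic_deriv[OF L assms(1)] assms(1) that])
qed (use assms in auto)

lemma logderiv3_mult:
  assumes "open A" "z \<in> A" "f holomorphic_on A" "g holomorphic_on A" "f z \<noteq> 0" "g z \<noteq> 0"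
  shows "logderiv3 (\<lambda>x. f x * g x) z = logderiv3 f z + logderiv3 g z"
proof -
  define S where "S = {x \<in> A. f x * g x \<noteq> 0}"
  have "continuous_on A (\<lambda>x. f x * g x)"
    by (intro continuous_intros holomorphic_on_imp_continuous_on assms)
  hence "open S"
    using continuous_open_preimage[of A "\<lambda>x. f x * g x" "- {0}"] assms(1)
    by (simp add: S_def vimage_def Int_def open_Compl)
  have S: "z \<in> S" "f holomorphic_on S" "g holomorphic_on S" "\<And>x. x \<in> S \<Longrightarrow> f x \<noteq> 0"
    "\<And>x. x \<in> S \<Longrightarrow> g x \<noteq> 0"
    using assms by (auto simp: S_def intro: holomorphic_on_subset)
  define lf lg where "lf x = deriv f x / f x" and "lg x = deriv g x / g x" for x
  have l: "lf holomorphic_on S" "lg holomorphic_on S"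
    unfolding lf_def lg_def using logderiv_holomorphic \<open>open S\<close> S by blast+
  have "logderiv3 (\<lambda>x. f x * g x) z = deriv (deriv lf) z + deriv (deriv lg) z"
  proof (rule logderiv3_eqI[OF \<open>open S\<close> S(1)])
    fix x assume x: "x \<in> S"
    show "((\<lambda>x. f x * g x) has_field_derivative f x * g x * (lf x + lg x)) (at x)"
      using DERIV_mult[OF holomorphic_derivI[OF S(2) \<open>open S\<close> x] holomorphic_derivI[OF S(3) \<open>open S\<close> x]]
      by (rule DERIV_cong) (use S(4,5) x in \<open>simp add: lf_def lg_def field_simps\<close>)
    show "((\<lambda>x. lf x + lg x) has_field_derivative deriv lf x + deriv lg x) (at x)"
      by (intro DERIV_add holomorphic_derivI[OF _ \<open>open S\<close> x] l)
    show "((\<lambda>x. deriv lf x + deriv lg x) has_field_derivative deriv (deriv lf) x + deriv (deriv lg) x) (at x)"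
      by (intro DERIV_add holomorphic_derivI[OF _ \<open>open S\<close> x] holomorphic_deriv l \<open>open S\<close>)
  qed (use assms in auto)
  also have "\<dots> = logderiv3 f z + logderiv3 g z"
    unfolding lf_def lg_def using logderiv3_logderiv[OF \<open>open S\<close> S(1)] S(2-) by simp
  finally show ?thesis .
qed

lemma logderiv3_prod:
  fixes f :: "nat \<Rightarrow> complex \<Rightarrow> complex"
  assumes "open A" "z \<in> A" "\<And>k. f k holomorphic_on A" "\<And>k. f k z \<noteq> 0"
  shows "logderiv3 (\<lambda>x. \<Prod>k<n. f k x) z = (\<Sum>k<n. logderiv3 (f k) z)"
proof (induction n)
  case (Suc n)
  have "logderiv3 (\<lambda>x. (\<Prod>k<n. f k x) * f n x) z = logderiv3 (\<lambda>x. \<Prod>k<n. f k x) z + logderiv3 (f n) z"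
    using assms by (intro logderiv3_mult[OF assms(1,2)]) (auto intro!: holomorphic_intros)
  thus ?case using Suc by simp
qed (simp add: logderiv3_def)

text \<open>Derivatives of every order pass to the locally uniform limit, and
  \<open>logderiv3\<close> is a rational expression in them whose denominators are powers of f(z).
  No series of logarithms has to be differentiated.\<close>

lemma logderiv3_prodinf:
  assumes lim: "uniform_limit A (\<lambda>n x. \<Prod>k<n. f k x) P sequentially"
    and A: "open A" "z \<in> A" and hol: "\<And>k. f k holomorphic_on A" and nz: "P z \<noteq> 0"
  shows "(\<lambda>k. logderiv3 (f k) z) sums logderiv3 P z"
proof -
  have lim': "(\<lambda>n. \<Prod>k<n. f k z) \<longlonglongrightarrow> P z"
    using lim by (rule tendsto_uniform_limitI) fact+
  have nz': "f k z \<noteq> 0" for k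
  proof
    assume "f k z = 0"
    have "eventually (\<lambda>n. (\<Prod>k<n. f k z) = 0) sequentially"
      using eventually_gt_at_top[of k] by eventually_elim (use \<open>f k z = 0\<close> in auto)
    hence "(\<lambda>n. (\<Prod>k<n. f k z)) \<longlonglongrightarrow> 0" by (rule tendsto_eventually)
    from LIMSEQ_unique[OF lim' this] nz show False by simp
  qed
  have d: "(\<lambda>n. (deriv ^^ m) (\<lambda>x. \<Prod>k<n. f k x) z) \<longlonglongrightarrow> (deriv ^^ m) P z" for m
    by (rule higher_deriv_complex_uniform_limit[OF lim])
       (use A in \<open>auto intro!: always_eventually holomorphic_intros hol\<close>)
  have "(\<lambda>n. logderiv3 (\<lambda>x. \<Prod>k<n. f k x) z) \<longlonglongrightarrow> logderiv3 P z"
    unfolding logderiv3_def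
    using d[of 1] d[of 2] d[of 3] lim' nz
    by (intro tendsto_intros) (simp_all add: numeral_2_eq_2 numeral_3_eq_3)
  thus ?thesis
    unfolding sums_def logderiv3_prod[OF A hol nz'] .
qed

text \<open>The convergence factor is the exponential of a quadratic polynomial, which three
  differentiations of the logarithm remove; only log(1 - w/\<mu>) contributes.\<close>

lemma logderiv3_weierstrass_factor:
  assumes "\<mu> \<noteq> 0" "w \<noteq> \<mu>"
  shows "logderiv3 (\<lambda>w. weierstrass_factor 2 (w / \<mu>)) w = 2 / (w - \<mu>) ^ 3"
proof -
  have wf: "weierstrass_factor 2 u = (1 - u) * exp (u + u\<^sup>2 / 2)" for u
    by (simp add: weierstrass_factor_def numeral_2_eq_2)
  show ?thesis
  proof (rule logderiv3_eqI[of "- {\<mu>}"])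
    fix x assume "x \<in> - {\<mu>}"
    hence x: "x - \<mu> \<noteq> 0" by simp
    have \<mu>2: "\<mu>\<^sup>2 \<noteq> 0" using assms by simp
    show "((\<lambda>w. weierstrass_factor 2 (w / \<mu>)) has_field_derivative
        weierstrass_factor 2 (x / \<mu>) * (1 / (x - \<mu>) + 1 / \<mu> + x / \<mu>\<^sup>2)) (at x)"
      unfolding wf using x assms
      by (auto intro!: derivative_eq_intros simp: divide_simps) (simp add: algebra_simps power2_eq_square)
    show "((\<lambda>x. 1 / (x - \<mu>) + 1 / \<mu> + x / \<mu>\<^sup>2) has_field_derivative (1 / \<mu>\<^sup>2 - 1 / (x - \<mu>)\<^sup>2)) (at x)"
      by (rule derivative_eq_intros refl x \<mu>2)+ (use x assms in \<open>simp add: power2_eq_square divide_simps\<close>)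
    show "((\<lambda>x. 1 / \<mu>\<^sup>2 - 1 / (x - \<mu>)\<^sup>2) has_field_derivative 2 / (x - \<mu>) ^ 3) (at x)"
      unfolding power2_eq_square power3_eq_cube
      by (rule derivative_eq_intros refl x no_zero_divisors \<mu>2[unfolded power2_eq_square])+
         (use x assms in \<open>simp add: divide_simps\<close>)
  qed (use assms in \<open>auto simp: divide_eq_1_iff\<close>)
qed

section \<open>Partial fractions for a single factor \<open>1 + e y\<close>\<close>

lemma e_holomorphic [holomorphic_intros]: "f holomorphic_on A \<Longrightarrow> (\<lambda>z. e (f z)) holomorphic_on A"
  unfolding e_def by (intro holomorphic_intros)

lemma e_continuous_on [continuous_intros]: "continuous_on A f \<Longrightarrow> continuous_on A (\<lambda>z. e (f z))"
  unfolding e_def by (intro continuous_intros)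

lemma e_eq_minus_1: "y + 1/2 \<in> \<int> \<Longrightarrow> 1 + e y = 0"
proof -
  assume "y + 1/2 \<in> \<int>"
  then obtain n where n: "y + 1/2 = of_int n" by (elim Ints_cases)
  have "- e y = e (y + 1/2)" by (simp add: e_add e_half)
  hence "- e y = 1" unfolding n by simp
  thus ?thesis by (metis add.right_inverse minus_minus)
qed

text \<open>The reflection formula at 1/2 + y. It splits the zeros y = n + 1/2 into positive and
  negative ones, and the logarithmic derivatives of either half are polygamma functions with known
  series.\<close>

lemma one_plus_e_rGamma:
  "1 + e y = 2 * of_real pi * exp (of_real pi * \<i> * y) * (rGamma (1/2 + y) * rGamma (1/2 - y))"
proof -
  have "rGamma (1/2 + y) * rGamma (1/2 - y) = sin (of_real pi * (1/2 + y)) / of_real pi"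
    using rGamma_reflection_complex[of "1/2 + y"] by (simp add: algebra_simps)
  also have "sin (of_real pi * (1/2 + y)) = cos (of_real pi * y)"
    by (simp add: sin_add algebra_simps flip: sin_of_real cos_of_real)
  also have "\<dots> = (exp (of_real pi * \<i> * y) + exp (- (of_real pi * \<i> * y))) / 2"
    by (simp add: cos_exp_eq algebra_simps)
  finally have "2 * of_real pi * exp (of_real pi * \<i> * y) * (rGamma (1/2 + y) * rGamma (1/2 - y)) =
     exp (of_real pi * \<i> * y) * (exp (of_real pi * \<i> * y) + exp (- (of_real pi * \<i> * y)))"
    by simp
  also have "\<dots> = exp (of_real pi * \<i> * y) * exp (of_real pi * \<i> * y) + 1"
    by (simp add: algebra_simps flip: exp_add)
  also have "exp (of_real pi * \<i> * y) * exp (of_real pi * \<i> * y) = e y"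
    by (simp add: e_def algebra_simps flip: exp_add)
  finally show ?thesis by simp
qed

text \<open>The two halves of the sum over all integers stay separate because they belong to
  different quadrants of the lattice. The slope \<alpha> covers both products: 1 for \<tau>, and
  1/\<tau> for the inverted one.\<close>

lemma logderiv3_one_plus_e:
  assumes "1 + e (\<alpha> * w + \<beta>) \<noteq> 0"
  obtains A B where "logderiv3 (\<lambda>w. 1 + e (\<alpha> * w + \<beta>)) w = A + B"
    "(\<lambda>n. \<alpha> ^ 3 * (2 / (\<alpha> * w + \<beta> + (of_nat n + 1/2)) ^ 3)) sums A"
    "(\<lambda>n. \<alpha> ^ 3 * (2 / (\<alpha> * w + \<beta> - (of_nat n + 1/2)) ^ 3)) sums B"
proof -
  define y where "y x = \<alpha> * x + \<beta>" for x
  define S where "S = {x. 1 + e (y x) \<noteq> 0}"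
  have "continuous_on UNIV (\<lambda>x. 1 + e (y x))" unfolding y_def by (intro continuous_intros)
  hence "open S" unfolding S_def
    using continuous_open_preimage[of UNIV "\<lambda>x. 1 + e (y x)" "- {0}"]
    by (simp add: vimage_def Int_def open_Compl)
  have "w \<in> S" using assms by (simp add: S_def y_def)
  have ni: "1/2 + y x \<notin> \<int>" "1/2 - y x \<notin> \<int>" if "x \<in> S" for x
  proof -
    have *: "y x + 1/2 \<notin> \<int>" using e_eq_minus_1[of "y x"] that by (auto simp: S_def)
    thus "1/2 + y x \<notin> \<int>" by (simp add: add.commute)
    show "1/2 - y x \<notin> \<int>"
    proof
      assume "1/2 - y x \<in> \<int>"
      hence "1 - (1/2 - y x) \<in> \<int>" using Ints_diff[OF Ints_1] by blast
      thus False using * by (simp add: algebra_simps)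
    qed
  qed
  hence np: "1/2 + y x \<notin> \<int>\<^sub>\<le>\<^sub>0" "1/2 - y x \<notin> \<int>\<^sub>\<le>\<^sub>0" if "x \<in> S" for x
    using that nonpos_Ints_Int by blast+
  have dy: "(y has_field_derivative \<alpha>) (at x)" for x
    unfolding y_def by (auto intro!: derivative_eq_intros)
  \<comment> \<open>The logarithmic derivative read off from \<open>one_plus_e_rGamma\<close>:
    \<open>rGamma\<close> contributes -\<open>Digamma\<close>, and the factor exp(pi i y)
    contributes the constant pi i.\<close>
  define l where "l x = \<alpha> * (of_real pi * \<i> - Digamma (1/2 + y x) + Digamma (1/2 - y x))" for x
  define l1 where "l1 x = \<alpha>\<^sup>2 * (- Polygamma 1 (1/2 + y x) - Polygamma 1 (1/2 - y x))" for x
  define l2 where "l2 x = \<alpha> ^ 3 * (- Polygamma 2 (1/2 + y x) + Polygamma 2 (1/2 - y x))" for x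
  have "logderiv3 (\<lambda>x. 1 + e (y x)) w = l2 w"
  proof (rule logderiv3_eqI[OF \<open>open S\<close> \<open>w \<in> S\<close>])
    fix x assume x: "x \<in> S"
    show "((\<lambda>x. 1 + e (y x)) has_field_derivative (1 + e (y x)) * l x) (at x)"
      unfolding one_plus_e_rGamma
      by (rule derivative_eq_intros dy refl np x has_field_derivative_rGamma_no_nonpos_int[THEN DERIV_chain2])+
         (simp add: l_def algebra_simps)
    show "(l has_field_derivative l1 x) (at x)"
      unfolding l_def
      by (rule derivative_eq_intros dy refl np x has_field_derivative_Polygamma[THEN DERIV_chain2])+
         (simp add: l1_def algebra_simps power2_eq_square)
    show "(l1 has_field_derivative l2 x) (at x)"
      unfolding l1_def
      by (rule derivative_eq_intros dy refl np x has_field_derivative_Polygamma[THEN DERIV_chain2])+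
         (simp add: l2_def algebra_simps power2_eq_square power3_eq_cube del: One_nat_def)
  qed (use assms in \<open>simp add: y_def\<close>)
  moreover have P: "(\<lambda>n. 2 / (u + of_nat n) ^ 3) sums (- Polygamma 2 u)" if "u \<notin> \<int>" for u :: complex
  proof -
    have "u \<noteq> 0" using that by auto
    from sums_mult[OF Polygamma_LIMSEQ[OF this, of 2], of 2]
    have "(\<lambda>n. 2 * inverse ((u + of_nat n) ^ 3)) sums (2 * ((-1) ^ 3 * Polygamma 2 u / fact 2))"
      by (simp del: power_Suc inverse_mult_distrib add: Suc_numeral)
    moreover have "2 * ((-1) ^ 3 * Polygamma 2 u / fact 2) = - Polygamma 2 u" by simp
    ultimately show ?thesis unfolding divide_inverse by (simp only:)
  qed
  have "(\<lambda>n. \<alpha> ^ 3 * (2 / (\<alpha> * w + \<beta> + (of_nat n + 1/2)) ^ 3)) sums (\<alpha> ^ 3 * - Polygamma 2 (1/2 + y w))"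
  proof -
    have "1/2 + y w + of_nat n = \<alpha> * w + \<beta> + (of_nat n + 1/2)" for n by (simp add: y_def)
    thus ?thesis using sums_mult[OF P[OF ni(1)[OF \<open>w \<in> S\<close>]], of "\<alpha> ^ 3"] by (simp only:)
  qed
  moreover have "(\<lambda>n. \<alpha> ^ 3 * (2 / (\<alpha> * w + \<beta> - (of_nat n + 1/2)) ^ 3)) sums (\<alpha> ^ 3 * Polygamma 2 (1/2 - y w))"
  proof -
    have *: "2 / (y w - (of_nat n + 1/2)) ^ 3 = - (2 / (1/2 - y w + of_nat n) ^ 3)" for n
    proof -
      have "y w - (of_nat n + 1/2) = - (1/2 - y w + of_nat n)" by simp
      moreover have "2 / (- v) ^ 3 = - (2 / v ^ 3)" for v :: complex by (simp add: power3_eq_cube)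
      ultimately show ?thesis by (simp only:)
    qed
    show ?thesis
      using sums_mult[OF sums_minus[OF P[OF ni(2)[OF \<open>w \<in> S\<close>]]], of "\<alpha> ^ 3"]
      unfolding *[symmetric] unfolding y_def minus_minus .
  qed
  ultimately show ?thesis
    using that[of "\<alpha> ^ 3 * - Polygamma 2 (1/2 + y w)" "\<alpha> ^ 3 * Polygamma 2 (1/2 - y w)"]
    by (simp add: l2_def y_def algebra_simps)
qed

text \<open>The product \<open>\<Prod>k. 1 + e (w + (k + 1/2) * \<tau>)\<close>: its zeros are half-integral lattice points.\<close>

definition cvarpi :: "complex \<Rightarrow> complex \<Rightarrow> complex" where
  "cvarpi w \<tau> = varpi (w + (\<tau> - 1) / 2) \<tau>"

lemma cvarpi_factor: "1 - e (w + (\<tau> - 1) / 2 + of_nat k * \<tau>) = 1 + e (w + (of_nat k + 1/2) * \<tau>)"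
proof -
  have "e (w + (\<tau> - 1) / 2 + of_nat k * \<tau>) = e (w + (of_nat k + 1/2) * \<tau> + - (1/2))"
    by (simp add: algebra_simps diff_divide_distrib)
  also have "\<dots> = - e (w + (of_nat k + 1/2) * \<tau>)"
    by (simp only: e_add e_minus e_half) simp
  finally show ?thesis by simp
qed

lemma uniform_limit_cvarpi:
  assumes "\<tau> \<in> UHP" "compact K"
  shows "uniform_limit K (\<lambda>n w. \<Prod>k<n. 1 + e (\<alpha> * w + (of_nat k + 1/2) * \<tau>)) (\<lambda>w. cvarpi (\<alpha> * w) \<tau>) sequentially"
proof -
  let ?g = "\<lambda>w. \<alpha> * w + (\<tau> - 1) / 2"
  have "compact (?g ` K)" by (intro compact_continuous_image assms continuous_intros)
  from uniform_limit_compose'[OF uniform_limit_varpi(2)[OF assms(1) this], of ?g K]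
  show ?thesis by (simp add: cvarpi_factor cvarpi_def image_subset_iff_funcset[symmetric])
qed

lemma cvarpi_eq_0_iff:
  assumes "\<tau> \<in> UHP"
  shows "cvarpi w \<tau> = 0 \<longleftrightarrow> (\<exists>(n::int) (k::nat). w = (of_int n + 1/2) - (of_nat k + 1/2) * \<tau>)"
proof -
  have "w + (\<tau> - 1) / 2 = of_int n - of_nat k * \<tau> \<longleftrightarrow> w = (of_int n + 1/2) - (of_nat k + 1/2) * \<tau>"
    for n :: int and k :: nat
  proof -
    have "w + (\<tau> - 1) / 2 - (of_int n - of_nat k * \<tau>) = w - ((of_int n + 1/2) - (of_nat k + 1/2) * \<tau>)"
      by (simp add: algebra_simps diff_divide_distrib)
    thus ?thesis by (metis right_minus_eq)
  qed
  thus ?thesis unfolding cvarpi_def varpi_eq_0_iff[OF assms] by simp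
qed

lemma hol2_at_cvarpi:
  assumes "hol2_at f p" "hol2_at g p" "g p \<in> UHP"
  shows "hol2_at (\<lambda>q. cvarpi (f q) (g q)) p"
  unfolding cvarpi_def by (intro hol2_at_varpi hol2_intros assms) simp

lemma cvarpi_holomorphic:
  assumes "\<tau> \<in> UHP"
  shows "(\<lambda>w. cvarpi (\<alpha> * w) \<tau>) holomorphic_on A"
proof -
  have "(\<lambda>w. cvarpi (\<alpha> * w) \<tau>) field_differentiable at x" for x
    using hol2_at_compose_slice[of "\<lambda>p. cvarpi (\<alpha> * fst p) (snd p)" "\<lambda>w. w" x "\<lambda>_. \<tau>"] assms
      hol2_at_cvarpi[OF hol2_at_mult[OF hol2_at_const hol2_at_fst] hol2_at_snd, of "(x, \<tau>)" \<alpha>]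
    by (simp add: field_differentiable_ident)
  thus ?thesis by (simp add: holomorphic_on_def field_differentiable_at_within)
qed

lemma cone_prod_holomorphic:
  assumes "\<tau> \<notin> \<real>\<^sub>\<le>\<^sub>0"
  shows "(\<lambda>w. cone_prod (\<alpha> * w) \<tau>) holomorphic_on A"
proof -
  have "(\<lambda>w. cone_prod (\<alpha> * w) \<tau>) field_differentiable at x" for x
    using hol2_at_compose_slice[of "\<lambda>p. cone_prod (\<alpha> * fst p) (snd p)" "\<lambda>w. w" x "\<lambda>_. \<tau>"] assms
      hol2_at_cone_prod[OF hol2_at_mult[OF hol2_at_const hol2_at_fst] hol2_at_snd, of "(x, \<tau>)" \<alpha>]
    by (simp add: field_differentiable_ident)
  thus ?thesis by (simp add: holomorphic_on_def field_differentiable_at_within)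
qed

lemma UHP_not_nonpos: "\<tau> \<in> UHP \<Longrightarrow> \<tau> \<notin> \<real>\<^sub>\<le>\<^sub>0" "\<tau> \<in> UHP \<Longrightarrow> - \<tau> \<notin> \<real>\<^sub>\<le>\<^sub>0"
  by (auto simp: UHP_def complex_nonpos_Reals_iff)

lemma UHP_nonzero: "\<tau> \<in> UHP \<Longrightarrow> \<tau> \<noteq> 0"
  by (auto simp: UHP_def)

lemma UHP_minus_inverse: "\<tau> \<in> UHP \<Longrightarrow> - 1 / \<tau> \<in> UHP"
  by (auto simp: UHP_def Im_divide intro!: divide_pos_pos simp: sum_power2_gt_zero_iff)

text \<open>One quadrant is enough: the others arise by changing the signs of w and \<tau>, at the
  cost of a sign from the odd power.\<close>

definition quadrant_term :: "complex \<Rightarrow> complex \<Rightarrow> nat \<times> nat \<Rightarrow> complex" where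
  "quadrant_term w \<tau> = (\<lambda>(m, n). 2 / (w + ((of_nat m + 1/2) + (of_nat n + 1/2) * \<tau>)) ^ 3)"

lemma quadrant_term_prod_decode:
  "quadrant_term w \<tau> (prod_decode i) = 2 / (w + lattice_pt \<tau> i) ^ 3"
  by (simp add: quadrant_term_def lattice_pt_def case_prod_beta)

lemma quadrant_term_has_sum:
  assumes "\<tau> \<notin> \<real>\<^sub>\<le>\<^sub>0"
  shows "(quadrant_term w \<tau> has_sum (\<Sum>i. 2 / (w + lattice_pt \<tau> i) ^ 3)) UNIV"
  using has_sum_prod_decode[of "quadrant_term w \<tau>"] summable_lattice_pt_cubed[OF assms, of w]
  by (simp add: quadrant_term_prod_decode)

lemma logderiv3_cone_prod:
  assumes \<tau>: "\<tau> \<notin> \<real>\<^sub>\<le>\<^sub>0" and nz: "cone_prod w \<tau> \<noteq> 0"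
  shows "logderiv3 (\<lambda>w. cone_prod w \<tau>) w = - (\<Sum>i. 2 / (- w + lattice_pt \<tau> i) ^ 3)"
proof -
  have A: "open (ball w 1)" "w \<in> ball w 1" by auto
  have "(\<lambda>i. logderiv3 (\<lambda>w. weierstrass_factor 2 (w / lattice_pt \<tau> i)) w) sums logderiv3 (\<lambda>w. cone_prod w \<tau>) w"
  proof (rule logderiv3_prodinf[OF _ A])
    show "uniform_limit (ball w 1) (\<lambda>n w. \<Prod>i<n. weierstrass_factor 2 (w / lattice_pt \<tau> i)) (\<lambda>w. cone_prod w \<tau>) sequentially"
      using uniform_limit_on_subset[OF uniform_limit_cone_prod(2)[OF \<tau> compact_cball] ball_subset_cball] .
  qed (use nz lattice_pt_nonzero[OF \<tau>] in \<open>auto intro!: holomorphic_intros\<close>)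
  moreover have "logderiv3 (\<lambda>w. weierstrass_factor 2 (w / lattice_pt \<tau> i)) w = - (2 / (- w + lattice_pt \<tau> i) ^ 3)" for i
  proof -
    have ne: "w \<noteq> lattice_pt \<tau> i" using nz cone_prod_eq_0_iff[OF \<tau>] by auto
    have "w - lattice_pt \<tau> i = - (- w + lattice_pt \<tau> i)" by simp
    moreover have "2 / (- v) ^ 3 = - (2 / v ^ 3)" for v :: complex by (simp add: power3_eq_cube)
    ultimately show ?thesis
      unfolding logderiv3_weierstrass_factor[OF lattice_pt_nonzero[OF \<tau>] ne] by (simp only:)
  qed
  ultimately have "(\<lambda>i. - (2 / (- w + lattice_pt \<tau> i) ^ 3)) sums logderiv3 (\<lambda>w. cone_prod w \<tau>) w" by simp
  from sums_minus[OF this] show ?thesis by (simp add: sums_iff)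
qed

lemma logderiv3_cone_prod_minus:
  assumes \<tau>: "\<tau> \<notin> \<real>\<^sub>\<le>\<^sub>0" and nz: "cone_prod (- w) \<tau> \<noteq> 0"
  shows "logderiv3 (\<lambda>w. cone_prod (- w) \<tau>) w = (\<Sum>i. 2 / (w + lattice_pt \<tau> i) ^ 3)"
proof -
  have A: "open (ball w 1)" "w \<in> ball w 1" by auto
  have "(\<lambda>i. logderiv3 (\<lambda>w. weierstrass_factor 2 (w / - lattice_pt \<tau> i)) w) sums logderiv3 (\<lambda>w. cone_prod (- w) \<tau>) w"
  proof (rule logderiv3_prodinf[OF _ A])
    have "compact (uminus ` cball w 1)" by (intro compact_continuous_image continuous_intros compact_cball)
    from uniform_limit_compose'[OF uniform_limit_cone_prod(2)[OF \<tau> this], of uminus "ball w 1"]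
    show "uniform_limit (ball w 1) (\<lambda>n w. \<Prod>i<n. weierstrass_factor 2 (w / - lattice_pt \<tau> i)) (\<lambda>w. cone_prod (- w) \<tau>) sequentially"
      by (simp add: image_iff)
  qed (use nz lattice_pt_nonzero[OF \<tau>] in \<open>auto intro!: holomorphic_intros\<close>)
  moreover have "logderiv3 (\<lambda>w. weierstrass_factor 2 (w / - lattice_pt \<tau> i)) w = 2 / (w + lattice_pt \<tau> i) ^ 3" for i
  proof -
    have ne: "w \<noteq> - lattice_pt \<tau> i" using nz cone_prod_eq_0_iff[OF \<tau>] by auto
    have "- lattice_pt \<tau> i \<noteq> 0" using lattice_pt_nonzero[OF \<tau>] by simp
    from logderiv3_weierstrass_factor[OF this ne] show ?thesis by simp
  qed
  ultimately show ?thesis by (simp add: sums_iff)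
qed

text \<open>The zeros of the k-th factor form a line in direction 1 below the real axis, cut into
  its two halves by \<open>logderiv3_one_plus_e\<close>. Summing over k fills two quadrants column
  by column.\<close>

lemma logderiv3_cvarpi:
  assumes \<tau>: "\<tau> \<in> UHP" and nz: "cvarpi w \<tau> \<noteq> 0"
  shows "logderiv3 (\<lambda>w. cvarpi w \<tau>) w =
    (\<Sum>i. 2 / (w + lattice_pt \<tau> i) ^ 3) - (\<Sum>i. 2 / (- w + lattice_pt (- \<tau>) i) ^ 3)"
    (is "_ = ?SA - ?SC")
proof -
  have A: "open (ball w 1)" "w \<in> ball w 1" by auto
  have sm: "(\<lambda>k. logderiv3 (\<lambda>w. 1 + e (1 * w + (of_nat k + 1/2) * \<tau>)) w) sums logderiv3 (\<lambda>w. cvarpi (1 * w) \<tau>) w"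
  proof (rule logderiv3_prodinf[OF _ A])
    show "uniform_limit (ball w 1) (\<lambda>n w. \<Prod>k<n. 1 + e (1 * w + (of_nat k + 1/2) * \<tau>)) (\<lambda>w. cvarpi (1 * w) \<tau>) sequentially"
      using uniform_limit_on_subset[OF uniform_limit_cvarpi[OF \<tau> compact_cball] ball_subset_cball] .
  qed (use nz in \<open>auto intro!: holomorphic_intros\<close>)
  have nz': "1 + e (1 * w + (of_nat k + 1/2) * \<tau>) \<noteq> 0" for k
  proof
    assume "1 + e (1 * w + (of_nat k + 1/2) * \<tau>) = 0"
    hence "1 - e (w + (\<tau> - 1) / 2 + of_nat k * \<tau>) = 0" by (simp add: cvarpi_factor)
    hence "cvarpi w \<tau> = 0" unfolding cvarpi_def varpi_def
      using prodinf_eq_0_iff[OF uniform_limit_varpi(1)[OF \<tau> compact_empty]] by blast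
    thus False using nz by simp
  qed
  have "\<exists>A B. logderiv3 (\<lambda>w. 1 + e (1 * w + (of_nat k + 1/2) * \<tau>)) w = A - B \<and>
     (\<lambda>m. quadrant_term w \<tau> (m, k)) sums A \<and> (\<lambda>m. quadrant_term (- w) (- \<tau>) (m, k)) sums B" for k
  proof -
    obtain A B where AB: "logderiv3 (\<lambda>w. 1 + e (1 * w + (of_nat k + 1/2) * \<tau>)) w = A + B"
      "(\<lambda>n. 1 ^ 3 * (2 / (1 * w + (of_nat k + 1/2) * \<tau> + (of_nat n + 1/2)) ^ 3)) sums A"
      "(\<lambda>n. 1 ^ 3 * (2 / (1 * w + (of_nat k + 1/2) * \<tau> - (of_nat n + 1/2)) ^ 3)) sums B"
      by (rule logderiv3_one_plus_e[OF nz'])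
    have "(\<lambda>m. quadrant_term w \<tau> (m, k)) sums A"
      using AB(2) by (simp add: quadrant_term_def add_ac)
    moreover have "(\<lambda>m. quadrant_term (- w) (- \<tau>) (m, k)) sums (- B)"
    proof -
      have *: "quadrant_term (- w) (- \<tau>) (m, k) = - (1 ^ 3 * (2 / (1 * w + (of_nat k + 1/2) * \<tau> - (of_nat m + 1/2)) ^ 3))" for m
      proof -
        have "- w + (of_nat m + 1/2 + (of_nat k + 1/2) * - \<tau>) = - (1 * w + (of_nat k + 1/2) * \<tau> - (of_nat m + 1/2))"
          by (simp add: algebra_simps)
        moreover have "2 / (- v) ^ 3 = - (1 ^ 3 * (2 / v ^ 3))" for v :: complex by (simp add: power3_eq_cube)
        ultimately show ?thesis unfolding quadrant_term_def prod.case by (simp only:)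
      qed
      show ?thesis unfolding * by (rule sums_minus[OF AB(3)])
    qed
    ultimately show ?thesis using AB(1) by (intro exI[of _ A] exI[of _ "- B"]) simp
  qed
  then obtain A B where AB: "\<And>k. logderiv3 (\<lambda>w. 1 + e (1 * w + (of_nat k + 1/2) * \<tau>)) w = A k - B k"
     "\<And>k. (\<lambda>m. quadrant_term w \<tau> (m, k)) sums A k" "\<And>k. (\<lambda>m. quadrant_term (- w) (- \<tau>) (m, k)) sums B k"
    by metis
  have "A sums ?SA"
    by (rule has_sum_imp_sums, rule has_sum_columns[OF quadrant_term_has_sum AB(2)])
       (rule UHP_not_nonpos(1)[OF \<tau>])
  moreover have "B sums ?SC"
    by (rule has_sum_imp_sums, rule has_sum_columns[OF quadrant_term_has_sum AB(3)])
       (rule UHP_not_nonpos(2)[OF \<tau>])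
  ultimately have "(\<lambda>k. logderiv3 (\<lambda>w. 1 + e (1 * w + (of_nat k + 1/2) * \<tau>)) w) sums (?SA - ?SC)"
    unfolding AB(1) by (rule sums_diff)
  with sm have "logderiv3 (\<lambda>w. cvarpi (1 * w) \<tau>) w = ?SA - ?SC" by (rule sums_unique2)
  thus ?thesis by simp
qed

text \<open>After multiplication by \<tau> the zeros of the k-th factor lie on a line in direction
  \<tau>, so the quadrants are now filled row by row; the cube of \<alpha> from the chain rule
  absorbs the scaling. The first sum is the one shared with \<open>logderiv3_cvarpi\<close>.\<close>

lemma logderiv3_cvarpi_inverted:
  assumes \<tau>: "\<tau> \<in> UHP" and nz: "cvarpi (w / \<tau>) (- 1 / \<tau>) \<noteq> 0"
  shows "logderiv3 (\<lambda>w. cvarpi (w / \<tau>) (- 1 / \<tau>)) w =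
    - (\<Sum>i. 2 / (- w + lattice_pt (- \<tau>) i) ^ 3) - (\<Sum>i. 2 / (- w + lattice_pt \<tau> i) ^ 3)"
    (is "_ = - ?SC - ?SB")
proof -
  define \<alpha> where "\<alpha> = 1 / \<tau>"
  define \<tau>' where "\<tau>' = - 1 / \<tau>"
  have \<tau>0: "\<tau> \<noteq> 0" and \<tau>': "\<tau>' \<in> UHP" using UHP_nonzero UHP_minus_inverse \<tau> by (auto simp: \<tau>'_def)
  have A: "open (ball w 1)" "w \<in> ball w 1" by auto
  have nz: "cvarpi (\<alpha> * w) \<tau>' \<noteq> 0" using nz by (simp add: \<alpha>_def \<tau>'_def)
  have sm: "(\<lambda>k. logderiv3 (\<lambda>w. 1 + e (\<alpha> * w + (of_nat k + 1/2) * \<tau>')) w) sums logderiv3 (\<lambda>w. cvarpi (\<alpha> * w) \<tau>') w"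
  proof (rule logderiv3_prodinf[OF _ A])
    show "uniform_limit (ball w 1) (\<lambda>n w. \<Prod>k<n. 1 + e (\<alpha> * w + (of_nat k + 1/2) * \<tau>')) (\<lambda>w. cvarpi (\<alpha> * w) \<tau>') sequentially"
      using uniform_limit_on_subset[OF uniform_limit_cvarpi[OF \<tau>' compact_cball] ball_subset_cball] .
  qed (use nz in \<open>auto intro!: holomorphic_intros\<close>)
  have nz': "1 + e (\<alpha> * w + (of_nat k + 1/2) * \<tau>') \<noteq> 0" for k
  proof
    assume "1 + e (\<alpha> * w + (of_nat k + 1/2) * \<tau>') = 0"
    hence "1 - e (\<alpha> * w + (\<tau>' - 1) / 2 + of_nat k * \<tau>') = 0" by (simp add: cvarpi_factor)
    hence "cvarpi (\<alpha> * w) \<tau>' = 0" unfolding cvarpi_def varpi_def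
      using prodinf_eq_0_iff[OF uniform_limit_varpi(1)[OF \<tau>' compact_empty]] by blast
    thus False using nz by simp
  qed
  have "\<exists>A B. logderiv3 (\<lambda>w. 1 + e (\<alpha> * w + (of_nat k + 1/2) * \<tau>')) w = - A - B \<and>
     (\<lambda>n. quadrant_term (- w) (- \<tau>) (k, n)) sums A \<and> (\<lambda>n. quadrant_term (- w) \<tau> (k, n)) sums B" for k
  proof -
    obtain A B where AB: "logderiv3 (\<lambda>w. 1 + e (\<alpha> * w + (of_nat k + 1/2) * \<tau>')) w = A + B"
      "(\<lambda>n. \<alpha> ^ 3 * (2 / (\<alpha> * w + (of_nat k + 1/2) * \<tau>' + (of_nat n + 1/2)) ^ 3)) sums A"
      "(\<lambda>n. \<alpha> ^ 3 * (2 / (\<alpha> * w + (of_nat k + 1/2) * \<tau>' - (of_nat n + 1/2)) ^ 3)) sums B"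
      by (rule logderiv3_one_plus_e[OF nz'])
    have c: "2 / (- (\<tau> * v)) ^ 3 = - (\<alpha> ^ 3 * (2 / v ^ 3))" for v :: complex
      by (simp add: power3_eq_cube \<alpha>_def)
    have "(\<lambda>n. quadrant_term (- w) (- \<tau>) (k, n)) sums (- A)"
    proof -
      have *: "quadrant_term (- w) (- \<tau>) (k, n) = - (\<alpha> ^ 3 * (2 / (\<alpha> * w + (of_nat k + 1/2) * \<tau>' + (of_nat n + 1/2)) ^ 3))" for n
      proof -
        have "- w + (of_nat k + 1/2 + (of_nat n + 1/2) * - \<tau>) = - (\<tau> * (\<alpha> * w + (of_nat k + 1/2) * \<tau>' + (of_nat n + 1/2)))"
          using \<tau>0 by (simp add: \<alpha>_def \<tau>'_def field_simps)
        thus ?thesis unfolding quadrant_term_def prod.case by (simp only: c)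
      qed
      show ?thesis unfolding * by (rule sums_minus[OF AB(2)])
    qed
    moreover have "(\<lambda>n. quadrant_term (- w) \<tau> (k, n)) sums (- B)"
    proof -
      have *: "quadrant_term (- w) \<tau> (k, n) = - (\<alpha> ^ 3 * (2 / (\<alpha> * w + (of_nat k + 1/2) * \<tau>' - (of_nat n + 1/2)) ^ 3))" for n
      proof -
        have "- w + (of_nat k + 1/2 + (of_nat n + 1/2) * \<tau>) = - (\<tau> * (\<alpha> * w + (of_nat k + 1/2) * \<tau>' - (of_nat n + 1/2)))"
          using \<tau>0 by (simp add: \<alpha>_def \<tau>'_def field_simps)
        thus ?thesis unfolding quadrant_term_def prod.case by (simp only: c)
      qed
      show ?thesis unfolding * by (rule sums_minus[OF AB(3)])
    qed
    ultimately show ?thesis using AB(1) by (intro exI[of _ "- A"] exI[of _ "- B"]) simp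
  qed
  then obtain A B where AB: "\<And>k. logderiv3 (\<lambda>w. 1 + e (\<alpha> * w + (of_nat k + 1/2) * \<tau>')) w = - A k - B k"
     "\<And>k. (\<lambda>n. quadrant_term (- w) (- \<tau>) (k, n)) sums A k" "\<And>k. (\<lambda>n. quadrant_term (- w) \<tau> (k, n)) sums B k"
    by metis
  have "A sums ?SC"
    by (rule has_sum_imp_sums, rule has_sum_rows[OF quadrant_term_has_sum AB(2)])
       (rule UHP_not_nonpos(2)[OF \<tau>])
  moreover have "B sums ?SB"
    by (rule has_sum_imp_sums, rule has_sum_rows[OF quadrant_term_has_sum AB(3)])
       (rule UHP_not_nonpos(1)[OF \<tau>])
  ultimately have "(\<lambda>k. logderiv3 (\<lambda>w. 1 + e (\<alpha> * w + (of_nat k + 1/2) * \<tau>')) w) sums (- ?SC - ?SB)"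
    unfolding AB(1) by (intro sums_diff sums_minus)
  with sm have "logderiv3 (\<lambda>w. cvarpi (\<alpha> * w) \<tau>') w = - ?SC - ?SB" by (rule sums_unique2)
  thus ?thesis by (simp add: \<alpha>_def \<tau>'_def)
qed

section \<open>Comparison of the two products\<close>

lemma countable_affine_preimage:
  fixes \<alpha> \<beta> :: complex
  assumes "countable Z" "\<alpha> \<noteq> 0"
  shows "countable {w. \<alpha> * w + \<beta> \<in> Z}"
proof (rule countable_subset)
  show "{w. \<alpha> * w + \<beta> \<in> Z} \<subseteq> (\<lambda>z. (z - \<beta>) / \<alpha>) ` Z"
  proof
    fix w assume "w \<in> {w. \<alpha> * w + \<beta> \<in> Z}"
    moreover have "w = (\<alpha> * w + \<beta> - \<beta>) / \<alpha>" using assms(2) by simp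
    ultimately show "w \<in> (\<lambda>z. (z - \<beta>) / \<alpha>) ` Z" by (metis imageI mem_Collect_eq)
  qed
  show "countable ((\<lambda>z. (z - \<beta>) / \<alpha>) ` Z)" using assms(1) by (rule countable_image)
qed

lemma countable_zeros_cvarpi:
  assumes "\<tau> \<in> UHP" shows "countable {w. cvarpi w \<tau> = 0}"
proof (rule countable_subset)
  show "{w. cvarpi w \<tau> = 0} \<subseteq> range (\<lambda>(n::int, k::nat). (of_int n + 1/2) - (of_nat k + 1/2) * \<tau>)"
    using cvarpi_eq_0_iff[OF assms] by auto
  show "countable (range (\<lambda>(n::int, k::nat). (of_int n + 1/2) - (of_nat k + 1/2) * \<tau>))"
    by (intro countable_image countableI_type)
qed

lemma countable_zeros_cone_prod:
  assumes "\<tau> \<notin> \<real>\<^sub>\<le>\<^sub>0" shows "countable {w. cone_prod w \<tau> = 0}"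
proof (rule countable_subset)
  show "{w. cone_prod w \<tau> = 0} \<subseteq> range (lattice_pt \<tau>)"
    using cone_prod_eq_0_iff[OF assms] by auto
  show "countable (range (lattice_pt \<tau>))" by (intro countable_image countableI_type)
qed

lemma dense_complement_countable:
  fixes Z :: "complex set"
  assumes "countable Z" "open V" "V \<noteq> {}"
  shows "\<exists>w\<in>V. w \<notin> Z"
proof -
  obtain x where "x \<in> V" using assms by blast
  then obtain r where "r > 0" "ball x r \<subseteq> V" using assms(2) open_contains_ball by blast
  hence "uncountable V" using uncountable_ball[of r x] countable_subset[of "ball x r" V] by blast
  hence "\<not> V \<subseteq> Z" using assms(1) countable_subset[of V Z] by metis
  thus ?thesis by (simp add: subset_iff Bex_def)
qed

lemma zero_deriv_connected_constant:
  fixes f :: "complex \<Rightarrow> complex"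
  assumes "open S" "connected S" "\<And>w. w \<in> S \<Longrightarrow> (f has_field_derivative 0) (at w)"
  obtains c where "\<And>w. w \<in> S \<Longrightarrow> f w = c"
proof (rule DERIV_zero_connected_constant[OF assms(2,1) finite.emptyI])
  show "continuous_on S f"
    by (rule DERIV_continuous_on) (rule has_field_derivative_at_within[OF assms(3)])
qed (use assms(3) that in auto)

text \<open>The quotient of the two sides without the exponential has vanishing third logarithmic
  derivative away from the zeros; integrating three times leaves the exponential of a quadratic
  polynomial. The equation is stated without denominators so that it holds at every w.\<close>

lemma inversion_core:
  assumes \<tau>: "\<tau> \<in> UHP"
  shows "\<exists>a b C. \<forall>w. cvarpi (w / \<tau>) (- 1 / \<tau>) * cone_prod (- w) \<tau> =
    C * exp (a * w\<^sup>2 + b * w) * (cvarpi w \<tau> * cone_prod w \<tau>)"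
proof -
  define f1 f2 f3 f4 where "f1 w = cvarpi (w / \<tau>) (- 1 / \<tau>)" and "f2 w = cone_prod (- w) \<tau>"
    and "f3 w = cvarpi w \<tau>" and "f4 w = cone_prod w \<tau>" for w
  have \<tau>0: "\<tau> \<noteq> 0" and \<tau>': "- 1 / \<tau> \<in> UHP" and np: "\<tau> \<notin> \<real>\<^sub>\<le>\<^sub>0"
    using UHP_nonzero UHP_minus_inverse UHP_not_nonpos \<tau> by blast+
  have hol: "f1 holomorphic_on A" "f2 holomorphic_on A" "f3 holomorphic_on A" "f4 holomorphic_on A" for A
    using cvarpi_holomorphic[OF \<tau>', of "1 / \<tau>" A] cone_prod_holomorphic[OF np, of "- 1" A]
      cvarpi_holomorphic[OF \<tau>, of 1 A] cone_prod_holomorphic[OF np, of 1 A]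
    unfolding f1_def f2_def f3_def f4_def by simp_all
  define Z where "Z = {w. f1 w * f2 w * f3 w * f4 w = 0}"
  have "countable ({w. f1 w = 0} \<union> {w. f2 w = 0} \<union> {w. f3 w = 0} \<union> {w. f4 w = 0})"
    using countable_affine_preimage[OF countable_zeros_cvarpi[OF \<tau>'], of "1 / \<tau>" 0]
      countable_affine_preimage[OF countable_zeros_cone_prod[OF np], of "- 1" 0]
      countable_zeros_cvarpi[OF \<tau>] countable_zeros_cone_prod[OF np] \<tau>0
    unfolding f1_def f2_def f3_def f4_def by simp
  hence Z: "countable Z"
    by (rule countable_subset[rotated]) (auto simp: Z_def)
  have "closed Z" unfolding Z_def
    by (intro closed_Collect_eq continuous_intros holomorphic_on_imp_continuous_on hol)
  \<comment> \<open>Removing a countable set from the plane leaves it connected, so each integration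
    constant is global and the zeros need no local analysis.\<close>
  define S where "S = - Z"
  have S: "open S" "connected S"
    using \<open>closed Z\<close> path_connected_complement_countable[OF _ Z]
    by (auto simp: S_def intro: path_connected_imp_connected)
  have nz: "f1 w \<noteq> 0" "f2 w \<noteq> 0" "f3 w \<noteq> 0" "f4 w \<noteq> 0" if "w \<in> S" for w
    using that by (auto simp: S_def Z_def)
  define l where "l f w = deriv f w / f w" for f :: "complex \<Rightarrow> complex" and w
  have lhol: "l f1 holomorphic_on S" "l f2 holomorphic_on S" "l f3 holomorphic_on S" "l f4 holomorphic_on S"
    unfolding l_def using logderiv_holomorphic[OF S(1)] hol nz by blast+
  define L where "L w = l f1 w + l f2 w - l f3 w - l f4 w" for w
  define L1 where "L1 w = deriv (l f1) w + deriv (l f2) w - deriv (l f3) w - deriv (l f4) w" for w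
  have dL: "(L has_field_derivative L1 w) (at w)" if "w \<in> S" for w
    unfolding L_def L1_def
    by (intro DERIV_add DERIV_diff holomorphic_derivI[OF _ S(1) that] lhol)
  have dL1: "(L1 has_field_derivative 0) (at w)" if w: "w \<in> S" for w
  proof -
    have "(L1 has_field_derivative deriv (deriv (l f1)) w + deriv (deriv (l f2)) w
        - deriv (deriv (l f3)) w - deriv (deriv (l f4)) w) (at w)"
      unfolding L1_def
      by (intro DERIV_add DERIV_diff holomorphic_derivI[OF _ S(1) w] holomorphic_deriv lhol S(1))
    also have "deriv (deriv (l f1)) w + deriv (deriv (l f2)) w - deriv (deriv (l f3)) w - deriv (deriv (l f4)) w =
        logderiv3 f1 w + logderiv3 f2 w - logderiv3 f3 w - logderiv3 f4 w"
      unfolding l_def using logderiv3_logderiv[OF S(1) w] hol nz by simp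
    \<comment> \<open>The three quadrant sums cancel in pairs: the shared quadrant between
      \<open>f1\<close> and \<open>f3\<close>, the other two against the cone products.\<close>
    also have "\<dots> = 0"
    proof -
      have "logderiv3 f1 w = - (\<Sum>i. 2 / (- w + lattice_pt (- \<tau>) i) ^ 3) - (\<Sum>i. 2 / (- w + lattice_pt \<tau> i) ^ 3)"
        unfolding f1_def[abs_def] by (rule logderiv3_cvarpi_inverted[OF \<tau>]) (use nz(1)[OF w] in \<open>simp add: f1_def\<close>)
      moreover have "logderiv3 f2 w = (\<Sum>i. 2 / (w + lattice_pt \<tau> i) ^ 3)"
        unfolding f2_def[abs_def] by (rule logderiv3_cone_prod_minus[OF np]) (use nz(2)[OF w] in \<open>simp add: f2_def\<close>)
      moreover have "logderiv3 f3 w = (\<Sum>i. 2 / (w + lattice_pt \<tau> i) ^ 3) - (\<Sum>i. 2 / (- w + lattice_pt (- \<tau>) i) ^ 3)"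
        unfolding f3_def[abs_def] by (rule logderiv3_cvarpi[OF \<tau>]) (use nz(3)[OF w] in \<open>simp add: f3_def\<close>)
      moreover have "logderiv3 f4 w = - (\<Sum>i. 2 / (- w + lattice_pt \<tau> i) ^ 3)"
        unfolding f4_def[abs_def] by (rule logderiv3_cone_prod[OF np]) (use nz(4)[OF w] in \<open>simp add: f4_def\<close>)
      ultimately show ?thesis by simp
    qed
    finally show ?thesis .
  qed
  obtain a2 where a2: "\<And>w. w \<in> S \<Longrightarrow> L1 w = a2"
    using zero_deriv_connected_constant[OF S dL1] by metis
  have dLa: "((\<lambda>w. L w - a2 * w) has_field_derivative 0) (at w)" if "w \<in> S" for w
    using DERIV_diff[OF dL[OF that] DERIV_cmult[OF DERIV_ident, of a2]] a2[OF that] by simp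
  obtain b where b: "\<And>w. w \<in> S \<Longrightarrow> L w - a2 * w = b"
    using zero_deriv_connected_constant[OF S dLa] by metis
  define E where "E w = f1 w * f2 w / (f3 w * f4 w) * exp (- (a2 / 2 * w\<^sup>2 + b * w))" for w
  have dE: "(E has_field_derivative 0) (at w)" if w: "w \<in> S" for w
  proof -
    have d: "(f has_field_derivative f w * l f w) (at w)" if "f holomorphic_on S" "f w \<noteq> 0" for f
      using holomorphic_derivI[OF that(1) S(1) w, of UNIV] that(2) by (simp add: l_def)
    note d' = d[OF hol(1) nz(1)[OF w]] d[OF hol(2) nz(2)[OF w]] d[OF hol(3) nz(3)[OF w]] d[OF hol(4) nz(4)[OF w]]
    have "(E has_field_derivative E w * (L w - (a2 * w + b))) (at w)"
      unfolding E_def[abs_def]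
      apply (rule derivative_eq_intros d' refl no_zero_divisors nz w)+
      using nz[OF w] by (simp add: L_def field_simps)
    moreover have "L w - (a2 * w + b) = 0" using b[OF w] by (simp add: algebra_simps)
    ultimately show ?thesis by simp
  qed
  obtain C where C: "\<And>w. w \<in> S \<Longrightarrow> E w = C"
    using zero_deriv_connected_constant[OF S dE] by metis
  define R where "R w = C * exp (a2 / 2 * w\<^sup>2 + b * w) * (f3 w * f4 w)" for w
  have eqS: "f1 w * f2 w = R w" if "w \<in> S" for w
    using C[OF that] nz[OF that] by (simp add: R_def E_def exp_minus field_simps)
  \<comment> \<open>The set of disagreement is open and contained in the countable set
    \<open>Z\<close>, hence empty.\<close>
  have "open {w. f1 w * f2 w \<noteq> R w}" unfolding R_def
    by (intro open_Collect_neq continuous_intros holomorphic_on_imp_continuous_on hol)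
  hence "f1 w * f2 w = R w" for w
    using dense_complement_countable[OF Z, of "{w. f1 w * f2 w \<noteq> R w}"] eqS by (auto simp: S_def)
  thus ?thesis unfolding R_def f1_def f2_def f3_def f4_def by blast
qed

section \<open>Determination of the quadratic exponent\<close>

lemma cvarpi_add_1 [simp]: "cvarpi (w + 1) \<tau> = cvarpi w \<tau>"
  using varpi_add_of_int[of "w + (\<tau> - 1) / 2" 1 \<tau>] by (simp add: cvarpi_def add_ac)

lemma cvarpi_shift:
  assumes "\<tau> \<in> UHP"
  shows "cvarpi (w - \<tau> / 2) \<tau> = (1 + e w) * cvarpi (w + \<tau> / 2) \<tau>"
proof -
  have "e (w - 1/2) = - e w"
    using e_add[of w "- (1/2)"] by (simp add: e_minus e_half)
  moreover have "w - \<tau> / 2 + (\<tau> - 1) / 2 = w - 1/2" "w + \<tau> / 2 + (\<tau> - 1) / 2 = w - 1/2 + \<tau>"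
    by (simp_all add: field_simps)
  ultimately show ?thesis
    using varpi_shift[OF assms, of "w - 1/2"] by (simp only: cvarpi_def diff_minus_eq_add)
qed

lemma cvarpi_split:
  assumes "\<tau> \<in> UHP"
  shows "cvarpi w \<tau> = cvarpi (w - \<tau> / 2) (2 * \<tau>) * cvarpi (w + \<tau> / 2) (2 * \<tau>)"
proof -
  have "w - \<tau> / 2 + (2 * \<tau> - 1) / 2 = w + (\<tau> - 1) / 2"
    "w + \<tau> / 2 + (2 * \<tau> - 1) / 2 = w + (\<tau> - 1) / 2 + \<tau>"
    by (simp_all add: field_simps)
  moreover have "varpi z \<tau> = varpi z (2 * \<tau>) * varpi (z + \<tau>) (2 * \<tau>)" for z
    using varpi_decimate[OF assms, of 2 z] by (simp add: numeral_2_eq_2)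
  ultimately show ?thesis by (simp only: cvarpi_def)
qed

text \<open>Inversion trades this relation for \<open>cvarpi_split\<close>: halving the period in
  one product is halving the argument in the other. The recursions for C rest on this
  exchange.\<close>

lemma cvarpi_double:
  assumes "\<tau> \<in> UHP"
  shows "cvarpi (2 * w) (2 * \<tau>) = cvarpi (w + 1/4) \<tau> * cvarpi (w - 1/4) \<tau>"
proof -
  define z where "z = w + \<tau> / 2 - 1/4"
  have "2 * w + (2 * \<tau> - 1) / 2 = 2 * z" "w + 1/4 + (\<tau> - 1) / 2 = z"
    "w - 1/4 + (\<tau> - 1) / 2 = z + 1/2 + of_int (-1)"
    by (simp_all add: z_def field_simps)
  thus ?thesis
    using varpi_duplication[OF assms, of z] by (simp only: cvarpi_def varpi_add_of_int)
qed

section \<open>Regions without zeros\<close>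

lemma cvarpi_nonzero:
  assumes "\<tau> \<in> UHP" "Im w > - Im \<tau> / 2"
  shows "cvarpi w \<tau> \<noteq> 0"
proof
  assume "cvarpi w \<tau> = 0"
  then obtain n :: int and k :: nat where "w = (of_int n + 1/2) - (of_nat k + 1/2) * \<tau>"
    using cvarpi_eq_0_iff[OF assms(1)] by blast
  from arg_cong[OF this, of Im] have "Im w = - (real k * Im \<tau>) - Im \<tau> / 2" by (simp add: ring_distribs)
  moreover have "real k * Im \<tau> \<ge> 0" using assms by (simp add: UHP_def)
  ultimately show False using assms(2) by simp
qed

lemma cvarpi_inverted_nonzero:
  assumes "\<tau> \<in> UHP" "\<bar>Im w\<bar> < Im \<tau> / 2"
  shows "cvarpi (w / \<tau>) (- 1 / \<tau>) \<noteq> 0"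
proof
  assume "cvarpi (w / \<tau>) (- 1 / \<tau>) = 0"
  then obtain n :: int and k :: nat where "w / \<tau> = (of_int n + 1/2) - (of_nat k + 1/2) * (- 1 / \<tau>)"
    using cvarpi_eq_0_iff[OF UHP_minus_inverse[OF assms(1)]] by blast
  hence "w = (of_int n + 1/2) * \<tau> + (of_nat k + 1/2)"
    using UHP_nonzero[OF assms(1)] by (simp add: field_simps)
  hence "Im w = (real_of_int n + 1/2) * Im \<tau>" by simp
  hence "\<bar>real_of_int n + 1/2\<bar> * Im \<tau> < 1/2 * Im \<tau>" using assms by (simp add: abs_mult UHP_def)
  hence "\<bar>real_of_int n + 1/2\<bar> < 1/2" using assms(1) by (simp add: UHP_def)
  hence "real_of_int n < 0" "real_of_int n > -1" by linarith+
  hence "n < 0" "n > -1" by linarith+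
  thus False by simp
qed

lemma cone_prod_nonzero_strip:
  assumes "\<tau> \<in> UHP" "Im w < Im \<tau> / 2"
  shows "cone_prod w \<tau> \<noteq> 0"
proof
  assume "cone_prod w \<tau> = 0"
  then obtain i where "w = lattice_pt \<tau> i"
    using cone_prod_eq_0_iff[OF UHP_not_nonpos(1)[OF assms(1)]] by blast
  hence "Im w = real (snd (prod_decode i)) * Im \<tau> + Im \<tau> / 2"
    by (simp add: lattice_pt_def algebra_simps)
  moreover have "real (snd (prod_decode i)) * Im \<tau> \<ge> 0" using assms by (simp add: UHP_def)
  ultimately show False using assms(2) by simp
qed

text \<open>Unlike the strip lemma this covers the whole cut plane, where a logarithm of these
  values is taken. A real number at most 1/2 could be a lattice point only for \<tau> on the
  cut.\<close>

lemma cone_prod_half_nonzero: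
  assumes "\<tau> \<notin> \<real>\<^sub>\<le>\<^sub>0" "x \<le> 1/2"
  shows "cone_prod (of_real x) \<tau> \<noteq> 0"
proof
  assume "cone_prod (of_real x) \<tau> = 0"
  then obtain i where i: "of_real x = lattice_pt \<tau> i"
    using cone_prod_eq_0_iff[OF assms(1)] by blast
  define m n where "m = fst (prod_decode i)" and "n = snd (prod_decode i)"
  have n: "complex_of_real (real n + 1/2) \<noteq> 0"
    by (subst of_real_eq_0_iff) linarith
  have eq: "of_real (real n + 1/2) * \<tau> = of_real (x - (real m + 1/2))"
    using i by (simp add: lattice_pt_def m_def n_def)
  have "\<tau> = of_real (real n + 1/2) * \<tau> / of_real (real n + 1/2)"
    using n by simp
  hence "\<tau> = of_real ((x - (real m + 1/2)) / (real n + 1/2))"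
    unfolding eq of_real_divide .
  moreover have "(x - (real m + 1/2)) / (real n + 1/2) \<le> 0"
    using assms(2) by (intro divide_nonpos_pos) auto
  ultimately have "\<tau> \<in> \<real>\<^sub>\<le>\<^sub>0" using nonpos_Reals_of_real_iff by blast
  thus False using assms(1) by simp
qed

text \<open>The point \<tau>/2 lies on the edge of the strip of
  \<open>cone_prod_nonzero_strip\<close>: there the imaginary part forces n = 0, and then the real
  part m + 1/2 cannot vanish.\<close>

lemma cone_prod_half_period_nonzero:
  assumes "\<tau> \<in> UHP"
  shows "cone_prod (\<tau> / 2) \<tau> \<noteq> 0"
proof
  assume "cone_prod (\<tau> / 2) \<tau> = 0"
  then obtain i where i: "\<tau> / 2 = lattice_pt \<tau> i"
    using cone_prod_eq_0_iff[OF UHP_not_nonpos(1)[OF assms]] by blast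
  define m n where "m = fst (prod_decode i)" and "n = snd (prod_decode i)"
  have *: "of_nat n * \<tau> + (of_nat m + 1/2) = 0"
  proof -
    have "of_nat n * \<tau> + (of_nat m + 1/2) = lattice_pt \<tau> i - \<tau> / 2"
      by (simp add: lattice_pt_def m_def n_def ring_distribs)
    thus ?thesis using i by simp
  qed
  from arg_cong[OF *, of Im] have "n = 0" using assms by (simp add: UHP_def)
  with arg_cong[OF *, of Re] show False by simp
qed

lemma exp_linear_eq_1_imp_zero:
  fixes k :: complex
  assumes "r > 0" "\<And>u. norm u < r \<Longrightarrow> exp (k * u) = 1"
  shows "k = 0"
proof -
  have "((\<lambda>u. exp (k * u)) has_field_derivative k) (at 0)"
    by (auto intro!: derivative_eq_intros)
  moreover have "((\<lambda>u. exp (k * u)) has_field_derivative 0) (at 0)"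
    by (rule has_field_derivative_transform_within_open[where f = "\<lambda>_. 1" and S = "ball 0 r"])
       (use assms in auto)
  ultimately show ?thesis by (rule DERIV_unique)
qed

lemma UHP_double: "\<tau> \<in> UHP \<Longrightarrow> 2 * \<tau> \<in> UHP" "\<tau> \<in> UHP \<Longrightarrow> \<tau> / 2 \<in> UHP"
  by (auto simp: UHP_def)

lemma cvarpi_differentiable:
  assumes "f field_differentiable at x" "g field_differentiable at x" "g x \<in> UHP"
  shows "(\<lambda>x. cvarpi (f x) (g x)) field_differentiable at x"
  using hol2_at_compose_slice[OF _ assms(1,2), of "\<lambda>p. cvarpi (fst p) (snd p)"]
    hol2_at_cvarpi[OF hol2_at_fst hol2_at_snd, of "(f x, g x)"] assms(3) by simp

lemma cone_prod_differentiable: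
  assumes "f field_differentiable at x" "g field_differentiable at x" "g x \<notin> \<real>\<^sub>\<le>\<^sub>0"
  shows "(\<lambda>x. cone_prod (f x) (g x)) field_differentiable at x"
  using hol2_at_compose_slice[OF _ assms(1,2), of "\<lambda>p. cone_prod (fst p) (snd p)"]
    hol2_at_cone_prod[OF hol2_at_fst hol2_at_snd, of "(f x, g x)"] assms(3) by simp

text \<open>The coefficients are chosen pointwise in \<tau>. Nothing is assumed about how they vary;
  this has to be recovered from functional equations.\<close>

locale inversion_coeffs =
  fixes a b C :: "complex \<Rightarrow> complex"
  assumes core: "\<And>\<tau> w. \<tau> \<in> UHP \<Longrightarrow> cvarpi (w / \<tau>) (- 1 / \<tau>) * cone_prod (- w) \<tau> =
    C \<tau> * exp (a \<tau> * w\<^sup>2 + b \<tau> * w) * (cvarpi w \<tau> * cone_prod w \<tau>)"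
begin

lemma C_eq:
  assumes "\<tau> \<in> UHP"
  shows "C \<tau> = cvarpi 0 (- 1 / \<tau>) / cvarpi 0 \<tau>" "C \<tau> \<noteq> 0"
proof -
  have "cvarpi 0 \<tau> \<noteq> 0" "cvarpi (0 / \<tau>) (- 1 / \<tau>) \<noteq> 0"
    using cvarpi_nonzero[OF assms, of 0] cvarpi_inverted_nonzero[OF assms, of 0] assms by (auto simp: UHP_def)
  thus "C \<tau> = cvarpi 0 (- 1 / \<tau>) / cvarpi 0 \<tau>" "C \<tau> \<noteq> 0"
    using core[OF assms, of 0] by auto
qed

text \<open>Comparing \<open>core\<close> at u + 1/2 and u - 1/2 removes C and \<open>cvarpi\<close>
  at \<tau>, which has period 1, while the inverted product contributes 1 + e(u/\<tau>). The strip
  keeps the factors to be cancelled nonzero.\<close>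

lemma shift_relation:
  assumes \<tau>: "\<tau> \<in> UHP" and u: "\<bar>Im u\<bar> < Im \<tau> / 2"
  shows "(1 + e (u / \<tau>)) * (cone_prod (- 1/2 - u) \<tau> * cone_prod (- 1/2 + u) \<tau>) =
    exp (2 * a \<tau> * u + b \<tau>) * (cone_prod (1/2 + u) \<tau> * cone_prod (1/2 - u) \<tau>)"
proof -
  define n v P E where "n w = cvarpi (w / \<tau>) (- 1 / \<tau>)" and "v w = cvarpi w \<tau>"
    and "P w = cone_prod w \<tau>" and "E w = exp (a \<tau> * w\<^sup>2 + b \<tau> * w)" for w
  have \<tau>0: "\<tau> \<noteq> 0" by (rule UHP_nonzero[OF \<tau>])
  have 1: "n (u + 1/2) * P (- 1/2 - u) = C \<tau> * E (u + 1/2) * (v (u + 1/2) * P (1/2 + u))"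
  proof -
    have "- (u + 1/2) = - 1/2 - u" by simp
    thus ?thesis using core[OF \<tau>, of "u + 1/2"]
      unfolding n_def v_def P_def E_def by (simp only: add.commute[of "1/2"])
  qed
  have 2: "n (u - 1/2) * P (1/2 - u) = C \<tau> * E (u - 1/2) * (v (u - 1/2) * P (- 1/2 + u))"
  proof -
    have "- (u - 1/2) = 1/2 - u" "- 1/2 + u = u - 1/2" by simp_all
    thus ?thesis using core[OF \<tau>, of "u - 1/2"]
      unfolding n_def v_def P_def E_def by (simp only:)
  qed
  have 3: "n (u + 1/2) = (1 + e (u / \<tau>)) * n (u - 1/2)"
    using cvarpi_shift[OF UHP_minus_inverse[OF \<tau>], of "u / \<tau>"] \<tau>0
    by (simp add: n_def add_divide_distrib diff_divide_distrib mult.commute[of 2])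
  have 4: "v (u + 1/2) = v (u - 1/2)"
    using cvarpi_add_1[of "u - 1/2" \<tau>] by (simp add: v_def add.commute)
  have 5: "E (u + 1/2) = exp (2 * a \<tau> * u + b \<tau>) * E (u - 1/2)"
    by (simp add: E_def power2_eq_square algebra_simps flip: exp_add)
  have nz: "n (u - 1/2) \<noteq> 0" "v (u - 1/2) \<noteq> 0" "E (u - 1/2) \<noteq> 0"
    using cvarpi_inverted_nonzero[OF \<tau>, of "u - 1/2"] cvarpi_nonzero[OF \<tau>, of "u - 1/2"] u
    by (auto simp: n_def v_def E_def)
  have "n (u - 1/2) * ((1 + e (u / \<tau>)) * P (- 1/2 - u) * P (- 1/2 + u)) =
      (n (u + 1/2) * P (- 1/2 - u)) * P (- 1/2 + u)" by (simp add: 3)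
  also have "\<dots> = exp (2 * a \<tau> * u + b \<tau>) * P (1/2 + u) * (C \<tau> * E (u - 1/2) * (v (u - 1/2) * P (- 1/2 + u)))"
    unfolding 1 4 5 by simp
  also have "\<dots> = n (u - 1/2) * (exp (2 * a \<tau> * u + b \<tau>) * P (1/2 + u) * P (1/2 - u))"
    unfolding 2[symmetric] by simp
  finally show ?thesis using nz(1) by (simp add: P_def mult.assoc)
qed

text \<open>Both pairs of cone products in \<open>shift_relation\<close> are even in u. Dividing the
  relation at u by the one at -u therefore leaves e(u/\<tau>) = exp(4 a u) for small u, since (1 +
  s)/(1 + 1/s) = s.\<close>

lemma a_eq:
  assumes \<tau>: "\<tau> \<in> UHP"
  shows "a \<tau> = of_real pi * \<i> / (2 * \<tau>)"
proof -
  have "2 * of_real pi * \<i> / \<tau> - 4 * a \<tau> = 0"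
  proof (rule exp_linear_eq_1_imp_zero)
    show "Im \<tau> / 2 > 0" using \<tau> by (simp add: UHP_def)
    fix u :: complex assume "norm u < Im \<tau> / 2"
    hence u: "\<bar>Im u\<bar> < Im \<tau> / 2" using abs_Im_le_cmod[of u] by linarith
    define X Y where "X = cone_prod (- 1/2 - u) \<tau> * cone_prod (- 1/2 + u) \<tau>"
      and "Y = cone_prod (1/2 + u) \<tau> * cone_prod (1/2 - u) \<tau>"
    have nz: "X \<noteq> 0" "Y \<noteq> 0"
      using u cone_prod_nonzero_strip[OF \<tau>] by (auto simp: X_def Y_def)
    define s t where "s = e (u / \<tau>)" and "t = exp (2 * a \<tau> * u)"
    have st: "s \<noteq> 0" "t \<noteq> 0" by (auto simp: s_def t_def)
    have "(1 + s) * X = t * exp (b \<tau>) * Y"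
      using shift_relation[OF \<tau> u] by (simp add: X_def Y_def s_def t_def exp_add)
    moreover have "(1 + inverse s) * X = inverse t * exp (b \<tau>) * Y"
    proof -
      have "exp (2 * a \<tau> * - u + b \<tau>) = inverse t * exp (b \<tau>)"
        by (simp only: t_def mult_minus_right exp_add exp_minus)
      thus ?thesis using shift_relation[OF \<tau>, of "- u"] u
        by (simp add: X_def Y_def s_def e_minus mult_ac)
    qed
    ultimately have "s * (inverse t * exp (b \<tau>) * Y) = t * exp (b \<tau>) * Y"
      using st by (auto simp: field_simps)
    hence "s * inverse t * inverse t = 1" using nz st by (simp add: field_simps)
    moreover have "exp ((2 * of_real pi * \<i> / \<tau> - 4 * a \<tau>) * u) = s * inverse t * inverse t"
      by (simp add: s_def t_def e_def algebra_simps flip: exp_minus exp_add)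
    ultimately show "exp ((2 * of_real pi * \<i> / \<tau> - 4 * a \<tau>) * u) = 1" by simp
  qed
  thus ?thesis using UHP_nonzero[OF \<tau>] by (simp add: field_simps)
qed

text \<open>This is u = 0 in \<open>shift_relation\<close>, with 2 = 1 + e(0). The right side makes
  sense on the whole cut plane, but determines b only modulo 2 pi i.\<close>

lemma exp_b:
  assumes \<tau>: "\<tau> \<in> UHP"
  shows "exp (b \<tau>) = 2 * (cone_prod (- 1/2) \<tau> / cone_prod (1/2) \<tau>)\<^sup>2"
proof -
  have "Im \<tau> > 0" using \<tau> by (simp add: UHP_def)
  hence "cone_prod (1/2) \<tau> \<noteq> 0" by (intro cone_prod_nonzero_strip[OF \<tau>]) simp
  thus ?thesis using shift_relation[OF \<tau>, of 0] \<open>Im \<tau> > 0\<close>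
    by (simp add: field_simps power2_eq_square)
qed

text \<open>The counterpart of \<open>exp_b\<close> for the shift by \<tau>, from
  \<open>core\<close> at \<tau>/2 and -\<tau>/2. Changing b by 2 pi i n alters the modulus of exp(b
  \<tau>), so this relation sees the integer that \<open>exp_b\<close> leaves open.\<close>

lemma exp_b_period:
  assumes \<tau>: "\<tau> \<in> UHP"
  shows "exp (b \<tau> * \<tau>) = 2 * (cone_prod (- \<tau> / 2) \<tau> / cone_prod (\<tau> / 2) \<tau>)\<^sup>2"
proof -
  define N v P Q E where "N = cvarpi (1/2) (- 1 / \<tau>)" and "v = cvarpi (\<tau> / 2) \<tau>"
    and "P = cone_prod (\<tau> / 2) \<tau>" and "Q = cone_prod (- \<tau> / 2) \<tau>"
    and "E = exp (b \<tau> * \<tau> / 2)"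
  define A where "A = C \<tau> * exp (a \<tau> * (\<tau> / 2)\<^sup>2)"
  have \<tau>0: "\<tau> \<noteq> 0" "Im \<tau> > 0" using UHP_nonzero[OF \<tau>] \<tau> by (auto simp: UHP_def)
  have nz: "N \<noteq> 0" "v \<noteq> 0" "P \<noteq> 0" "Q \<noteq> 0" "E \<noteq> 0" "A \<noteq> 0"
    using cvarpi_nonzero[OF UHP_minus_inverse[OF \<tau>], of "1/2"] UHP_minus_inverse[OF \<tau>]
      cvarpi_nonzero[OF \<tau>, of "\<tau> / 2"] cone_prod_half_period_nonzero[OF \<tau>]
      cone_prod_nonzero_strip[OF \<tau>, of "- \<tau> / 2"] \<tau>0 C_eq(2)[OF \<tau>]
    by (auto simp: N_def v_def P_def Q_def E_def A_def UHP_def)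
  have N': "cvarpi (- 1/2) (- 1 / \<tau>) = N" using cvarpi_add_1[of "- 1/2" "- 1 / \<tau>"] by (simp add: N_def)
  have v': "cvarpi (- \<tau> / 2) \<tau> = 2 * v" using cvarpi_shift[OF \<tau>, of 0] by (simp add: v_def)
  have 1: "N * Q = A * E * (v * P)"
    using core[OF \<tau>, of "\<tau> / 2"] \<tau>0 by (simp add: N_def Q_def A_def E_def v_def P_def exp_add)
  have 2: "N * P = A * inverse E * (2 * v * Q)"
  proof -
    have "exp (a \<tau> * (- \<tau> / 2)\<^sup>2 + b \<tau> * (- \<tau> / 2)) = exp (a \<tau> * (\<tau> / 2)\<^sup>2) * inverse E"
      unfolding E_def exp_minus[symmetric] exp_add[symmetric] by simp
    thus ?thesis using core[OF \<tau>, of "- \<tau> / 2"] \<tau>0 N' v'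
      by (simp add: Q_def A_def P_def)
  qed
  have "N * P * (E\<^sup>2 * P) = N * P * (2 * Q * Q / P)"
  proof -
    have "A * (E * v) = N * Q / P" using 1 nz by (simp add: field_simps)
    have "N * P * (E\<^sup>2 * P) = 2 * (A * (E * v)) * Q * P"
      unfolding 2 using nz by (simp add: field_simps power2_eq_square)
    also have "\<dots> = N * P * (2 * Q * Q / P)" unfolding \<open>A * (E * v) = N * Q / P\<close> using nz by simp
    finally show ?thesis .
  qed
  moreover have "N * P \<noteq> 0" using nz by simp
  ultimately have "E\<^sup>2 * P = 2 * Q * Q / P" using mult_left_cancel by blast
  hence "E\<^sup>2 = 2 * (Q / P)\<^sup>2" using nz by (simp add: field_simps power2_eq_square)
  moreover have "E\<^sup>2 = exp (b \<tau> * \<tau>)" by (simp add: E_def flip: exp_double)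
  ultimately show ?thesis by (simp add: P_def Q_def)
qed

text \<open>Multiplying \<open>core\<close> at w and at -w removes the cone products and the linear
  coefficient. By the triple product, \<open>cvarpi w \<tau> * cvarpi (- w) \<tau>\<close> is
  Jacobi's theta_3 divided by the product of 1 - e(k \<tau>), k \<ge> 1.\<close>

lemma reflection:
  assumes \<tau>: "\<tau> \<in> UHP" and w: "\<bar>Im w\<bar> < Im \<tau> / 2"
  shows "cvarpi (w / \<tau>) (- 1 / \<tau>) * cvarpi (- w / \<tau>) (- 1 / \<tau>) =
    (C \<tau>)\<^sup>2 * exp (2 * a \<tau> * w\<^sup>2) * (cvarpi w \<tau> * cvarpi (- w) \<tau>)"
proof -
  define P Q where "P = cone_prod w \<tau>" and "Q = cone_prod (- w) \<tau>"
  have nz: "P \<noteq> 0" "Q \<noteq> 0" using cone_prod_nonzero_strip[OF \<tau>] w by (auto simp: P_def Q_def)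
  have "(cvarpi (w / \<tau>) (- 1 / \<tau>) * Q) * (cvarpi (- w / \<tau>) (- 1 / \<tau>) * P) =
     (C \<tau> * exp (a \<tau> * w\<^sup>2 + b \<tau> * w) * (cvarpi w \<tau> * P)) * (C \<tau> * exp (a \<tau> * w\<^sup>2 - b \<tau> * w) * (cvarpi (- w) \<tau> * Q))"
    using core[OF \<tau>, of w] core[OF \<tau>, of "- w"] by (simp add: P_def Q_def)
  also have "\<dots> = (C \<tau>)\<^sup>2 * (exp (a \<tau> * w\<^sup>2 + b \<tau> * w) * exp (a \<tau> * w\<^sup>2 - b \<tau> * w)) * (cvarpi w \<tau> * cvarpi (- w) \<tau>) * (P * Q)"
    by (simp add: power2_eq_square)
  also have "exp (a \<tau> * w\<^sup>2 + b \<tau> * w) * exp (a \<tau> * w\<^sup>2 - b \<tau> * w) = exp (2 * a \<tau> * w\<^sup>2)"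
    by (simp add: mult.assoc flip: exp_add)
  finally show ?thesis using nz by simp
qed

text \<open>In \<open>reflection\<close> for 2\<tau> the point w = \<tau>/2 lets
  \<open>cvarpi_split\<close> collapse the right side to \<open>cvarpi 0 \<tau>\<close>; inverted, w
  becomes 1/4, and \<open>cvarpi_double\<close> collapses the left side.\<close>

lemma C_double:
  assumes \<tau>: "\<tau> \<in> UHP"
  shows "C \<tau> = exp (of_real pi * \<i> * \<tau> / 8) * (C (2 * \<tau>))\<^sup>2"
proof -
  have \<tau>0: "\<tau> \<noteq> 0" "Im \<tau> > 0" using UHP_nonzero[OF \<tau>] \<tau> by (auto simp: UHP_def)
  define t where "t = - 1 / (2 * \<tau>)"
  have t: "t \<in> UHP" "2 * t = - 1 / \<tau>"
    using UHP_minus_inverse[OF UHP_double(1)[OF \<tau>]] by (auto simp: t_def)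
  have "cvarpi 0 (- 1 / \<tau>) = cvarpi (1/4) t * cvarpi (- 1/4) t"
    using cvarpi_double[OF t(1), of 0] t(2) by simp
  also have "\<dots> = cvarpi ((\<tau> / 2) / (2 * \<tau>)) (- 1 / (2 * \<tau>)) * cvarpi (- (\<tau> / 2) / (2 * \<tau>)) (- 1 / (2 * \<tau>))"
    using \<tau>0 by (simp add: t_def)
  also have "\<dots> = (C (2 * \<tau>))\<^sup>2 * exp (2 * a (2 * \<tau>) * (\<tau> / 2)\<^sup>2) * (cvarpi (\<tau> / 2) (2 * \<tau>) * cvarpi (- (\<tau> / 2)) (2 * \<tau>))"
    by (rule reflection[OF UHP_double(1)[OF \<tau>]]) (use \<tau>0 in simp)
  also have "cvarpi (\<tau> / 2) (2 * \<tau>) * cvarpi (- (\<tau> / 2)) (2 * \<tau>) = cvarpi 0 \<tau>"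
    using cvarpi_split[OF \<tau>, of 0] by simp
  also have "2 * a (2 * \<tau>) * (\<tau> / 2)\<^sup>2 = of_real pi * \<i> * \<tau> / 8"
    unfolding a_eq[OF UHP_double(1)[OF \<tau>]] using \<tau>0 by (simp add: field_simps power2_eq_square)
  finally show ?thesis
    using C_eq(1)[OF \<tau>] cvarpi_nonzero[OF \<tau>, of 0] \<tau>0 by (simp add: field_simps)
qed

text \<open>The mirror image of \<open>C_double\<close>: \<open>reflection\<close> for \<tau>/2 at w
  = 1/4, with the two distribution relations interchanged.\<close>

lemma C_half:
  assumes \<tau>: "\<tau> \<in> UHP"
  shows "C \<tau> = exp (of_real pi * \<i> / (8 * \<tau>)) * (C (\<tau> / 2))\<^sup>2"
proof -
  have \<tau>0: "\<tau> \<noteq> 0" "Im \<tau> > 0" using UHP_nonzero[OF \<tau>] \<tau> by (auto simp: UHP_def)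
  have \<tau>2: "\<tau> / 2 \<in> UHP" by (rule UHP_double(2)[OF \<tau>])
  have "cvarpi 0 (- 1 / \<tau>) = cvarpi ((1/4) / (\<tau> / 2)) (- 1 / (\<tau> / 2)) * cvarpi (- (1/4) / (\<tau> / 2)) (- 1 / (\<tau> / 2))"
    using cvarpi_split[OF UHP_minus_inverse[OF \<tau>], of 0] by (simp add: mult.commute[of 2])
  also have "\<dots> = (C (\<tau> / 2))\<^sup>2 * exp (2 * a (\<tau> / 2) * (1/4)\<^sup>2) * (cvarpi (1/4) (\<tau> / 2) * cvarpi (- (1/4)) (\<tau> / 2))"
    by (rule reflection[OF \<tau>2]) (use \<tau>0 in simp)
  also have "cvarpi (1/4) (\<tau> / 2) * cvarpi (- (1/4)) (\<tau> / 2) = cvarpi 0 \<tau>"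
    using cvarpi_double[OF \<tau>2, of 0] by simp
  also have "2 * a (\<tau> / 2) * (1/4)\<^sup>2 = of_real pi * \<i> / (8 * \<tau>)"
    unfolding a_eq[OF \<tau>2] using \<tau>0 by (simp add: field_simps power2_eq_square)
  finally show ?thesis
    using C_eq(1)[OF \<tau>] cvarpi_nonzero[OF \<tau>, of 0] \<tau>0 by (simp add: field_simps)
qed

text \<open>Inserting \<open>C_half\<close> at 2\<tau> into \<open>C_double\<close> expresses
  C(\<tau>) through its own fourth power; cancelling one nonzero factor leaves the cube.\<close>

lemma C_cubed:
  assumes \<tau>: "\<tau> \<in> UHP"
  shows "(C \<tau> * exp (of_real pi * \<i> * (\<tau> + 1 / \<tau>) / 24)) ^ 3 = 1"
proof -
  have \<tau>0: "\<tau> \<noteq> 0" using UHP_nonzero[OF \<tau>] .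
  define x y where "x = exp (of_real pi * \<i> * \<tau> / 8)" and "y = exp (of_real pi * \<i> / (16 * \<tau>))"
  have "C (2 * \<tau>) = y * (C \<tau>)\<^sup>2"
    using C_half[OF UHP_double(1)[OF \<tau>]] by (simp add: y_def)
  hence "C \<tau> = x * (y * (C \<tau>)\<^sup>2)\<^sup>2" using C_double[OF \<tau>] by (simp add: x_def)
  hence "C \<tau> * 1 = C \<tau> * (x * y\<^sup>2 * C \<tau> ^ 3)"
    by (simp add: power2_eq_square power3_eq_cube mult_ac)
  hence "x * y\<^sup>2 * C \<tau> ^ 3 = 1" using C_eq(2)[OF \<tau>] by (metis mult_left_cancel)
  moreover have "exp (of_real pi * \<i> * (\<tau> + 1 / \<tau>) / 24) ^ 3 = x * y\<^sup>2"
  proof -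
    have "exp (of_real pi * \<i> * (\<tau> + 1 / \<tau>) / 24) ^ 3 = exp (3 * (of_real pi * \<i> * (\<tau> + 1 / \<tau>) / 24))"
      using exp_of_nat_mult[of 3 "of_real pi * \<i> * (\<tau> + 1 / \<tau>) / 24"] by simp
    also have "3 * (of_real pi * \<i> * (\<tau> + 1 / \<tau>) / 24) =
       of_real pi * \<i> * \<tau> / 8 + 2 * (of_real pi * \<i> / (16 * \<tau>))"
      using \<tau>0 by (simp add: field_simps)
    also have "exp \<dots> = x * y\<^sup>2"
      by (simp only: exp_add x_def y_def exp_double)
    finally show ?thesis .
  qed
  ultimately show ?thesis by (simp add: power_mult_distrib mult.commute)
qed

text \<open>In effect the invariance of Weber's function f under \<tau> -> -1/\<tau>, up to a
  constant \<open>K\<close>: by \<open>C_eq\<close>, C is a quotient of values of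
  \<open>cvarpi 0\<close>, and these are f up to the factor exp(pi i \<tau>/24). Continuity into the
  finite set of cube roots of unity makes \<open>K\<close> constant.\<close>

lemma C_extension:
  "\<exists>K. \<forall>\<tau>\<in>UHP. C \<tau> = K * exp (- (of_real pi * \<i> * (\<tau> + 1 / \<tau>) / 24))"
proof -
  define \<kappa> where "\<kappa> \<tau> = C \<tau> * exp (of_real pi * \<i> * (\<tau> + 1 / \<tau>) / 24)" for \<tau>
  have "\<kappa> constant_on UHP"
  proof (rule continuous_finite_range_constant[OF connected_UHP])
    have "continuous_on UHP (\<lambda>\<tau>. cvarpi 0 (- 1 / \<tau>) / cvarpi 0 \<tau> * exp (of_real pi * \<i> * (\<tau> + 1 / \<tau>) / 24))"
    proof (intro continuous_at_imp_continuous_on ballI)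
      fix \<tau> assume \<tau>: "\<tau> \<in> UHP"
      hence *: "\<tau> \<noteq> 0" "cvarpi 0 \<tau> \<noteq> 0" using UHP_nonzero cvarpi_nonzero[OF \<tau>, of 0] by (auto simp: UHP_def)
      have "isCont (\<lambda>\<tau>. cvarpi 0 (- 1 / \<tau>)) \<tau>" "isCont (\<lambda>\<tau>. cvarpi 0 \<tau>) \<tau>"
        by (rule field_differentiable_imp_continuous_at, rule cvarpi_differentiable,
            (use \<tau> * UHP_minus_inverse[OF \<tau>] in \<open>auto intro!: derivative_intros\<close>))+
      thus "isCont (\<lambda>\<tau>. cvarpi 0 (- 1 / \<tau>) / cvarpi 0 \<tau> * exp (of_real pi * \<i> * (\<tau> + 1 / \<tau>) / 24)) \<tau>"
        using * by (intro continuous_intros) auto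
    qed
    thus "continuous_on UHP \<kappa>"
      by (rule continuous_on_eq) (simp add: \<kappa>_def C_eq(1))
    have "\<kappa> ` UHP \<subseteq> {z. z ^ 3 = 1}" using C_cubed by (auto simp: \<kappa>_def)
    thus "finite (\<kappa> ` UHP)" by (rule finite_subset) (rule finite_nth_roots, simp)
  qed
  then obtain K where "\<And>\<tau>. \<tau> \<in> UHP \<Longrightarrow> \<kappa> \<tau> = K" by (auto simp: constant_on_def)
  hence "\<forall>\<tau>\<in>UHP. C \<tau> = K * exp (- (of_real pi * \<i> * (\<tau> + 1 / \<tau>) / 24))"
    unfolding \<kappa>_def exp_minus by (auto simp: field_simps)
  thus ?thesis by blast
qed

text \<open>A logarithm \<beta> of the right side of \<open>exp_b\<close> exists on the slotted
  plane and differs from b by 2 pi i times an integer depending on \<tau>. That integer has to be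
  shown constant although b is not known to be continuous.\<close>

lemma b_extension:
  "\<exists>\<beta>. \<beta> holomorphic_on - \<real>\<^sub>\<le>\<^sub>0 \<and> (\<forall>\<tau>\<in>UHP. b \<tau> = \<beta> \<tau>)"
proof -
  define Y where "Y \<tau> = 2 * (cone_prod (- 1/2) \<tau> / cone_prod (1/2) \<tau>)\<^sup>2" for \<tau>
  define Y2 where "Y2 \<tau> = 2 * (cone_prod (- \<tau> / 2) \<tau> / cone_prod (\<tau> / 2) \<tau>)\<^sup>2" for \<tau>
  have nz: "cone_prod (1/2) \<tau> \<noteq> 0" "cone_prod (- 1/2) \<tau> \<noteq> 0" if "\<tau> \<notin> \<real>\<^sub>\<le>\<^sub>0" for \<tau>
    using cone_prod_half_nonzero[OF that, of "1/2"] cone_prod_half_nonzero[OF that, of "- 1/2"] by simp_all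
  have hY: "Y holomorphic_on - \<real>\<^sub>\<le>\<^sub>0"
  proof -
    have "(\<lambda>\<tau>. cone_prod k \<tau>) holomorphic_on - \<real>\<^sub>\<le>\<^sub>0" for k
    proof -
      have "(\<lambda>\<tau>. cone_prod k \<tau>) field_differentiable at \<tau>" if "\<tau> \<in> - \<real>\<^sub>\<le>\<^sub>0" for \<tau>
        using cone_prod_differentiable[of "\<lambda>_. k" \<tau> "\<lambda>x. x"] that by (simp add: field_differentiable_ident)
      thus ?thesis by (simp add: holomorphic_on_def field_differentiable_at_within)
    qed
    thus ?thesis unfolding Y_def using nz by (intro holomorphic_intros) auto
  qed
  have nzY: "Y \<tau> \<noteq> 0" if "\<tau> \<in> - \<real>\<^sub>\<le>\<^sub>0" for \<tau> using nz that by (simp add: Y_def)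
  have con: "contractible (- \<real>\<^sub>\<le>\<^sub>0 :: complex set)"
  proof -
    have "(\<real>\<^sub>\<le>\<^sub>0 :: complex set) = complex_of_real ` {..0}" by (auto simp: nonpos_Reals_def)
    thus ?thesis using starlike_imp_contractible[OF starlike_slotted_complex_plane_left[of 0]] by simp
  qed
  obtain \<beta> where \<beta>: "\<beta> holomorphic_on - \<real>\<^sub>\<le>\<^sub>0" "\<And>\<tau>. \<tau> \<in> - \<real>\<^sub>\<le>\<^sub>0 \<Longrightarrow> Y \<tau> = exp (\<beta> \<tau>)"
    using contractible_imp_holomorphic_log[OF hY con nzY] by metis
  \<comment> \<open>Solves |exp((b - \<beta>) \<tau>)| = exp(-2 pi n Im \<tau>) for n, with exp(b
    \<tau>) replaced by \<open>Y2\<close>. The formula avoids b and is visibly continuous in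
    \<tau>.\<close>
  define M where "M \<tau> = - ln (norm (Y2 \<tau> * exp (- (\<beta> \<tau> * \<tau>)))) / (2 * pi * Im \<tau>)" for \<tau>
  have M: "b \<tau> = \<beta> \<tau> + 2 * of_real pi * \<i> * of_real (M \<tau>) \<and> M \<tau> \<in> \<int>" if \<tau>: "\<tau> \<in> UHP" for \<tau>
  proof -
    have "exp (b \<tau>) = exp (\<beta> \<tau>)"
      using exp_b[OF \<tau>] \<beta>(2)[of \<tau>] UHP_not_nonpos(1)[OF \<tau>] by (simp add: Y_def)
    then obtain n :: int where n: "b \<tau> = \<beta> \<tau> + of_int (2 * n) * (of_real pi * \<i>)"
      unfolding exp_eq by (auto simp: mult_ac)
    have "Y2 \<tau> * exp (- (\<beta> \<tau> * \<tau>)) = exp ((b \<tau> - \<beta> \<tau>) * \<tau>)"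
    proof -
      have "(b \<tau> - \<beta> \<tau>) * \<tau> = b \<tau> * \<tau> + - (\<beta> \<tau> * \<tau>)" by (simp add: algebra_simps)
      thus ?thesis unfolding Y2_def exp_b_period[OF \<tau>, symmetric] by (simp only: exp_add)
    qed
    also have "norm \<dots> = exp (- (of_int n * (2 * pi * Im \<tau>)))"
    proof -
      have "Re ((b \<tau> - \<beta> \<tau>) * \<tau>) = - (of_int n * (2 * pi * Im \<tau>))" unfolding n by simp
      thus ?thesis by (simp only: norm_exp_eq_Re)
    qed
    finally have "M \<tau> = of_int n"
      using \<tau> by (simp add: M_def UHP_def)
    thus ?thesis using n by simp
  qed
  have "M constant_on UHP"
  proof (rule continuous_discrete_range_constant[OF connected_UHP])
    show "continuous_on UHP M"
    proof (intro continuous_at_imp_continuous_on ballI)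
      fix \<tau> assume \<tau>: "\<tau> \<in> UHP"
      hence np: "\<tau> \<notin> \<real>\<^sub>\<le>\<^sub>0" and Im: "Im \<tau> > 0" using UHP_not_nonpos by (auto simp: UHP_def)
      have c: "isCont (\<lambda>\<tau>. cone_prod (\<tau> / 2) \<tau>) \<tau>" "isCont (\<lambda>\<tau>. cone_prod (- \<tau> / 2) \<tau>) \<tau>"
      proof -
        have d: "(\<lambda>\<tau>. \<tau> / 2) field_differentiable at \<tau>" "(\<lambda>\<tau>. - \<tau> / 2) field_differentiable at \<tau>"
          by (auto intro!: derivative_intros)
        show "isCont (\<lambda>\<tau>. cone_prod (\<tau> / 2) \<tau>) \<tau>" "isCont (\<lambda>\<tau>. cone_prod (- \<tau> / 2) \<tau>) \<tau>"
          using d[THEN cone_prod_differentiable, OF field_differentiable_ident, OF np]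
          by (auto intro: field_differentiable_imp_continuous_at)
      qed
      have cz: "cone_prod (\<tau> / 2) \<tau> \<noteq> 0" "cone_prod (- \<tau> / 2) \<tau> \<noteq> 0"
        using cone_prod_half_period_nonzero[OF \<tau>] cone_prod_nonzero_strip[OF \<tau>, of "- \<tau> / 2"] Im by auto
      have "isCont Y2 \<tau>" unfolding Y2_def using c cz by (intro continuous_intros)
      moreover have "isCont \<beta> \<tau>"
        using holomorphic_on_imp_continuous_on[OF \<beta>(1)] open_cut_plane np
        by (simp add: continuous_on_eq_continuous_at)
      moreover have "Y2 \<tau> \<noteq> 0" using cz by (simp add: Y2_def)
      ultimately show "isCont M \<tau>" unfolding M_def using Im by (intro continuous_intros) auto
    qed
    \<comment> \<open>Distinct integers are at distance at least 1, so the continuous function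
      \<open>M\<close> has discrete range.\<close>
    fix \<tau> assume \<tau>: "\<tau> \<in> UHP"
    show "\<exists>r>0. \<forall>y. y \<in> UHP \<and> M y \<noteq> M \<tau> \<longrightarrow> r \<le> norm (M y - M \<tau>)"
    proof (intro exI[of _ 1] conjI allI impI)
      fix y assume y: "y \<in> UHP \<and> M y \<noteq> M \<tau>"
      hence "M y - M \<tau> \<in> \<int>" "M y - M \<tau> \<noteq> 0" using M \<tau> by auto
      thus "1 \<le> norm (M y - M \<tau>)" by (simp add: Ints_nonzero_abs_ge1)
    qed auto
  qed
  then obtain m where m: "\<And>\<tau>. \<tau> \<in> UHP \<Longrightarrow> M \<tau> = m" by (auto simp: constant_on_def)
  show ?thesis
  proof (intro exI[of _ "\<lambda>\<tau>. \<beta> \<tau> + 2 * of_real pi * \<i> * of_real m"] conjI ballI)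
    show "(\<lambda>\<tau>. \<beta> \<tau> + 2 * of_real pi * \<i> * of_real m) holomorphic_on - \<real>\<^sub>\<le>\<^sub>0"
      by (intro holomorphic_intros \<beta>)
  qed (use M m in simp)
qed

end

section \<open>The inversion formula on the cut plane\<close>

lemma cvarpi_inversion:
  "\<exists>\<beta> K. \<beta> holomorphic_on - \<real>\<^sub>\<le>\<^sub>0 \<and> (\<forall>\<tau>\<in>UHP. \<forall>w. cvarpi (w / \<tau>) (- 1 / \<tau>) * cone_prod (- w) \<tau> =
    K * exp (- (of_real pi * \<i> * (\<tau> + 1 / \<tau>) / 24)) * exp (of_real pi * \<i> / (2 * \<tau>) * w\<^sup>2 + \<beta> \<tau> * w) *
     (cvarpi w \<tau> * cone_prod w \<tau>))"
proof -
  obtain a b C where "\<And>\<tau> w. \<tau> \<in> UHP \<Longrightarrow> cvarpi (w / \<tau>) (- 1 / \<tau>) * cone_prod (- w) \<tau> =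
    C \<tau> * exp (a \<tau> * w\<^sup>2 + b \<tau> * w) * (cvarpi w \<tau> * cone_prod w \<tau>)"
    using inversion_core by metis
  then interpret inversion_coeffs a b C by unfold_locales
  obtain K \<beta> where K: "\<And>\<tau>. \<tau> \<in> UHP \<Longrightarrow> C \<tau> = K * exp (- (of_real pi * \<i> * (\<tau> + 1 / \<tau>) / 24))"
    and \<beta>: "\<beta> holomorphic_on - \<real>\<^sub>\<le>\<^sub>0" "\<And>\<tau>. \<tau> \<in> UHP \<Longrightarrow> b \<tau> = \<beta> \<tau>"
    using C_extension b_extension by metis
  show ?thesis
    by (intro exI[of _ \<beta>] exI[of _ K] conjI \<beta>(1) ballI allI) (simp only: core a_eq K \<beta>(2))
qed

text \<open>Clearing denominators avoids the junk values \<open>x / 0 = 0\<close> at zeros of \<open>H\<close> or \<open>varpi\<close>, and makes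
  the notion stable under products and substitutions.\<close>

definition extends_to :: "(complex \<Rightarrow> complex \<Rightarrow> complex) \<Rightarrow> complex set \<Rightarrow> bool" where
  "extends_to N T \<longleftrightarrow> (\<exists>G H. holomorphic2_on G (UNIV \<times> T) \<and> holomorphic2_on H (UNIV \<times> T) \<and>
     (\<forall>\<tau>\<in>T. countable {z. H (z, \<tau>) = 0}) \<and>
     (\<forall>\<tau>\<in>UHP. \<forall>z. N z \<tau> * H (z, \<tau>) = G (z, \<tau>) * varpi z \<tau>))"

lemma extends_toI:
  assumes "holomorphic2_on G (UNIV \<times> T)" "holomorphic2_on H (UNIV \<times> T)"
    "\<And>\<tau>. \<tau> \<in> T \<Longrightarrow> countable {z. H (z, \<tau>) = 0}"
    "\<And>\<tau> z. \<tau> \<in> UHP \<Longrightarrow> N z \<tau> * H (z, \<tau>) = G (z, \<tau>) * varpi z \<tau>"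
  shows "extends_to N T"
  unfolding extends_to_def
  by (rule exI[of _ G], rule exI[of _ H], intro conjI ballI allI) (fact assms)+

lemma extends_toE:
  assumes "extends_to N T"
  obtains G H where "holomorphic2_on G (UNIV \<times> T)" "holomorphic2_on H (UNIV \<times> T)"
    "\<And>\<tau>. \<tau> \<in> T \<Longrightarrow> countable {z. H (z, \<tau>) = 0}"
    "\<And>\<tau> z. \<tau> \<in> UHP \<Longrightarrow> N z \<tau> * H (z, \<tau>) = G (z, \<tau>) * varpi z \<tau>"
proof -
  from assms obtain G H where "holomorphic2_on G (UNIV \<times> T) \<and> holomorphic2_on H (UNIV \<times> T) \<and>
     (\<forall>\<tau>\<in>T. countable {z. H (z, \<tau>) = 0}) \<and>
     (\<forall>\<tau>\<in>UHP. \<forall>z. N z \<tau> * H (z, \<tau>) = G (z, \<tau>) * varpi z \<tau>)"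
    unfolding extends_to_def by (elim exE)
  thus thesis using that[of G H] by simp
qed

lemma varpi_inversion: "extends_to (\<lambda>z \<tau>. varpi (z / \<tau>) (- 1 / \<tau>)) (- \<real>\<^sub>\<le>\<^sub>0)"
proof -
  obtain \<beta> K where \<beta>: "\<beta> holomorphic_on - \<real>\<^sub>\<le>\<^sub>0" and
    inv: "\<And>\<tau> w. \<tau> \<in> UHP \<Longrightarrow> cvarpi (w / \<tau>) (- 1 / \<tau>) * cone_prod (- w) \<tau> =
    K * exp (- (of_real pi * \<i> * (\<tau> + 1 / \<tau>) / 24)) * exp (of_real pi * \<i> / (2 * \<tau>) * w\<^sup>2 + \<beta> \<tau> * w) *
     (cvarpi w \<tau> * cone_prod w \<tau>)"
    using cvarpi_inversion by metis
  define w where "w p = fst p - (snd p - 1) / 2" for p :: "complex \<times> complex"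
  define H where "H p = cone_prod (- w p) (snd p)" for p
  define G where "G p = K * exp (- (of_real pi * \<i> * (snd p + 1 / snd p) / 24)) *
    exp (of_real pi * \<i> / (2 * snd p) * (w p)\<^sup>2 + \<beta> (snd p) * w p) * cone_prod (w p) (snd p)" for p
  have w: "hol2_at w p" for p unfolding w_def by (intro hol2_intros) simp
  have "holomorphic2_on H (UNIV \<times> - \<real>\<^sub>\<le>\<^sub>0)"
    unfolding holomorphic2_on_iff H_def by (auto intro!: hol2_at_cone_prod hol2_intros w)
  moreover have "holomorphic2_on G (UNIV \<times> - \<real>\<^sub>\<le>\<^sub>0)"
    unfolding holomorphic2_on_iff
  proof
    fix p :: "complex \<times> complex" assume "p \<in> UNIV \<times> - \<real>\<^sub>\<le>\<^sub>0"
    hence np: "snd p \<notin> \<real>\<^sub>\<le>\<^sub>0" "snd p \<noteq> 0" by auto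
    have "hol2_at (\<lambda>p. \<beta> (snd p)) p"
      using holomorphic_on_imp_differentiable_at[OF \<beta> open_cut_plane, of "snd p"] np
        hol2_at_compose_field[OF hol2_at_snd, of \<beta> p] by simp
    thus "hol2_at G p" unfolding G_def using np
      by (intro hol2_at_cone_prod hol2_intros w) auto
  qed
  moreover have "countable {z. H (z, \<tau>) = 0}" if "\<tau> \<in> - \<real>\<^sub>\<le>\<^sub>0" for \<tau>
    using countable_affine_preimage[OF countable_zeros_cone_prod[of \<tau>], of "- 1" "(\<tau> - 1) / 2"] that
    by (simp add: H_def w_def add.commute)
  moreover have "varpi (z / \<tau>) (- 1 / \<tau>) * H (z, \<tau>) = G (z, \<tau>) * varpi z \<tau>" if \<tau>: "\<tau> \<in> UHP" for z \<tau>
  proof -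
    have "cvarpi (w (z, \<tau>)) \<tau> = varpi z \<tau>" by (simp add: cvarpi_def w_def)
    moreover have "cvarpi (w (z, \<tau>) / \<tau>) (- 1 / \<tau>) = varpi (z / \<tau>) (- 1 / \<tau>)"
    proof -
      \<comment> \<open>The half-period shifts of the two products match under inversion up to the
        integer -1, which periodicity absorbs.\<close>
      have "w (z, \<tau>) / \<tau> + (- 1 / \<tau> - 1) / 2 = z / \<tau> + of_int (-1)"
        using UHP_nonzero[OF \<tau>] by (simp add: w_def field_simps)
      thus ?thesis unfolding cvarpi_def by (simp only: varpi_add_of_int)
    qed
    ultimately show ?thesis
      using inv[OF \<tau>, of "w (z, \<tau>)"] by (simp add: G_def H_def)
  qed
  ultimately show ?thesis by (intro extends_toI[of G _ H])
qed

section \<open>The modular quotient\<close>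

text \<open>Controlling zeros on slices of constant \<tau> suffices: a countable set cannot fill an
  open piece of such a slice, so H is not identically zero on any ball in U.\<close>

lemma meromorphic2_onI_quotient:
  assumes U: "open U" and G: "holomorphic2_on G U" and H: "holomorphic2_on H U"
    and zeros: "\<And>z \<tau>. (z, \<tau>) \<in> U \<Longrightarrow> countable {z. H (z, \<tau>) = 0}"
    and F: "\<And>q. q \<in> U \<Longrightarrow> H q \<noteq> 0 \<Longrightarrow> F q = G q / H q"
  shows "meromorphic2_on F U"
  unfolding meromorphic2_on_def
proof (intro conjI ballI U)
  fix p assume "p \<in> U"
  then obtain r where r: "r > 0" "ball p r \<subseteq> U" using U open_contains_ball by blast
  obtain z \<tau> where p: "p = (z, \<tau>)" by (cases p)
  define S where "S = (\<lambda>z. (z, \<tau>)) -` ball p r"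
  have "open S" unfolding S_def by (intro open_vimage open_ball continuous_intros)
  moreover have "z \<in> S" using r(1) by (simp add: S_def p)
  moreover have "countable {z. H (z, \<tau>) = 0}" using zeros \<open>p \<in> U\<close> p by blast
  ultimately obtain z' where "z' \<in> S" "H (z', \<tau>) \<noteq> 0"
    using dense_complement_countable[of "{z. H (z, \<tau>) = 0}" S] by auto
  hence q: "\<exists>q\<in>ball p r. H q \<noteq> 0" by (auto simp: S_def)
  have hol: "holomorphic2_on G (ball p r)" "holomorphic2_on H (ball p r)"
    using G H r(2) by (auto simp: holomorphic2_on_iff)
  have "\<forall>q\<in>ball p r. H q \<noteq> 0 \<longrightarrow> F q = G q / H q" using F r(2) by blast
  with r hol q show "\<exists>V g h. open V \<and> connected V \<and> p \<in> V \<and> V \<subseteq> U \<and>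
        holomorphic2_on g V \<and> holomorphic2_on h V \<and> (\<exists>q\<in>V. h q \<noteq> 0) \<and>
        (\<forall>q\<in>V. h q \<noteq> 0 \<longrightarrow> F q = g q / h q)"
    by (intro exI[of _ "ball p r"] exI[of _ G] exI[of _ H]) auto
qed

lemma extends_to_imp_meromorphic:
  assumes "extends_to N T" "open T"
  shows "\<exists>F. meromorphic2_on F (UNIV \<times> T) \<and>
    (\<forall>z \<tau>. \<tau> \<in> UHP \<and> varpi z \<tau> \<noteq> 0 \<longrightarrow> F (z, \<tau>) = N z \<tau> / varpi z \<tau>)"
proof -
  obtain G H where GH: "holomorphic2_on G (UNIV \<times> T)" "holomorphic2_on H (UNIV \<times> T)"
     "\<And>\<tau>. \<tau> \<in> T \<Longrightarrow> countable {z. H (z, \<tau>) = 0}"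
     "\<And>\<tau> z. \<tau> \<in> UHP \<Longrightarrow> N z \<tau> * H (z, \<tau>) = G (z, \<tau>) * varpi z \<tau>"
    using extends_toE[OF assms(1)] by metis
  \<comment> \<open>The true quotient takes precedence wherever \<open>varpi\<close> is nonzero: H
    may vanish there as well, and G/H would then be the default value 0.\<close>
  define F where "F = (\<lambda>(z, \<tau>). if \<tau> \<in> UHP \<and> varpi z \<tau> \<noteq> 0 then N z \<tau> / varpi z \<tau> else G (z, \<tau>) / H (z, \<tau>))"
  have "meromorphic2_on F (UNIV \<times> T)"
  proof (rule meromorphic2_onI_quotient[OF _ GH(1,2)])
    show "open (UNIV \<times> T :: (complex \<times> complex) set)" by (intro open_Times open_UNIV assms)
    show "countable {z. H (z, \<tau>) = 0}" if "(z, \<tau>) \<in> UNIV \<times> T" for z \<tau> using GH(3) that by simp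
    fix q assume "H q \<noteq> 0"
    thus "F q = G q / H q"
      using GH(4)[of "snd q" "fst q"] by (cases q) (simp add: F_def field_simps)
  qed
  thus ?thesis by (intro exI[of _ F]) (simp add: F_def)
qed

section \<open>Reduction of a modular matrix to the inversion\<close>

lemma DA_iff:
  assumes "c \<noteq> 0"
  shows "\<tau> \<in> DA c d \<longleftrightarrow> of_int c * \<tau> + of_int d \<notin> \<real>\<^sub>\<le>\<^sub>0"
proof -
  have "of_int c * \<tau> + of_int d \<in> \<real>\<^sub>\<le>\<^sub>0 \<longleftrightarrow> Im \<tau> = 0 \<and> real_of_int c * Re \<tau> + real_of_int d \<le> 0"
    using assms by (auto simp: complex_nonpos_Reals_iff)
  moreover have ex: "(\<exists>x. \<tau> = complex_of_real x \<and> P x) \<longleftrightarrow> Im \<tau> = 0 \<and> P (Re \<tau>)" for P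
    by (auto simp: complex_eq_iff)
  moreover have "\<tau> \<in> DA c d \<longleftrightarrow> \<not> (Im \<tau> = 0 \<and> real_of_int c * Re \<tau> + real_of_int d \<le> 0)"
  proof (cases "c > 0")
    case True
    hence "Re \<tau> \<le> - real_of_int d / real_of_int c \<longleftrightarrow> real_of_int c * Re \<tau> + real_of_int d \<le> 0"
      by (subst pos_le_divide_eq) (auto simp: algebra_simps)
    thus ?thesis using True by (simp add: DA_def ex)
  next
    case False
    hence "real_of_int c < 0" using assms by simp
    hence "- real_of_int d / real_of_int c \<le> Re \<tau> \<longleftrightarrow> real_of_int c * Re \<tau> + real_of_int d \<le> 0"
      by (subst neg_divide_le_eq) (auto simp: algebra_simps)
    thus ?thesis using False assms by (simp add: DA_def ex)
  qed
  ultimately show ?thesis by blast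
qed

lemma open_DA:
  assumes "c \<noteq> 0" shows "open (DA c d)"
proof -
  have "DA c d = (\<lambda>\<tau>. of_int c * \<tau> + of_int d) -` (- \<real>\<^sub>\<le>\<^sub>0)"
    using DA_iff[OF assms] by auto
  thus ?thesis by (simp only:) (intro open_vimage open_cut_plane continuous_intros)
qed

lemma moeb_UHP:
  assumes "a * d - b * c = 1" "\<tau> \<in> UHP"
  shows "moeb a b c d \<tau> \<in> UHP"
proof -
  have "Im ((of_int a * \<tau> + of_int b) * cnj (of_int c * \<tau> + of_int d)) = of_int (a * d - b * c) * Im \<tau>"
    by (simp add: algebra_simps)
  hence "Im ((of_int a * \<tau> + of_int b) * cnj (of_int c * \<tau> + of_int d)) > 0"
    using assms by (simp add: UHP_def)
  thus ?thesis by (simp only: UHP_def moeb_def mem_Collect_eq Im_complex_div_gt_0)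
qed

lemma hol2_at_holomorphic2_on:
  assumes "holomorphic2_on F U" "hol2_at f p" "hol2_at g p" "(f p, g p) \<in> U"
  shows "hol2_at (\<lambda>q. F (f q, g q)) p"
  using hol2_at_compose[OF _ assms(2,3), of F] assms(1,4) by (simp add: holomorphic2_on_iff)

lemma bij_betw_mult_mod:
  fixes m A :: nat
  assumes "m > 0" "coprime A m"
  shows "bij_betw (\<lambda>r. r * A mod m) {..<m} {..<m}"
proof -
  have "inj_on (\<lambda>r. r * A mod m) {..<m}"
  proof (rule linorder_inj_onI')
    fix r r' assume *: "r \<in> {..<m}" "r' \<in> {..<m}" "r < r'"
    show "r * A mod m \<noteq> r' * A mod m"
    proof
      assume "r * A mod m = r' * A mod m"
      hence "m dvd r' * A - r * A" using * by (subst mod_eq_dvd_iff_nat[symmetric]) auto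
      hence "m dvd (r' - r) * A" by (simp add: diff_mult_distrib)
      hence "m dvd r' - r" using assms(2) by (simp add: coprime_dvd_mult_left_iff coprime_commute)
      thus False using * by (auto dest!: dvd_imp_le)
    qed
  qed
  moreover have "(\<lambda>r. r * A mod m) ` {..<m} \<subseteq> {..<m}" using assms(1) by auto
  ultimately show ?thesis by (simp add: bij_betw_def endo_inj_surj)
qed

text \<open>With \<tau>1 = c\<tau> + d one has c (A \<tau>) = a - 1/\<tau>1 and c \<tau> = \<tau>1 -
  d, so decimation modulo c gives both products the periods of the inversion at \<tau>1. The
  arguments match after reducing r a modulo c; coprimality makes this a permutation of residues, and
  a \<ge> 0 makes the quotients natural numbers.\<close>

lemma modular_extension_pos_nonneg:
  assumes det: "a * d - b * c = 1" and c: "c > 0" and a: "a \<ge> 0"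
  shows "extends_to (\<lambda>z \<tau>. varpi (z / (of_int c * \<tau> + of_int d)) (moeb a b c d \<tau>)) (DA c d)"
proof -
  obtain GS HS where S: "holomorphic2_on GS (UNIV \<times> - \<real>\<^sub>\<le>\<^sub>0)" "holomorphic2_on HS (UNIV \<times> - \<real>\<^sub>\<le>\<^sub>0)"
    "\<And>\<tau>. \<tau> \<in> - \<real>\<^sub>\<le>\<^sub>0 \<Longrightarrow> countable {z. HS (z, \<tau>) = 0}"
    "\<And>\<tau> z. \<tau> \<in> UHP \<Longrightarrow> varpi (z / \<tau>) (- 1 / \<tau>) * HS (z, \<tau>) = GS (z, \<tau>) * varpi z \<tau>"
    using extends_toE[OF varpi_inversion] by metis
  define m A where "m = nat c" and "A = nat a"
  have mc: "of_int c = (of_nat m :: complex)" and Aa: "of_int a = (of_nat A :: complex)" and "m > 0"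
    using a c by (simp_all add: m_def A_def)
  have cop: "coprime A m"
  proof -
    have "coprime a c"
    proof (rule coprimeI)
      fix k assume "k dvd a" "k dvd c"
      hence "k dvd a * d - b * c" by simp
      thus "is_unit k" using det by simp
    qed
    thus ?thesis using a c by (simp add: m_def A_def coprime_int_iff[symmetric])
  qed
  define \<tau>1 where "\<tau>1 \<tau> = of_int c * \<tau> + of_int d" for \<tau> :: complex
  define zr where "zr r p = fst p + of_nat r * (of_int a * snd p + of_int b)" for r :: nat and p :: "complex \<times> complex"
  \<comment> \<open>From r a = s + c q follows z + r(a\<tau> + b) = z + s\<tau> + q\<tau>1 plus an
    integer; \<open>X\<close> collects the q factors passed on the way.\<close>
  define s q where "s r = r * A mod m" and "q r = r * A div m" for r
  define X where "X r p = (\<Prod>k<q r. 1 - e (fst p + of_nat (s r) * snd p + of_nat k * \<tau>1 (snd p)))" for r p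
  define G where "G p = (\<Prod>r<m. GS (zr r p, \<tau>1 (snd p)))" for p
  define H where "H p = (\<Prod>r<m. HS (zr r p, \<tau>1 (snd p)) * X r p)" for p
  have \<tau>1: "hol2_at (\<lambda>p. \<tau>1 (snd p)) p" for p unfolding \<tau>1_def by (intro hol2_intros)
  have zr: "hol2_at (zr r) p" for r p unfolding zr_def by (intro hol2_intros)
  have X: "hol2_at (X r) p" for r p unfolding X_def by (intro hol2_intros \<tau>1)
  have np: "\<tau>1 \<tau> \<in> - \<real>\<^sub>\<le>\<^sub>0" if "\<tau> \<in> DA c d" for \<tau>
    using that DA_iff c by (simp add: \<tau>1_def)
  have "hol2_at G p" "hol2_at H p" if "snd p \<in> DA c d" for p
    unfolding G_def H_def
    by (intro hol2_at_prod hol2_at_mult X hol2_at_holomorphic2_on[OF S(1) zr \<tau>1]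
        hol2_at_holomorphic2_on[OF S(2) zr \<tau>1]; use np[OF that] in simp)+
  hence "holomorphic2_on G (UNIV \<times> DA c d)" "holomorphic2_on H (UNIV \<times> DA c d)"
    by (auto simp: holomorphic2_on_iff)
  moreover have "countable {z. H (z, \<tau>) = 0}" if "\<tau> \<in> DA c d" for \<tau>
  proof (rule countable_subset)
    \<comment> \<open>For fixed \<tau> each factor of \<open>X\<close> vanishes only on a translate
      of the integers.\<close>
    show "{z. H (z, \<tau>) = 0} \<subseteq>
      (\<Union>r<m. {z. HS (zr r (z, \<tau>), \<tau>1 \<tau>) = 0} \<union>
        (\<Union>k<q r. range (\<lambda>n::int. of_int n - (of_nat (s r) * \<tau> + of_nat k * \<tau>1 \<tau>))))"
      by (auto simp: H_def X_def right_minus_eq e_eq_1_iff image_iff algebra_simps)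
    have "countable {z. HS (zr r (z, \<tau>), \<tau>1 \<tau>) = 0}" for r
      using countable_affine_preimage[OF S(3)[OF np[OF that]], of 1 "of_nat r * (of_int a * \<tau> + of_int b)"]
      by (simp add: zr_def)
    thus "countable (\<Union>r<m. {z. HS (zr r (z, \<tau>), \<tau>1 \<tau>) = 0} \<union>
        (\<Union>k<q r. range (\<lambda>n::int. of_int n - (of_nat (s r) * \<tau> + of_nat k * \<tau>1 \<tau>))))"
      by (intro countable_UN countable_Un countable_image countableI_type)
  qed
  moreover have "varpi (z / \<tau>1 \<tau>) (moeb a b c d \<tau>) * H (z, \<tau>) = G (z, \<tau>) * varpi z \<tau>" if \<tau>: "\<tau> \<in> UHP" for \<tau> z
  proof -
    define y where "y r = zr r (z, \<tau>)" for r
    have \<tau>1U: "\<tau>1 \<tau> \<in> UHP" using \<tau> c by (simp add: \<tau>1_def UHP_def)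
    hence \<tau>10: "\<tau>1 \<tau> \<noteq> 0" by (rule UHP_nonzero)
    have "of_nat m * moeb a b c d \<tau> = - 1 / \<tau>1 \<tau> + of_int a"
    proof -
      have "of_int c * (of_int a * \<tau> + of_int b) = of_int a * \<tau>1 \<tau> - of_int (a * d - b * c)"
        by (simp add: \<tau>1_def algebra_simps)
      hence "of_int c * (of_int a * \<tau> + of_int b) = of_int a * \<tau>1 \<tau> - 1" by (simp only: det of_int_1)
      hence "of_nat m * (of_int a * \<tau> + of_int b) / \<tau>1 \<tau> = (of_int a * \<tau>1 \<tau> - 1) / \<tau>1 \<tau>" by (simp only: mc)
      also have "\<dots> = - 1 / \<tau>1 \<tau> + of_int a" using \<tau>10 by (simp add: diff_divide_distrib)
      finally show ?thesis unfolding moeb_def \<tau>1_def by simp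
    qed
    hence per: "varpi x (of_nat m * moeb a b c d \<tau>) = varpi x (- 1 / \<tau>1 \<tau>)" for x
      by (simp only: varpi_add_of_int_right)
    have num: "varpi (z / \<tau>1 \<tau>) (moeb a b c d \<tau>) = (\<Prod>r<m. varpi (y r / \<tau>1 \<tau>) (- 1 / \<tau>1 \<tau>))"
    proof -
      have "z / \<tau>1 \<tau> + of_nat r * moeb a b c d \<tau> = y r / \<tau>1 \<tau>" for r
        unfolding y_def zr_def moeb_def \<tau>1_def fst_conv snd_conv
        by (simp only: add_divide_distrib[of z] times_divide_eq_right)
      thus ?thesis
        using varpi_decimate[OF moeb_UHP[OF det \<tau>] \<open>m > 0\<close>, of "z / \<tau>1 \<tau>"] by (simp only: per)
    qed
    have "of_nat m * \<tau> = \<tau>1 \<tau> + of_int (- d)" by (simp add: \<tau>1_def mc)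
    hence "varpi z \<tau> = (\<Prod>r<m. varpi (z + of_nat r * \<tau>) (\<tau>1 \<tau>))"
      using varpi_decimate[OF \<tau> \<open>m > 0\<close>, of z] by (simp only: varpi_add_of_int_right)
    also have "\<dots> = (\<Prod>r<m. varpi (z + of_nat (s r) * \<tau>) (\<tau>1 \<tau>))"
      unfolding s_def
      by (rule prod.reindex_bij_betw[OF bij_betw_mult_mod[OF \<open>m > 0\<close> cop], symmetric])
    also have "\<dots> = (\<Prod>r<m. X r (z, \<tau>) * varpi (y r) (\<tau>1 \<tau>))"
    proof (rule prod.cong[OF refl])
      fix r
      have rA: "of_nat r * of_nat A = (of_nat (s r + m * q r) :: complex)"
        unfolding s_def q_def by (simp only: mod_mult_div_eq of_nat_mult)
      have "y r = z + (of_nat r * of_nat A) * \<tau> + of_nat r * of_int b"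
        by (simp add: y_def zr_def Aa algebra_simps)
      hence "y r = z + of_nat (s r) * \<tau> + of_nat (q r) * \<tau>1 \<tau> + of_int (int r * b - int (q r) * d)"
        unfolding rA by (simp add: \<tau>1_def mc algebra_simps)
      hence "varpi (y r) (\<tau>1 \<tau>) = varpi (z + of_nat (s r) * \<tau> + of_nat (q r) * \<tau>1 \<tau>) (\<tau>1 \<tau>)"
        by (simp only: varpi_add_of_int)
      thus "varpi (z + of_nat (s r) * \<tau>) (\<tau>1 \<tau>) = X r (z, \<tau>) * varpi (y r) (\<tau>1 \<tau>)"
        using varpi_shift_nat[OF \<tau>1U, of "z + of_nat (s r) * \<tau>" "q r"] by (simp add: X_def)
    qed
    finally have den: "varpi z \<tau> = (\<Prod>r<m. X r (z, \<tau>) * varpi (y r) (\<tau>1 \<tau>))" .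
    have "varpi (z / \<tau>1 \<tau>) (moeb a b c d \<tau>) * H (z, \<tau>) =
        (\<Prod>r<m. (varpi (y r / \<tau>1 \<tau>) (- 1 / \<tau>1 \<tau>) * HS (y r, \<tau>1 \<tau>)) * X r (z, \<tau>))"
      unfolding num H_def y_def by (simp add: prod.distrib mult.assoc)
    also have "\<dots> = G (z, \<tau>) * varpi z \<tau>"
      unfolding S(4)[OF \<tau>1U] den G_def y_def by (simp add: prod.distrib mult_ac)
    finally show ?thesis .
  qed
  ultimately show ?thesis unfolding \<tau>1_def by (rule extends_toI)
qed

text \<open>Left multiplication by a translation adds t to A \<tau>, which \<open>varpi\<close> does
  not see, and replaces a by a + t c. The choice t = |a| works because c \<ge> 1.\<close>

lemma modular_extension_pos:
  assumes det: "a * d - b * c = 1" and c: "c > 0"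
  shows "extends_to (\<lambda>z \<tau>. varpi (z / (of_int c * \<tau> + of_int d)) (moeb a b c d \<tau>)) (DA c d)"
proof -
  define t where "t = \<bar>a\<bar>"
  have "\<bar>a\<bar> * 1 \<le> \<bar>a\<bar> * c" using c by (intro mult_left_mono) auto
  hence "a + t * c \<ge> 0" by (simp add: t_def)
  moreover have "(a + t * c) * d - (b + t * d) * c = 1" using det by (simp add: algebra_simps)
  ultimately have *: "extends_to (\<lambda>z \<tau>. varpi (z / (of_int c * \<tau> + of_int d)) (moeb (a + t * c) (b + t * d) c d \<tau>)) (DA c d)"
    using modular_extension_pos_nonneg c by blast
  have "varpi x (moeb (a + t * c) (b + t * d) c d \<tau>) = varpi x (moeb a b c d \<tau>)" if "\<tau> \<in> UHP" for x \<tau>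
  proof -
    have "of_int c * \<tau> + of_int d \<noteq> 0"
      using that c by (auto simp: complex_eq_iff UHP_def)
    hence "moeb (a + t * c) (b + t * d) c d \<tau> = moeb a b c d \<tau> + of_int t"
      by (simp add: moeb_def field_simps)
    thus ?thesis by simp
  qed
  with * show ?thesis by (simp add: extends_to_def)
qed

lemma varpi_cnj:
  assumes "\<tau> \<in> UHP"
  shows "varpi (- cnj z) (- cnj \<tau>) = cnj (varpi z \<tau>)"
proof -
  have \<tau>': "- cnj \<tau> \<in> UHP" using assms by (simp add: UHP_def)
  have "e (- cnj x) = cnj (e x)" for x
    by (simp add: e_def exp_cnj)
  moreover have "- cnj z + of_nat k * - cnj \<tau> = - cnj (z + of_nat k * \<tau>)" for k by simp
  ultimately have "(\<Prod>k<n. 1 - e (- cnj z + of_nat k * - cnj \<tau>)) = cnj (\<Prod>k<n. 1 - e (z + of_nat k * \<tau>))" for n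
    by (simp only: cnj_prod complex_cnj_diff complex_cnj_one)
  hence "(\<lambda>n. \<Prod>k<n. 1 - e (- cnj z + of_nat k * - cnj \<tau>)) \<longlonglongrightarrow> cnj (varpi z \<tau>)"
    using tendsto_cnj[OF varpi_LIMSEQ[OF assms, of z]] by (simp only:)
  from LIMSEQ_unique[OF varpi_LIMSEQ[OF \<tau>', of "- cnj z"] this] show ?thesis .
qed

text \<open>Schwarz reflection: the inner and the outer conjugation together make the derivative
  complex linear again.\<close>

lemma hol2_at_cnj:
  assumes "hol2_at f (- cnj z, - cnj \<tau>)"
  shows "hol2_at (\<lambda>p. cnj (f (- cnj (fst p), - cnj (snd p)))) (z, \<tau>)"
proof -
  obtain a b where "(f has_derivative (\<lambda>(u, v). a * u + b * v)) (at (- cnj z, - cnj \<tau>))"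
    using assms unfolding hol2_at_def by blast
  moreover have "((\<lambda>p. (- cnj (fst p), - cnj (snd p))) has_derivative (\<lambda>h. (- cnj (fst h), - cnj (snd h)))) (at (z, \<tau>))"
    by (auto intro!: derivative_eq_intros bounded_linear.has_derivative[OF bounded_linear_cnj])
  ultimately have "((\<lambda>p. f (- cnj (fst p), - cnj (snd p))) has_derivative
      (\<lambda>h. a * (- cnj (fst h)) + b * (- cnj (snd h)))) (at (z, \<tau>))"
    using has_derivative_compose[of "\<lambda>p. (- cnj (fst p), - cnj (snd p))" _ "(z, \<tau>)" UNIV f] by fastforce
  from bounded_linear.has_derivative[OF bounded_linear_cnj this]
  show ?thesis unfolding hol2_at_def
    by (intro exI[of _ "- cnj a"] exI[of _ "- cnj b"]) (simp add: case_prod_beta' algebra_simps)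
qed

text \<open>Reflection turns (a, b, c, d) into (a, -b, -c, d) with the same determinant and
  conjugates c\<tau> + d, and the cut is invariant under conjugation. Passing to -A instead would
  replace z by -z and bring in varpi(-z)/varpi(z), which is handled here only over the upper half
  plane.\<close>

lemma modular_extension_neg:
  assumes det: "a * d - b * c = 1" and c: "c < 0"
  shows "extends_to (\<lambda>z \<tau>. varpi (z / (of_int c * \<tau> + of_int d)) (moeb a b c d \<tau>)) (DA c d)"
proof -
  have det': "a * d - (- b) * (- c) = 1" using det by simp
  obtain G H where GH: "holomorphic2_on G (UNIV \<times> DA (- c) d)" "holomorphic2_on H (UNIV \<times> DA (- c) d)"
     "\<And>\<tau>. \<tau> \<in> DA (- c) d \<Longrightarrow> countable {z. H (z, \<tau>) = 0}"
     "\<And>\<tau> z. \<tau> \<in> UHP \<Longrightarrow> varpi (z / (of_int (- c) * \<tau> + of_int d)) (moeb a (- b) (- c) d \<tau>) * H (z, \<tau>) =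
        G (z, \<tau>) * varpi z \<tau>"
  proof -
    have "- c > 0" using c by simp
    from extends_toE[OF modular_extension_pos[OF det' this]] that show thesis by metis
  qed
  define J where "J f p = cnj (f (- cnj (fst p), - cnj (snd p)))" for f :: "complex \<times> complex \<Rightarrow> complex" and p
  have DA: "- cnj \<tau> \<in> DA (- c) d" if "\<tau> \<in> DA c d" for \<tau>
  proof -
    have eq: "of_int (- c) * (- cnj \<tau>) + of_int d = cnj (of_int c * \<tau> + of_int d)" by simp
    have "cnj x \<in> \<real>\<^sub>\<le>\<^sub>0 \<longleftrightarrow> x \<in> \<real>\<^sub>\<le>\<^sub>0" for x by (simp add: complex_nonpos_Reals_iff)
    hence "of_int (- c) * (- cnj \<tau>) + of_int d \<notin> \<real>\<^sub>\<le>\<^sub>0"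
      unfolding eq using that DA_iff[of c \<tau> d] c by (metis less_irrefl)
    thus ?thesis using DA_iff[of "- c" "- cnj \<tau>" d] c by simp
  qed
  have hol: "holomorphic2_on (J f) (UNIV \<times> DA c d)" if "holomorphic2_on f (UNIV \<times> DA (- c) d)" for f
    using that DA hol2_at_cnj[of f] by (auto simp: holomorphic2_on_iff J_def[abs_def])
  have cnt: "countable {z. J H (z, \<tau>) = 0}" if "\<tau> \<in> DA c d" for \<tau>
  proof -
    have "{z. J H (z, \<tau>) = 0} = (\<lambda>z. - cnj z) ` {z. H (z, - cnj \<tau>) = 0}"
      by (auto simp: J_def image_iff intro!: exI[of _ "- cnj _"])
    thus ?thesis using GH(3)[OF DA[OF that]] by simp
  qed
  have "varpi (z / (of_int c * \<tau> + of_int d)) (moeb a b c d \<tau>) * J H (z, \<tau>) = J G (z, \<tau>) * varpi z \<tau>"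
    if \<tau>: "\<tau> \<in> UHP" for \<tau> z
  proof -
    have \<tau>': "- cnj \<tau> \<in> UHP" using \<tau> by (simp add: UHP_def)
    have 1: "- cnj z / (of_int (- c) * - cnj \<tau> + of_int d) = - cnj (z / (of_int c * \<tau> + of_int d))" by simp
    have 2: "moeb a (- b) (- c) d (- cnj \<tau>) = - cnj (moeb a b c d \<tau>)"
    proof -
      have "of_int a * - cnj \<tau> + of_int (- b) = - cnj (of_int a * \<tau> + of_int b)"
        "of_int (- c) * - cnj \<tau> + of_int d = cnj (of_int c * \<tau> + of_int d)" by simp_all
      thus ?thesis by (simp only: moeb_def complex_cnj_divide minus_divide_left)
    qed
    have "cnj (varpi (z / (of_int c * \<tau> + of_int d)) (moeb a b c d \<tau>)) * H (- cnj z, - cnj \<tau>) =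
      G (- cnj z, - cnj \<tau>) * cnj (varpi z \<tau>)"
      using GH(4)[OF \<tau>', of "- cnj z"] unfolding 1 2 varpi_cnj[OF moeb_UHP[OF det \<tau>]] varpi_cnj[OF \<tau>] .
    from arg_cong[OF this, of cnj] show ?thesis by (simp add: J_def)
  qed
  from extends_toI[OF hol[OF GH(1)] hol[OF GH(2)] cnt this] show ?thesis .
qed

lemma modular_extension:
  assumes det: "a * d - b * c = 1"
  shows "open (DA c d)"
    and "extends_to (\<lambda>z \<tau>. varpi (z / (of_int c * \<tau> + of_int d)) (moeb a b c d \<tau>)) (DA c d)"
proof -
  have "open (DA c d) \<and> extends_to (\<lambda>z \<tau>. varpi (z / (of_int c * \<tau> + of_int d)) (moeb a b c d \<tau>)) (DA c d)"
  proof (cases "c = 0")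
    case False
    thus ?thesis
      using open_DA modular_extension_pos[OF det] modular_extension_neg[OF det] by (cases "c > 0") auto
  next
    case True
    hence ad: "a = d" "d = 1 \<or> d = -1" using det zmult_eq_1_iff by auto
    show ?thesis
    proof (cases "d = 1")
      case d: True
      have "varpi (z / (of_int c * \<tau> + of_int d)) (moeb a b c d \<tau>) = varpi z \<tau>" for z \<tau>
        using True d ad by (simp add: moeb_def)
      moreover have "extends_to varpi UNIV"
        by (rule extends_toI[of "\<lambda>_. 1" _ "\<lambda>_. 1"]) (auto simp: holomorphic2_on_iff hol2_at_const)
      ultimately show ?thesis using True d by (simp add: DA_def)
    next
      \<comment> \<open>Now A \<tau> = \<tau> - b and z/d = -z: the quotient is varpi(-z)/varpi(z),
        a ratio of functions already holomorphic over \<open>UHP\<close>, which is the whole domain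
        \<open>DA\<close> in this case.\<close>
      case d: False
      have "moeb a b c d \<tau> = \<tau> + of_int (- b)" for \<tau>
        using True d ad by (simp add: moeb_def)
      hence "varpi (z / (of_int c * \<tau> + of_int d)) (moeb a b c d \<tau>) = varpi (- z) \<tau>" for z \<tau>
        using True d ad by (simp only: varpi_add_of_int_right) simp
      moreover have "extends_to (\<lambda>z. varpi (- z)) UHP"
      proof (rule extends_toI[of "\<lambda>p. varpi (- fst p) (snd p)" _ "\<lambda>p. varpi (fst p) (snd p)"])
        show "holomorphic2_on (\<lambda>p. varpi (- fst p) (snd p)) (UNIV \<times> UHP)"
          unfolding holomorphic2_on_iff by (auto intro!: hol2_at_varpi hol2_intros)
        show "countable {z. varpi (fst (z, \<tau>)) (snd (z, \<tau>)) = 0}" if "\<tau> \<in> UHP" for \<tau>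
        proof (rule countable_subset)
          show "{z. varpi (fst (z, \<tau>)) (snd (z, \<tau>)) = 0} \<subseteq> range (\<lambda>(n::int, k::nat). of_int n - of_nat k * \<tau>)"
            using varpi_eq_0_iff[OF that] by auto
          show "countable (range (\<lambda>(n::int, k::nat). of_int n - of_nat k * \<tau>))"
            by (intro countable_image countableI_type)
        qed
      qed (auto simp: holomorphic2_on_varpi)
      ultimately show ?thesis using True d ad open_UHP by (simp add: DA_def)
    qed
  qed
  thus "open (DA c d)"
    and "extends_to (\<lambda>z \<tau>. varpi (z / (of_int c * \<tau> + of_int d)) (moeb a b c d \<tau>)) (DA c d)"
    by auto
qed

theorem theorem4p29:
  shows "(\<forall>z \<tau> (m::int) (n::int). \<tau> \<in> UHP \<and> qpoch (e z) (e \<tau>) m \<noteq> 0 \<longrightarrow>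
            varpi (z + of_int m * \<tau> + of_int n) \<tau> = inverse (qpoch (e z) (e \<tau>) m) * varpi z \<tau>)
       \<and> (\<forall>a b c d :: int. a * d - b * c = 1 \<longrightarrow>
            (\<exists>F. meromorphic2_on F (UNIV \<times> DA c d) \<and>
                 (\<forall>z \<tau>. \<tau> \<in> UHP \<and> varpi z \<tau> \<noteq> 0 \<longrightarrow>
                    F (z, \<tau>) = varpi (z / (of_int c * \<tau> + of_int d)) (moeb a b c d \<tau>) / varpi z \<tau>)))"
proof (intro conjI allI impI)
  fix z \<tau> and m n :: int assume "\<tau> \<in> UHP \<and> qpoch (e z) (e \<tau>) m \<noteq> 0"
  thus "varpi (z + of_int m * \<tau> + of_int n) \<tau> = inverse (qpoch (e z) (e \<tau>) m) * varpi z \<tau>"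
    using varpi_quasi_periodic by blast
next
  fix a b c d :: int assume "a * d - b * c = 1"
  from extends_to_imp_meromorphic[OF modular_extension(2)[OF this] modular_extension(1)[OF this]]
  show "\<exists>F. meromorphic2_on F (UNIV \<times> DA c d) \<and>
                 (\<forall>z \<tau>. \<tau> \<in> UHP \<and> varpi z \<tau> \<noteq> 0 \<longrightarrow>
                    F (z, \<tau>) = varpi (z / (of_int c * \<tau> + of_int d)) (moeb a b c d \<tau>) / varpi z \<tau>)" .
qed

end
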